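(* The problem of finding a strong Nash equilibrium of a bimatrix game $\Gamma=(U_1,U_2^t)$ is in Smoothed-$\mathcal{P}$. That is, there is an algorithm which, given a bimatrix game $(U_1,U_2^t)$, returns a strong Nash equilibrium if one exists and reports non-existence otherwise, and whose expected running time, once a perturbation uniformly distributed on $[-\sigma,+\sigma]$ (with $\sigma>0$) is applied independently to each entry of the bimatrix, is polynomial in the size of the game, i.e. in the numbers of actions $m_1$ and $m_2$ of the two players.
   Context: In the bimatrix game $(U_1,U_2^t)$, $U_1\in\mathbb{R}^{m_1\times m_2}$ and $U_2\in\mathbb{R}^{m_2\times m_1}$; a mixed strategy of player $i$ is a vector $x_i$ in the simplex $\Delta_i=\{x_i\in\mathbb{R}^{m_i}: x_i\ge 0,\ \sum_k x_{ik}=1\}$. At the profile $x=(x_1,x_2)$ player 1 gets $v_1(x)=x_1^tU_1x_2$ and player 2 gets $v_2(x)=x_2^tU_2x_1$. A Nash equilibrium is a profile at which no player can strictly increase her own utility by unilaterally changing her mixed strategy. A strong Nash equilibrium is a Nash equilibrium $\bar x$ that is weakly Pareto efficient for every coalition (nonempty subset of players) $C$: there is no profile $y$, with $y_i=\bar x_i$ for all $i\notin C$ and $y_i\in\Delta_i$ for $i\in C$, such that $v_i(y)>v_i(\bar x)$ for all $i\in C$. Smoothed-$\mathcal{P}$ is the class of problems solvable in smoothed polynomial time; for the present problem membership means the expected-running-time property written out in the claim. *)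

theory Defs
  imports "HOL-Probability.Probability" "Jordan_Normal_Form.Matrix"
begin

no_notation Finite_Cartesian_Product.vec_nth (infixl \<open>$\<close> 90)
no_notation Inner_Product.inner (infix \<open>\<bullet>\<close> 70)

section \<open>Bimatrix games and strong Nash equilibria\<close>

datatype player = P1 | P2

type_synonym profile = "player \<Rightarrow> real vec"

text \<open>Rows of \<open>U1\<close> and columns of \<open>U2\<close> are the actions of player 1; columns of \<open>U1\<close> and rows
  of \<open>U2\<close> are the actions of player 2.\<close>

definition bimatrix_game :: "real mat \<Rightarrow> real mat \<Rightarrow> bool" where
  "bimatrix_game U1 U2 \<longleftrightarrow>
     (\<exists>m1 \<ge> 1. \<exists>m2 \<ge> 1. U1 \<in> carrier_mat m1 m2 \<and> U2 \<in> carrier_mat m2 m1)"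

definition actions :: "real mat \<Rightarrow> player \<Rightarrow> nat" where
  "actions U1 i = (case i of P1 \<Rightarrow> dim_row U1 | P2 \<Rightarrow> dim_col U1)"

definition mixed_strategies :: "nat \<Rightarrow> real vec set" where
  "mixed_strategies m = {x \<in> carrier_vec m. (\<forall>k<m. 0 \<le> x $ k) \<and> (\<Sum>k<m. x $ k) = 1}"

definition utility :: "real mat \<Rightarrow> real mat \<Rightarrow> player \<Rightarrow> profile \<Rightarrow> real" where
  "utility U1 U2 i x =
     (case i of P1 \<Rightarrow> x P1 \<bullet> (U1 *\<^sub>v x P2) | P2 \<Rightarrow> x P2 \<bullet> (U2 *\<^sub>v x P1))"

definition nash_equilibrium :: "real mat \<Rightarrow> real mat \<Rightarrow> profile \<Rightarrow> bool" where
  "nash_equilibrium U1 U2 x \<longleftrightarrow>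
     (\<forall>i. x i \<in> mixed_strategies (actions U1 i)) \<and>
     (\<forall>i. \<not> (\<exists>z \<in> mixed_strategies (actions U1 i). utility U1 U2 i (x(i := z)) > utility U1 U2 i x))"

definition weakly_pareto_efficient :: "real mat \<Rightarrow> real mat \<Rightarrow> player set \<Rightarrow> profile \<Rightarrow> bool" where
  "weakly_pareto_efficient U1 U2 C x \<longleftrightarrow>
     \<not> (\<exists>y. (\<forall>i. i \<notin> C \<longrightarrow> y i = x i) \<and> (\<forall>i\<in>C. y i \<in> mixed_strategies (actions U1 i)) \<and>
           (\<forall>i\<in>C. utility U1 U2 i y > utility U1 U2 i x))"

definition strong_nash_equilibrium :: "real mat \<Rightarrow> real mat \<Rightarrow> profile \<Rightarrow> bool" where
  "strong_nash_equilibrium U1 U2 x \<longleftrightarrow>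
     nash_equilibrium U1 U2 x \<and> (\<forall>C. C \<noteq> {} \<longrightarrow> weakly_pareto_efficient U1 U2 C x)"

section \<open>Algorithms over the reals\<close>

text \<open>
  The perturbed inputs are real numbers, so algorithms are programs with exact real arithmetic,
  charged by the unit-cost measure as on a real RAM or a Blum-Shub-Smale machine.  The programming
  language is first-order and call-by-value, with general recursion; its data are binary trees with
  real leaves.  One program serves games of all sizes.  Programs contain integer constants only, so
  that no information can be hidden in a real constant, and there is no rounding operation.
\<close>

datatype val = Null | Num real | Cell val val

datatype unop = Fst | Snd

datatype binop = Mk_Cell | Add | Sub | Mul | Div | Less

text \<open>Ill-typed applications return \<open>Null\<close>.  A test is false iff it returns \<open>Null\<close>.  Division by
  zero returns zero, as in HOL.\<close>

fun app1 :: "unop \<Rightarrow> val \<Rightarrow> val" where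
  "app1 Fst (Cell a b) = a"
| "app1 Snd (Cell a b) = b"
| "app1 _ _ = Null"

fun app2 :: "binop \<Rightarrow> val \<Rightarrow> val \<Rightarrow> val" where
  "app2 Mk_Cell a b = Cell a b"
| "app2 Add (Num x) (Num y) = Num (x + y)"
| "app2 Sub (Num x) (Num y) = Num (x - y)"
| "app2 Mul (Num x) (Num y) = Num (x * y)"
| "app2 Div (Num x) (Num y) = Num (x / y)"
| "app2 Less (Num x) (Num y) = (if x < y then Cell Null Null else Null)"
| "app2 _ _ _ = Null"

text \<open>Variables are de Bruijn indices: \<open>LetIn t u\<close> binds the value of \<open>t\<close> to index 0 in \<open>u\<close>.
  A program is the list of its function bodies; each function has one parameter, which is index 0
  in its body, and \<open>Call f t\<close> applies the function at position \<open>f\<close>.\<close>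

datatype trm =
    Var nat
  | Empty
  | Const int
  | Op1 unop trm
  | Op2 binop trm trm
  | Cond trm trm trm
  | LetIn trm trm
  | Call nat trm

type_synonym program = "trm list"

text \<open>\<open>eval P env t v n\<close>: in environment \<open>env\<close> the term \<open>t\<close> evaluates to \<open>v\<close> in \<open>n\<close> elementary
  steps.\<close>

inductive eval :: "program \<Rightarrow> val list \<Rightarrow> trm \<Rightarrow> val \<Rightarrow> nat \<Rightarrow> bool" for P :: program where
  Var: "i < length env \<Longrightarrow> eval P env (Var i) (env ! i) 1"
| Empty: "eval P env Empty Null 1"
| Const: "eval P env (Const k) (Num (of_int k)) 1"
| Op1: "eval P env t a n \<Longrightarrow> eval P env (Op1 f t) (app1 f a) (n + 1)"
| Op2: "eval P env t a n \<Longrightarrow> eval P env u b m \<Longrightarrow> eval P env (Op2 f t u) (app2 f a b) (n + m + 1)"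
| Cond_True: "eval P env s a n \<Longrightarrow> a \<noteq> Null \<Longrightarrow> eval P env t v m \<Longrightarrow>
    eval P env (Cond s t u) v (n + m + 1)"
| Cond_False: "eval P env s Null n \<Longrightarrow> eval P env u v m \<Longrightarrow>
    eval P env (Cond s t u) v (n + m + 1)"
| LetIn: "eval P env t a n \<Longrightarrow> eval P (a # env) u v m \<Longrightarrow>
    eval P env (LetIn t u) v (n + m + 1)"
| Call: "eval P env t a n \<Longrightarrow> f < length P \<Longrightarrow> eval P [a] (P ! f) v m \<Longrightarrow>
    eval P env (Call f t) v (n + m + 1)"

inductive_cases eval_VarE: "eval P env (Var i) v n"
inductive_cases eval_EmptyE: "eval P env Empty v n"
inductive_cases eval_ConstE: "eval P env (Const k) v n"
inductive_cases eval_Op1E: "eval P env (Op1 f t) v n"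
inductive_cases eval_Op2E: "eval P env (Op2 f t u) v n"
inductive_cases eval_CondE: "eval P env (Cond s t u) v n"
inductive_cases eval_LetInE: "eval P env (LetIn t u) v n"
inductive_cases eval_CallE: "eval P env (Call f t) v n"

lemma eval_deterministic:
  "eval P env t v n \<Longrightarrow> eval P env t v' n' \<Longrightarrow> v' = v \<and> n' = n"
proof (induction arbitrary: v' n' rule: eval.induct)
  case Var from Var.prems show ?case by (rule eval_VarE) simp
next
  case Empty from Empty.prems show ?case by (rule eval_EmptyE) simp
next
  case Const from Const.prems show ?case by (rule eval_ConstE) simp
next
  case Op1 from Op1.prems show ?case by (rule eval_Op1E) (auto dest: Op1.IH)
next
  case Op2 from Op2.prems show ?case by (rule eval_Op2E) (auto dest: Op2.IH)
next
  case Cond_True from Cond_True.prems show ?case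
    by (rule eval_CondE) (use Cond_True.hyps in \<open>auto dest: Cond_True.IH\<close>)
next
  case Cond_False from Cond_False.prems show ?case
    by (rule eval_CondE) (auto dest: Cond_False.IH)
next
  case LetIn from LetIn.prems show ?case by (rule eval_LetInE) (auto dest: LetIn.IH)
next
  case Call from Call.prems show ?case by (rule eval_CallE) (auto dest: Call.IH)
qed

text \<open>The function at position 0 is the entry point.\<close>

definition runs :: "program \<Rightarrow> val \<Rightarrow> val \<Rightarrow> nat \<Rightarrow> bool" where
  "runs P a r n \<longleftrightarrow> eval P [a] (Call 0 (Var 0)) r n"

text \<open>By determinism the set below has at most one element; it is empty, and the infimum is
  \<open>\<infinity>\<close>, iff \<open>P\<close> does not halt on \<open>a\<close>.\<close>

definition running_time :: "program \<Rightarrow> val \<Rightarrow> ennreal" where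
  "running_time P a = Inf {of_nat n | r n. runs P a r n}"

section \<open>The search problem and its smoothed complexity\<close>

fun list_val :: "val list \<Rightarrow> val" where
  "list_val [] = Null"
| "list_val (v # vs) = Cell v (list_val vs)"

definition vec_val :: "real vec \<Rightarrow> val" where
  "vec_val x = list_val (map Num (list_of_vec x))"

definition mat_val :: "real mat \<Rightarrow> val" where
  "mat_val A = list_val (map vec_val (rows A))"

definition game_val :: "real mat \<Rightarrow> real mat \<Rightarrow> val" where
  "game_val U1 U2 = Cell (mat_val U1) (mat_val U2)"

definition profile_val :: "profile \<Rightarrow> val" where
  "profile_val x = Cell (vec_val (x P1)) (vec_val (x P2))"

text \<open>Non-existence is reported by the answer \<open>Null\<close>, which encodes no profile.\<close>

definition finds_strong_nash :: "program \<Rightarrow> bool" where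
  "finds_strong_nash P \<longleftrightarrow>
     (\<forall>U1 U2. bimatrix_game U1 U2 \<longrightarrow>
       (\<exists>r n. runs P (game_val U1 U2) r n \<and>
         (if \<exists>x. strong_nash_equilibrium U1 U2 x
          then \<exists>x. strong_nash_equilibrium U1 U2 x \<and> r = profile_val x
          else r = Null)))"

text \<open>The joint law of independent uniform perturbations of all entries of the two matrices.\<close>

definition perturbation ::
    "real \<Rightarrow> nat \<Rightarrow> nat \<Rightarrow> ((nat \<times> nat \<Rightarrow> real) \<times> (nat \<times> nat \<Rightarrow> real)) measure" where
  "perturbation \<sigma> m1 m2 =
     (\<Pi>\<^sub>M ij \<in> {..<m1} \<times> {..<m2}. uniform_measure lborel {-\<sigma>..\<sigma>}) \<Otimes>\<^sub>M
     (\<Pi>\<^sub>M ij \<in> {..<m2} \<times> {..<m1}. uniform_measure lborel {-\<sigma>..\<sigma>})"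

definition perturbed_time ::
    "program \<Rightarrow> real mat \<Rightarrow> real mat \<Rightarrow> (nat \<times> nat \<Rightarrow> real) \<times> (nat \<times> nat \<Rightarrow> real) \<Rightarrow> ennreal" where
  "perturbed_time P U1 U2 = (\<lambda>(d1, d2).
     running_time P (game_val (U1 + mat (dim_row U1) (dim_col U1) d1)
                              (U2 + mat (dim_row U2) (dim_col U2) d2)))"

text \<open>The bound depends neither on the unperturbed game nor on \<open>\<sigma>\<close>.  Measurability is demanded
  because \<open>nn_integral\<close> of a non-measurable function is only a lower integral.\<close>

definition smoothed_polynomial_time :: "program \<Rightarrow> bool" where
  "smoothed_polynomial_time P \<longleftrightarrow>
     (\<exists>c k :: nat. \<forall>\<sigma> > 0. \<forall>m1 \<ge> 1. \<forall>m2 \<ge> 1.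
       \<forall>U1 \<in> carrier_mat m1 m2. \<forall>U2 \<in> carrier_mat m2 m1.
         perturbed_time P U1 U2 \<in> borel_measurable (perturbation \<sigma> m1 m2) \<and>
         (\<integral>\<^sup>+ d. perturbed_time P U1 U2 d \<partial>perturbation \<sigma> m1 m2) \<le> of_nat (c * (m1 + m2) ^ k))"

end

theory Submission
  imports Defs
begin

text \<open>
  For a fixed mixed strategy of one player the payoff pairs of the other player's actions are points
  of the plane, so a profile that is better for both players can be found on two actions of each
  player.  Weak Pareto efficiency of a given profile is therefore decided by one constant-size
  problem for each two by two block of actions.

  If both supports of a strong equilibrium have at least two actions, then moving inside the supports
  changes the utilities by bilinear forms that are never both positive.  Such forms are proportional
  unless one of the payoff matrices is constant along a line of the support, so the payoff pairs of
  every two by two block of the support have three collinear vertices.  After a perturbation this has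
  probability zero, and so has a tie between two payoffs in the same column of \<open>U1\<close> or of \<open>U2\<close>.
  Hence almost surely only the \<open>m1 * m2\<close> pure profiles must be tested.

  In the remaining games the algorithm tests all pairs of vertices of the arrangements of indifference
  hyperplanes in the two simplices: if \<open>x\<close> is a strong equilibrium, then in the regions of the
  arrangements that contain \<open>x\<close> there are vertices at which the equilibrium conditions persist and
  the utilities are at least as large.
\<close>

section \<open>Domination involves two actions of each player\<close>

text \<open>The answer must be correct for every game, while time counts only outside a null set. So
  the exhaustive search is merely shown to terminate; what must be cheap is the pure search together
  with the recognition of a generic input. Genericity is therefore stated as the failure of finitely
  many polynomial equations in two by two blocks. The language has field operations and
  \<open><\<close>, but no roots. Candidates are produced by intersecting segments with hyperplanes,
  and domination in a block, a quadratic question in the row mixture, is decided by signs and a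
  discriminant, without computing a dominating profile. The bilinear forms are second-order terms.
  At an equilibrium a move inside the own support does not change the own utility to first order; it
  changes the opponent's utility by a linear term, and the two moves together change both utilities
  by bilinear terms. If some linear term is nonzero, one bilinear form vanishes, which gives a tie;
  if all linear terms vanish, the two bilinear forms never share a strict sign, which gives
  collinearity.\<close>

lemma two_support:
  fixes z f g :: "'a \<Rightarrow> real"
  assumes K: "finite K" "\<And>k. k \<in> K \<Longrightarrow> 0 \<le> z k"
    and f: "0 < (\<Sum>k\<in>K. z k * f k)" and g: "0 < (\<Sum>k\<in>K. z k * g k)"
  shows "\<exists>i\<in>K. \<exists>j\<in>K. 0 < f i \<and> 0 < g j \<and> (i = j \<or> f j * g i < f i * g j)"
proof (rule ccontr)
  assume no: "\<not> ?thesis"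
  have "\<exists>k\<in>K. 0 < f k"
  proof (rule ccontr)
    assume "\<not> ?thesis"
    then have "(\<Sum>k\<in>K. z k * f k) \<le> 0" using K by (intro sum_nonpos mult_nonneg_nonpos) force+
    with f show False by simp
  qed
  then have P: "finite {k\<in>K. 0 < f k}" "{k\<in>K. 0 < f k} \<noteq> {}" using K by auto
  \<comment> \<open>\<open>i\<close> has the greatest slope among the points
    \<open>(f k, g k)\<close> with \<open>0 < f k\<close>. If no pair works, all points lie weakly
    below the line through the origin and point \<open>i\<close>, and \<open>g i \<le> 0\<close>;
    then the mean cannot lie in the open first quadrant.\<close>
  obtain i where "i \<in> {k\<in>K. 0 < f k}"
    and "\<not> (\<exists>x\<in>{k\<in>K. 0 < f k}. - (g x / f x) < - (g i / f i))"
    using arg_min_if_finite[OF P, of "\<lambda>k. - (g k / f k)"] by blast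
  then have i: "i \<in> K" "0 < f i" and m: "\<And>k. k \<in> K \<Longrightarrow> 0 < f k \<Longrightarrow> g k / f k \<le> g i / f i"
    by (auto simp: not_less)
  have gi: "g i \<le> 0" using no i by (metis not_less)
  have "z k * (f i * g k - g i * f k) \<le> 0" if k: "k \<in> K" for k
  proof (rule mult_nonneg_nonpos[OF K(2)[OF k]])
    show "f i * g k - g i * f k \<le> 0"
    proof (cases "0 < f k")
      case True
      from m[OF k True] i True show ?thesis by (simp add: field_simps)
    next
      case False
      show ?thesis
      proof (cases "0 < g k")
        case True
        with no i k have "\<not> f k * g i < f i * g k" by blast
        then show ?thesis by (simp add: mult.commute)
      next
        case gk: False
        have "f i * g k \<le> 0" using i gk by (intro mult_nonneg_nonpos) auto
        moreover have "0 \<le> g i * f k" using gi False by (intro mult_nonpos_nonpos) auto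
        ultimately show ?thesis by simp
      qed
    qed
  qed
  then have "(\<Sum>k\<in>K. z k * (f i * g k - g i * f k)) \<le> 0" by (intro sum_nonpos)
  also have "(\<Sum>k\<in>K. z k * (f i * g k - g i * f k)) =
      f i * (\<Sum>k\<in>K. z k * g k) - g i * (\<Sum>k\<in>K. z k * f k)"
    by (simp add: sum_distrib_left sum_subtractf algebra_simps)
  finally have "f i * (\<Sum>k\<in>K. z k * g k) \<le> g i * (\<Sum>k\<in>K. z k * f k)" by simp
  moreover have "0 < f i * (\<Sum>k\<in>K. z k * g k)" using i g by simp
  moreover have "g i * (\<Sum>k\<in>K. z k * f k) \<le> 0" using gi f by (intro mult_nonpos_nonneg) auto
  ultimately show False by linarith
qed

text \<open>The determinant inequality says that the segment between the two points passes the
  origin on the side of the open first quadrant.\<close>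

lemma two_support_converse:
  fixes f1 f2 g1 g2 :: real
  assumes "0 < f1" "0 < g2" "f1 = f2 \<and> g1 = g2 \<or> f2 * g1 < f1 * g2"
  shows "\<exists>s t. 0 \<le> s \<and> 0 \<le> t \<and> s + t = 1 \<and> 0 < s * f1 + t * f2 \<and> 0 < s * g1 + t * g2"
proof -
  consider "0 < g1" | "0 < f2" | "g1 \<le> 0" "f2 \<le> 0" by linarith
  then show ?thesis
  proof cases
    case 1
    then show ?thesis using assms by (intro exI[of _ 1] exI[of _ 0]) auto
  next
    case 2
    then show ?thesis using assms by (intro exI[of _ 0] exI[of _ 1]) auto
  next
    case 3
    \<comment> \<open>Neither end point need lie in the quadrant. The weights pick the point where
      the segment meets the diagonal; both coordinates there equal the determinant divided by
      \<open>d\<close>.\<close>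
    define d where "d = (g2 - f2) + (f1 - g1)"
    have lt: "f2 * g1 < f1 * g2" using assms 3 by auto
    have d: "0 < d" using assms 3 by (simp add: d_def)
    have "(g2 - f2) / d * f1 + (f1 - g1) / d * f2 = (f1 * g2 - f2 * g1) / d"
      and "(g2 - f2) / d * g1 + (f1 - g1) / d * g2 = (f1 * g2 - f2 * g1) / d"
      by (simp_all add: divide_simps) (simp_all add: algebra_simps)
    moreover have "0 < (f1 * g2 - f2 * g1) / d" using lt d by simp
    moreover have "(g2 - f2) / d + (f1 - g1) / d = 1"
      using d by (simp add: d_def flip: add_divide_distrib)
    ultimately show ?thesis
      using assms 3 d by (intro exI[of _ "(g2 - f2) / d"] exI[of _ "(f1 - g1) / d"]) auto
  qed
qed

text \<open>Some mixture \<open>(s, t)\<close> of the rows \<open>i, i'\<close> leaves a mixture of the columns \<open>j, j'\<close> at which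
  both payoffs are positive.\<close>

definition block_dominated ::
    "('i \<Rightarrow> 'j \<Rightarrow> real) \<Rightarrow> ('i \<Rightarrow> 'j \<Rightarrow> real) \<Rightarrow> 'i \<Rightarrow> 'i \<Rightarrow> 'j \<Rightarrow> 'j \<Rightarrow> bool" where
  "block_dominated a b i i' j j' \<longleftrightarrow>
     (\<exists>s t. 0 \<le> s \<and> 0 \<le> t \<and> s + t = 1 \<and>
        0 < s * a i j + t * a i' j \<and> 0 < s * b i j' + t * b i' j' \<and>
        (j = j' \<or> (s * a i j' + t * a i' j') * (s * b i j + t * b i' j) <
          (s * a i j + t * a i' j) * (s * b i j' + t * b i' j')))"

text \<open>Mixtures of two actions are written as sums of two indicators so that
  \<open>i = i'\<close> needs no separate treatment.\<close>

lemma sum_two: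
  fixes h :: "'a \<Rightarrow> real"
  assumes "finite K" "i \<in> K" "i' \<in> K"
  shows "(\<Sum>k\<in>K. ((if k = i then s else 0) + (if k = i' then t else 0)) * h k) = s * h i + t * h i'"
proof -
  have "((if k = i then s else 0) + (if k = i' then t else 0)) * h k =
      (if k = i then s * h k else 0) + (if k = i' then t * h k else 0)" for k
    by (simp add: algebra_simps)
  then show ?thesis using assms by (simp add: sum.distrib)
qed

text \<open>A Caratheodory-type reduction, one player at a time: for the given row mixture two
  columns suffice, and for the resulting column mixture two rows suffice.\<close>

lemma dominated_imp_block:
  fixes a b :: "'i \<Rightarrow> 'j \<Rightarrow> real"
  assumes I: "finite I" "\<And>i. i \<in> I \<Longrightarrow> 0 \<le> z i" and J: "finite J" "\<And>j. j \<in> J \<Longrightarrow> 0 \<le> w j"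
    and a: "0 < (\<Sum>i\<in>I. \<Sum>j\<in>J. z i * a i j * w j)" and b: "0 < (\<Sum>i\<in>I. \<Sum>j\<in>J. z i * b i j * w j)"
  shows "\<exists>i\<in>I. \<exists>i'\<in>I. \<exists>j\<in>J. \<exists>j'\<in>J. block_dominated a b i i' j j'"
proof -
  have sw: "(\<Sum>i\<in>I. \<Sum>j\<in>J. z i * c i j * w j) = (\<Sum>j\<in>J. w j * (\<Sum>i\<in>I. z i * c i j))" for c
    by (subst sum.swap) (simp add: sum_distrib_left algebra_simps)
  obtain j j' where j: "j \<in> J" "j' \<in> J" and
    "0 < (\<Sum>i\<in>I. z i * a i j)" "0 < (\<Sum>i\<in>I. z i * b i j')"
    "j = j' \<or> (\<Sum>i\<in>I. z i * a i j') * (\<Sum>i\<in>I. z i * b i j) <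
      (\<Sum>i\<in>I. z i * a i j) * (\<Sum>i\<in>I. z i * b i j')"
    using two_support[where K = J and z = w and f = "\<lambda>j. \<Sum>i\<in>I. z i * a i j" and
        g = "\<lambda>j. \<Sum>i\<in>I. z i * b i j"] J a b
    unfolding sw by blast
  then obtain u v where uv: "0 \<le> u" "0 \<le> v"
    and pa: "0 < u * (\<Sum>i\<in>I. z i * a i j) + v * (\<Sum>i\<in>I. z i * a i j')"
    and pb: "0 < u * (\<Sum>i\<in>I. z i * b i j) + v * (\<Sum>i\<in>I. z i * b i j')"
    using two_support_converse[of "\<Sum>i\<in>I. z i * a i j" "\<Sum>i\<in>I. z i * b i j'"
        "\<Sum>i\<in>I. z i * a i j'" "\<Sum>i\<in>I. z i * b i j"] by blast
  have "u * (\<Sum>i\<in>I. z i * c i j) + v * (\<Sum>i\<in>I. z i * c i j') =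
      (\<Sum>i\<in>I. z i * (u * c i j + v * c i j'))" for c
    by (simp add: sum_distrib_left sum.distrib algebra_simps)
  with pa pb obtain i i' where i: "i \<in> I" "i' \<in> I" and
    "0 < u * a i j + v * a i j'" "0 < u * b i' j + v * b i' j'"
    "i = i' \<or> (u * a i' j + v * a i' j') * (u * b i j + v * b i j') <
      (u * a i j + v * a i j') * (u * b i' j + v * b i' j')"
    using two_support[where K = I and z = z and f = "\<lambda>i. u * a i j + v * a i j'" and
        g = "\<lambda>i. u * b i j + v * b i j'"] I by auto
  then obtain s t where st: "0 \<le> s" "0 \<le> t" "s + t = 1"
    and qa: "0 < s * (u * a i j + v * a i j') + t * (u * a i' j + v * a i' j')"
    and qb: "0 < s * (u * b i j + v * b i j') + t * (u * b i' j + v * b i' j')"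
    using two_support_converse[of "u * a i j + v * a i j'" "u * b i' j + v * b i' j'"
        "u * a i' j + v * a i' j'" "u * b i j + v * b i j'"] by blast
  let ?w = "\<lambda>k. (if k = j then u else 0) + (if k = j' then v else 0)"
  have two: "(\<Sum>k\<in>{j, j'}. ?w k * h k) = u * h j + v * h j'" for h :: "'j \<Rightarrow> real"
    by (rule sum_two) auto
  \<comment> \<open>The row mixture has changed from \<open>z\<close> to \<open>(s, t)\<close>, so
    the columns are chosen once more, within \<open>{j, j'}\<close>, to obtain the determinant
    condition for \<open>(s, t)\<close>.\<close>
  have "\<exists>k\<in>{j, j'}. \<exists>k'\<in>{j, j'}. 0 < s * a i k + t * a i' k \<and> 0 < s * b i k' + t * b i' k' \<and>
      (k = k' \<or> (s * a i k' + t * a i' k') * (s * b i k + t * b i' k) <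
         (s * a i k + t * a i' k) * (s * b i k' + t * b i' k'))"
    by (rule two_support[of _ ?w]) (use uv qa qb in \<open>auto simp only: two, auto simp: algebra_simps\<close>)
  then show ?thesis using i j st unfolding block_dominated_def by blast
qed

lemma block_imp_dominated:
  fixes a b :: "'i \<Rightarrow> 'j \<Rightarrow> real"
  assumes I: "finite I" "i \<in> I" "i' \<in> I" and J: "finite J" "j \<in> J" "j' \<in> J"
    and bd: "block_dominated a b i i' j j'"
  obtains z w where "\<And>i. 0 \<le> z i" "(\<Sum>i\<in>I. z i) = 1" "\<And>j. 0 \<le> w j" "(\<Sum>j\<in>J. w j) = 1"
    "0 < (\<Sum>i\<in>I. \<Sum>j\<in>J. z i * a i j * w j)" "0 < (\<Sum>i\<in>I. \<Sum>j\<in>J. z i * b i j * w j)"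
proof -
  obtain s t where st: "0 \<le> s" "0 \<le> t" "s + t = 1"
    and p: "0 < s * a i j + t * a i' j" "0 < s * b i j' + t * b i' j'"
      "j = j' \<or> (s * a i j' + t * a i' j') * (s * b i j + t * b i' j) <
          (s * a i j + t * a i' j) * (s * b i j' + t * b i' j')"
    using bd unfolding block_dominated_def by blast
  then obtain u v where uv: "0 \<le> u" "0 \<le> v" "u + v = 1"
    and q: "0 < u * (s * a i j + t * a i' j) + v * (s * a i j' + t * a i' j')"
      "0 < u * (s * b i j + t * b i' j) + v * (s * b i j' + t * b i' j')"
    using two_support_converse[of "s * a i j + t * a i' j" "s * b i j' + t * b i' j'"
        "s * a i j' + t * a i' j'" "s * b i j + t * b i' j"] by blast
  let ?z = "\<lambda>k. (if k = i then s else 0) + (if k = i' then t else 0)"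
  let ?w = "\<lambda>k. (if k = j then u else 0) + (if k = j' then v else 0)"
  have z: "(\<Sum>k\<in>I. ?z k * h k) = s * h i + t * h i'" for h by (rule sum_two[OF I])
  have w: "(\<Sum>k\<in>J. ?w k * h k) = u * h j + v * h j'" for h by (rule sum_two[OF J])
  have zw: "(\<Sum>k\<in>I. \<Sum>l\<in>J. ?z k * c k l * ?w l) =
      s * (u * c i j + v * c i j') + t * (u * c i' j + v * c i' j')" for c :: "'i \<Rightarrow> 'j \<Rightarrow> real"
  proof -
    have "(\<Sum>k\<in>I. \<Sum>l\<in>J. ?z k * c k l * ?w l) = (\<Sum>k\<in>I. ?z k * (\<Sum>l\<in>J. ?w l * c k l))"
      unfolding sum_distrib_left by (intro sum.cong refl) (simp only: mult_ac)
    then show ?thesis by (simp only: z w)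
  qed
  show ?thesis
  proof (rule that[of ?z ?w])
    show "(\<Sum>k\<in>I. ?z k) = 1" using z[of "\<lambda>_. 1"] st by simp
    show "(\<Sum>k\<in>J. ?w k) = 1" using w[of "\<lambda>_. 1"] uv by simp
    show "0 < (\<Sum>k\<in>I. \<Sum>l\<in>J. ?z k * a k l * ?w l)" unfolding zw using q by (simp add: algebra_simps)
    show "0 < (\<Sum>k\<in>I. \<Sum>l\<in>J. ?z k * b k l * ?w l)" unfolding zw using q by (simp add: algebra_simps)
  qed (use st uv in auto)
qed

section \<open>Vertices of hyperplane arrangements in a simplex\<close>

definition dot :: "real list \<Rightarrow> real list \<Rightarrow> real" where
  "dot u v = foldr (\<lambda>(a, b) s. a * b + s) (zip u v) 0"

definition lin_comb :: "real \<Rightarrow> real list \<Rightarrow> real \<Rightarrow> real list \<Rightarrow> real list" where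
  "lin_comb p u q v = map (\<lambda>(a, b). p * a + q * b) (zip u v)"

text \<open>The point of the segment from \<open>u\<close> to \<open>v\<close> on the hyperplane orthogonal to \<open>c\<close>.\<close>

definition crossing :: "real list \<Rightarrow> real list \<Rightarrow> real list \<Rightarrow> real list" where
  "crossing c u v =
     lin_comb (- dot c v / (dot c u - dot c v)) u (dot c u / (dot c u - dot c v)) v"

definition add_crossing ::
    "real list \<Rightarrow> real list \<times> real list \<Rightarrow> real list list \<Rightarrow> real list list" where
  "add_crossing c p gs =
     (if dot c (snd p) < 0 \<and> 0 < dot c (fst p) then crossing c (fst p) (snd p) # gs else gs)"

text \<open>A step of the double description method, except that points on both sides are kept: the
  same list has to serve either half space of each hyperplane.\<close>

definition split_by :: "real list \<Rightarrow> real list list \<Rightarrow> real list list" where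
  "split_by c gs = foldr (add_crossing c) (List.product gs gs) gs"

lemma dot_Nil [simp]: "dot [] v = 0" "dot u [] = 0"
  by (simp_all add: dot_def)

lemma dot_Cons [simp]: "dot (a # u) (b # v) = a * b + dot u v"
  by (simp add: dot_def)

lemma dot_eq_sum: "length u = length v \<Longrightarrow> dot u v = (\<Sum>i<length v. u ! i * v ! i)"
proof (induction u v rule: list_induct2)
  case (Cons a u b v)
  then show ?case by (simp add: sum.lessThan_Suc_shift del: sum.lessThan_Suc)
qed simp

lemma length_lin_comb [simp]: "length (lin_comb p u q v) = min (length u) (length v)"
  by (simp add: lin_comb_def)

lemma nth_lin_comb [simp]:
  "i < length u \<Longrightarrow> i < length v \<Longrightarrow> lin_comb p u q v ! i = p * u ! i + q * v ! i"
  by (simp add: lin_comb_def)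

lemma dot_lin_comb_right:
  assumes "length u = n" "length v = n" "length c = n"
  shows "dot c (lin_comb p u q v) = p * dot c u + q * dot c v"
  using assms by (simp add: dot_eq_sum sum_distrib_left sum.distrib algebra_simps)

lemma dot_lin_comb_left:
  assumes "length u = n" "length v = n" "length c = n"
  shows "dot (lin_comb p u q v) c = p * dot u c + q * dot v c"
  using assms by (simp add: dot_eq_sum sum_distrib_left sum.distrib algebra_simps)

lemma set_split_by:
  "set (split_by c gs) =
     set gs \<union> {crossing c u v | u v. u \<in> set gs \<and> v \<in> set gs \<and> 0 < dot c u \<and> dot c v < 0}"
proof -
  have "set (foldr (add_crossing c) ps gs) =
      set gs \<union> (\<lambda>p. crossing c (fst p) (snd p)) ` {p \<in> set ps. dot c (snd p) < 0 \<and> 0 < dot c (fst p)}"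
    for ps
  proof (induction ps)
    case (Cons p ps)
    then show ?case by (cases "dot c (snd p) < 0 \<and> 0 < dot c (fst p)") (auto simp: add_crossing_def)
  qed simp
  then show ?thesis unfolding split_by_def by (auto simp: image_iff; blast)
qed

definition in_simplex :: "nat \<Rightarrow> real list \<Rightarrow> bool" where
  "in_simplex n u \<longleftrightarrow> length u = n \<and> (\<forall>i<n. 0 \<le> u ! i) \<and> (\<Sum>i<n. u ! i) = 1"

lemma crossing_weights:
  fixes a b :: real
  assumes "0 < a" "b < 0"
  shows "0 \<le> - b / (a - b)" "0 \<le> a / (a - b)" "- b / (a - b) + a / (a - b) = 1"
  using assms by (auto simp: divide_simps)

lemma in_simplex_crossing:
  assumes "in_simplex n u" "in_simplex n v" "0 < dot c u" "dot c v < 0"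
  shows "in_simplex n (crossing c u v)"
proof -
  define p q where "p = - dot c v / (dot c u - dot c v)" and "q = dot c u / (dot c u - dot c v)"
  have pq: "0 \<le> p" "0 \<le> q" "p + q = 1"
    using crossing_weights[OF assms(3,4)] unfolding p_def q_def by blast+
  have "(\<Sum>i<n. p * u ! i + q * v ! i) = p * (\<Sum>i<n. u ! i) + q * (\<Sum>i<n. v ! i)"
    by (simp add: sum.distrib sum_distrib_left)
  then show ?thesis
    using assms pq unfolding crossing_def p_def[symmetric] q_def[symmetric]
    by (simp add: in_simplex_def)
qed

lemma in_simplex_split_by: "\<forall>g\<in>set gs. in_simplex n g \<Longrightarrow> \<forall>g\<in>set (split_by c gs). in_simplex n g"
  unfolding set_split_by using in_simplex_crossing by blast

text \<open>A cone instead of a convex hull: between points of the simplex the weights add up to one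
  by themselves, so only their signs must be maintained.\<close>

definition in_cone :: "nat \<Rightarrow> real list set \<Rightarrow> (nat \<Rightarrow> real) \<Rightarrow> bool" where
  "in_cone n S x \<longleftrightarrow>
     (\<exists>w. (\<forall>g\<in>S. 0 \<le> w g) \<and> (\<forall>i<n. x i = (\<Sum>g\<in>S. w g * g ! i)))"

lemma in_cone_member: "finite S \<Longrightarrow> g \<in> S \<Longrightarrow> in_cone n S ((!) g)"
  unfolding in_cone_def by (intro exI[of _ "\<lambda>h. if h = g then 1 else 0"])
    (auto simp: if_distrib[of "\<lambda>x. x * _"] cong: if_cong)

lemma in_cone_sum:
  assumes "\<And>k. k \<in> K \<Longrightarrow> 0 \<le> m k" "\<And>k. k \<in> K \<Longrightarrow> in_cone n S (y k)"
  shows "in_cone n S (\<lambda>i. \<Sum>k\<in>K. m k * y k i)"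
proof -
  obtain w where w: "\<And>k g. k \<in> K \<Longrightarrow> g \<in> S \<Longrightarrow> 0 \<le> w k g"
    "\<And>k i. k \<in> K \<Longrightarrow> i < n \<Longrightarrow> y k i = (\<Sum>g\<in>S. w k g * g ! i)"
    using assms(2) unfolding in_cone_def by metis
  show ?thesis unfolding in_cone_def
  proof (intro exI conjI ballI allI impI)
    show "0 \<le> (\<Sum>k\<in>K. m k * w k g)" if "g \<in> S" for g
      using that w assms by (intro sum_nonneg mult_nonneg_nonneg) auto
    show "(\<Sum>k\<in>K. m k * y k i) = (\<Sum>g\<in>S. (\<Sum>k\<in>K. m k * w k g) * g ! i)" if "i < n" for i
      using that by (simp add: w sum_distrib_left sum_distrib_right mult_ac) (rule sum.swap)
  qed
qed

lemma in_cone_add: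
  assumes "in_cone n S x" "in_cone n S y"
  shows "in_cone n S (\<lambda>i. x i + y i)"
proof -
  have "in_cone n S (\<lambda>i. \<Sum>k\<in>UNIV. 1 * (if k then x else y) i)"
    by (rule in_cone_sum) (use assms in auto)
  then show ?thesis by (simp add: UNIV_bool add.commute)
qed

lemma in_cone_cong: "(\<And>i. i < n \<Longrightarrow> x i = y i) \<Longrightarrow> in_cone n S x \<Longrightarrow> in_cone n S y"
  by (simp add: in_cone_def)

lemma in_cone_mono:
  assumes "finite T" "S \<subseteq> T" "in_cone n S x"
  shows "in_cone n T x"
proof -
  obtain w where w: "\<And>g. g \<in> S \<Longrightarrow> 0 \<le> w g" "\<And>i. i < n \<Longrightarrow> x i = (\<Sum>g\<in>S. w g * g ! i)"
    using assms(3) unfolding in_cone_def by blast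
  have "in_cone n T (\<lambda>i. \<Sum>g\<in>S. w g * g ! i)"
    using assms w by (intro in_cone_sum in_cone_member) auto
  then show ?thesis by (rule in_cone_cong[rotated]) (simp add: w)
qed

text \<open>Cutting a cone with a half space: the part of \<open>x\<close> carried by the generators beyond the
  hyperplane is paired with the part carried by the others, in proportion to their distances
  from it.\<close>

lemma in_cone_half_space:
  assumes S: "finite S" "\<forall>g\<in>S. length g = n" and c: "length c = n"
    and T: "finite T" "{g\<in>S. 0 \<le> dot c g} \<subseteq> T"
      "\<And>u v. u \<in> S \<Longrightarrow> v \<in> S \<Longrightarrow> 0 < dot c u \<Longrightarrow> dot c v < 0 \<Longrightarrow> crossing c u v \<in> T"
    and x: "in_cone n S x" "0 \<le> (\<Sum>i<n. c ! i * x i)"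
  shows "in_cone n T x"
proof -
  obtain w where w: "\<And>g. g \<in> S \<Longrightarrow> 0 \<le> w g" and xw: "\<And>i. i < n \<Longrightarrow> x i = (\<Sum>g\<in>S. w g * g ! i)"
    using x(1) unfolding in_cone_def by blast
  define P Z N where "P = {g\<in>S. 0 < dot c g}" and "Z = {g\<in>S. dot c g = 0}" and "N = {g\<in>S. dot c g < 0}"
  have fin: "finite P" "finite Z" "finite N" using S by (auto simp: P_def Z_def N_def)
  have sumS: "(\<Sum>g\<in>S. h g) = (\<Sum>g\<in>P. h g) + (\<Sum>g\<in>Z. h g) + (\<Sum>g\<in>N. h g)" for h :: "real list \<Rightarrow> real"
  proof -
    have "S = P \<union> (Z \<union> N)" by (auto simp: P_def Z_def N_def)
    moreover have "P \<inter> (Z \<union> N) = {}" "Z \<inter> N = {}" by (auto simp: P_def Z_def N_def)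
    ultimately show ?thesis using fin by (simp add: sum.union_disjoint)
  qed
  define H D where "H = (\<Sum>g\<in>P. w g * dot c g)" and "D = (\<Sum>g\<in>N. w g * (- dot c g))"
  have "(\<Sum>i<n. c ! i * x i) = (\<Sum>g\<in>S. w g * dot c g)"
  proof -
    have "(\<Sum>i<n. c ! i * x i) = (\<Sum>i<n. \<Sum>g\<in>S. w g * (c ! i * g ! i))"
      by (simp add: xw sum_distrib_left mult_ac)
    also have "\<dots> = (\<Sum>g\<in>S. w g * dot c g)"
      using S c by (subst sum.swap) (simp add: dot_eq_sum sum_distrib_left)
    finally show ?thesis .
  qed
  also have "\<dots> = H - D"
    unfolding sumS H_def D_def by (simp add: Z_def sum_negf)
  finally have HD: "D \<le> H" using x by simp
  have D0: "0 \<le> D" unfolding D_def using w by (intro sum_nonneg mult_nonneg_nonneg) (auto simp: N_def)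
  have PT: "in_cone n T ((!) g)" if "g \<in> P \<or> g \<in> Z" for g
    using that T by (intro in_cone_member) (auto simp: P_def Z_def)
  have zero: "in_cone n T (\<lambda>i. \<Sum>g\<in>Z. w g * g ! i)"
    using w PT by (intro in_cone_sum) (auto simp: Z_def)
  show ?thesis
  \<comment> \<open>If \<open>D = 0\<close>, no weight lies strictly on the negative side. Otherwise
    \<open>H \<ge> D > 0\<close>, which justifies the divisions by \<open>H\<close>.\<close>
  proof (cases "D = 0")
    case True
    have "w g * (- dot c g) = 0" if "g \<in> N" for g
      using True that w fin unfolding D_def
      by (subst (asm) sum_nonneg_eq_0_iff) (auto simp: N_def mult_nonneg_nonpos)
    then have "(\<Sum>g\<in>N. w g * g ! i) = 0" for i
      by (intro sum.neutral) (auto simp: N_def)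
    then have "x i = (\<Sum>g\<in>P. w g * g ! i) + (\<Sum>g\<in>Z. w g * g ! i)" if "i < n" for i
      using that by (simp add: xw sumS)
    moreover have "in_cone n T (\<lambda>i. (\<Sum>g\<in>P. w g * g ! i) + (\<Sum>g\<in>Z. w g * g ! i))"
      using w PT by (intro in_cone_add[OF in_cone_sum zero]) (auto simp: P_def)
    ultimately show ?thesis using in_cone_cong by simp
  next
    case False
    then have H: "0 < H" using HD D0 by simp
    \<comment> \<open>The factor \<open>dot c h - dot c g\<close> cancels the denominator of
      \<open>crossing\<close>. Summed over all pairs, these weights use up the whole negative part
      and the fraction \<open>D / H\<close> of the positive part; \<open>y\<close> adds the
      remaining fraction.\<close>
    define m where "m = (\<lambda>(h, g). w h * w g * (dot c h - dot c g) / H)"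
    define y where "y = (\<lambda>i. (\<Sum>h\<in>P. (w h * (1 - D / H)) * h ! i) + (\<Sum>g\<in>Z. w g * g ! i) +
      (\<Sum>p\<in>P \<times> N. m p * crossing c (fst p) (snd p) ! i))"
    have "in_cone n T y" unfolding y_def
    proof (intro in_cone_add in_cone_sum zero)
      show "0 \<le> w h * (1 - D / H)" if "h \<in> P" for h
        using that w H HD by (intro mult_nonneg_nonneg) (auto simp: P_def)
      show "0 \<le> m p" if "p \<in> P \<times> N" for p
      proof -
        obtain h g where [simp]: "p = (h, g)" by fastforce
        have "0 \<le> w h" "0 \<le> w g" "0 \<le> dot c h - dot c g" using that w by (auto simp: P_def N_def)
        then show ?thesis using H by (simp add: m_def)
      qed
      show "in_cone n T ((!) (crossing c (fst p) (snd p)))" if "p \<in> P \<times> N" for p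
        using that T by (intro in_cone_member) (auto simp: P_def N_def)
    qed (use PT w in \<open>auto simp: Z_def\<close>)
    moreover have "y i = x i" if i: "i < n" for i
    proof -
      have m: "m (h, g) * crossing c h g ! i =
          (w h * h ! i) * (w g * (- dot c g)) / H + (w h * dot c h) * (w g * g ! i) / H"
        if "h \<in> P" "g \<in> N" for h g
      proof -
        have d: "dot c h - dot c g \<noteq> 0" using that by (auto simp: P_def N_def)
        have l: "i < length h" "i < length g" using that S i by (auto simp: P_def N_def)
        show ?thesis unfolding m_def crossing_def using l d H
          by (simp add: divide_simps) (simp add: algebra_simps)
      qed
      have "(\<Sum>p\<in>P \<times> N. m p * crossing c (fst p) (snd p) ! i) =
          (\<Sum>h\<in>P. \<Sum>g\<in>N. m (h, g) * crossing c h g ! i)"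
        by (simp add: sum.cartesian_product split_def)
      also have "\<dots> = (\<Sum>h\<in>P. \<Sum>g\<in>N. (w h * h ! i) * (w g * (- dot c g)) / H +
          (w h * dot c h) * (w g * g ! i) / H)"
        by (intro sum.cong refl m)
      also have "\<dots> = (\<Sum>h\<in>P. w h * h ! i) * D / H + H * (\<Sum>g\<in>N. w g * g ! i) / H"
        unfolding D_def H_def
        by (simp only: sum.distrib sum_product sum_divide_distrib)
      finally have pr: "(\<Sum>p\<in>P \<times> N. m p * crossing c (fst p) (snd p) ! i) =
          (\<Sum>h\<in>P. w h * h ! i) * D / H + H * (\<Sum>g\<in>N. w g * g ! i) / H" .
      have sc: "(\<Sum>h\<in>P. (w h * (1 - D / H)) * h ! i) = (\<Sum>h\<in>P. w h * h ! i) * (1 - D / H)"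
        unfolding sum_distrib_right by (intro sum.cong refl) (simp only: mult_ac)
      have "y i = (\<Sum>h\<in>P. w h * h ! i) * (1 - D / H) + (\<Sum>g\<in>Z. w g * g ! i) +
          (\<Sum>h\<in>P. w h * h ! i) * D / H + (\<Sum>g\<in>N. w g * g ! i)"
        using H sc pr by (simp add: y_def)
      then show ?thesis using i by (simp add: xw sumS algebra_simps)
    qed
    ultimately show ?thesis by (rule in_cone_cong[rotated])
  qed
qed

text \<open>\<open>G\<close> depends on neither \<open>F\<close> nor \<open>Q\<close>: one list
  serves every face of the simplex and every choice of half spaces. A crossing is a nonnegative
  combination of two earlier points, so it inherits their vanishing coordinates and inequalities,
  and it lies on the new hyperplane.\<close>

lemma finite_arrangement:
  assumes "\<forall>c\<in>set cs. length c = n" "\<forall>g\<in>set gs. in_simplex n g"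
    and "in_cone n {g\<in>set gs. \<forall>i\<in>F. g ! i = 0} x" "\<forall>i\<in>F. i < n"
    and "\<forall>c\<in>set cs. Q c \<longrightarrow> 0 \<le> (\<Sum>i<n. c ! i * x i)"
  defines "G \<equiv> foldr split_by cs gs"
  shows "(\<forall>g\<in>set G. in_simplex n g) \<and>
    in_cone n {g\<in>set G. (\<forall>i\<in>F. g ! i = 0) \<and> (\<forall>c\<in>set cs. Q c \<longrightarrow> 0 \<le> dot c g)} x"
  using assms(1,5) unfolding G_def
proof (induction cs)
  case Nil
  then show ?case using assms by simp
next
  case (Cons c cs)
  let ?H = "foldr split_by cs gs"
  let ?S = "{g\<in>set ?H. (\<forall>i\<in>F. g ! i = 0) \<and> (\<forall>c\<in>set cs. Q c \<longrightarrow> 0 \<le> dot c g)}"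
  let ?T = "{g\<in>set (split_by c ?H). (\<forall>i\<in>F. g ! i = 0) \<and> (\<forall>c\<in>set (c # cs). Q c \<longrightarrow> 0 \<le> dot c g)}"
  have IH: "\<forall>g\<in>set ?H. in_simplex n g" "in_cone n ?S x" using Cons by auto
  have len: "\<forall>g\<in>?S. length g = n" using IH by (auto simp: in_simplex_def)
  have "in_cone n ?T x"
  proof (cases "Q c")
    case False
    have "?S \<subseteq> ?T" using False by (auto simp: set_split_by)
    then show ?thesis using in_cone_mono[OF _ _ IH(2)] by simp
  next
    case True
    show ?thesis
    proof (rule in_cone_half_space[where S = ?S and c = c])
      show "{g \<in> ?S. 0 \<le> dot c g} \<subseteq> ?T" by (auto simp: set_split_by)
      show "0 \<le> (\<Sum>i<n. c ! i * x i)" using Cons.prems True by auto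
      show "crossing c u v \<in> ?T" if u: "u \<in> ?S" and v: "v \<in> ?S" and d: "0 < dot c u" "dot c v < 0" for u v
      proof -
        define p q where "p = - dot c v / (dot c u - dot c v)" and "q = dot c u / (dot c u - dot c v)"
        have pq: "0 \<le> p" "0 \<le> q" using crossing_weights[OF d] unfolding p_def q_def by blast+
        have cr: "crossing c u v = lin_comb p u q v" by (simp add: crossing_def p_def q_def)
        have l: "length u = n" "length v = n" using len u v by auto
        have "crossing c u v \<in> set (split_by c ?H)" using u v d by (auto simp: set_split_by)
        moreover have "crossing c u v ! i = 0" if "i \<in> F" for i
          using that u v l assms(4) by (simp add: cr)
        moreover have "0 \<le> dot b (crossing c u v)" if "b \<in> set cs" "Q b" for b
          using that u v l pq Cons.prems(1) by (simp add: cr dot_lin_comb_right[of _ n])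
        moreover have "dot c (crossing c u v) = 0"
        proof -
          have "dot c (crossing c u v) = p * dot c u + q * dot c v"
            using l Cons.prems(1) by (simp add: cr dot_lin_comb_right[of _ n])
          also have "\<dots> = 0" using d by (simp add: p_def q_def divide_simps)
          finally show ?thesis .
        qed
        ultimately show ?thesis by auto
      qed
    qed (use len IH Cons.prems in auto)
  qed
  moreover have "\<forall>g\<in>set (split_by c ?H). in_simplex n g" by (rule in_simplex_split_by[OF IH(1)])
  ultimately show ?case by simp
qed

text \<open>The weights sum to one, so the value of a linear functional at \<open>x\<close> is an
  average of its values on \<open>S\<close>.\<close>

lemma in_cone_dominates:
  assumes S: "finite S" "\<forall>g\<in>S. in_simplex n g" and x: "in_cone n S x" "(\<Sum>i<n. x i) = 1"
  shows "\<exists>g\<in>S. (\<Sum>i<n. l i * x i) \<le> (\<Sum>i<n. l i * g ! i)"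
proof (rule ccontr)
  define M where "M = (\<Sum>i<n. l i * x i)"
  assume "\<not> ?thesis"
  then have less: "\<And>g. g \<in> S \<Longrightarrow> (\<Sum>i<n. l i * g ! i) < M" by (auto simp: not_le M_def)
  obtain w where w: "\<And>g. g \<in> S \<Longrightarrow> 0 \<le> w g" and xw: "\<And>i. i < n \<Longrightarrow> x i = (\<Sum>g\<in>S. w g * g ! i)"
    using x(1) unfolding in_cone_def by blast
  have comb: "(\<Sum>i<n. k i * x i) = (\<Sum>g\<in>S. w g * (\<Sum>i<n. k i * g ! i))" for k
  proof -
    have "(\<Sum>i<n. k i * x i) = (\<Sum>i<n. \<Sum>g\<in>S. w g * (k i * g ! i))"
      by (simp add: xw sum_distrib_left mult_ac)
    then show ?thesis by (subst (asm) sum.swap) (simp add: sum_distrib_left)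
  qed
  have one: "(\<Sum>g\<in>S. w g) = 1"
    using comb[of "\<lambda>_. 1"] S(2) x(2) by (simp add: in_simplex_def)
  then obtain g where g: "g \<in> S" "w g \<noteq> 0" by (metis sum.neutral zero_neq_one)
  have "(\<Sum>g\<in>S. w g * (\<Sum>i<n. l i * g ! i)) < (\<Sum>g\<in>S. w g * M)"
  proof (rule sum_strict_mono_ex1[OF S(1)])
    show "\<forall>g\<in>S. w g * (\<Sum>i<n. l i * g ! i) \<le> w g * M"
      using w mult_left_mono[OF less_imp_le[OF less]] by blast
    have "0 < w g" using g w[of g] by simp
    then show "\<exists>g\<in>S. w g * (\<Sum>i<n. l i * g ! i) < w g * M"
      using mult_strict_left_mono[OF less[OF g(1)]] g(1) by blast
  qed
  then have "M < (\<Sum>g\<in>S. w g) * M" unfolding comb[of l, symmetric] M_def sum_distrib_right .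
  with one show False by simp
qed

section \<open>Deciding domination in a two by two block\<close>

text \<open>Polarisation of the determinant in \<open>block_dominated\<close>: with
  \<open>k = 1\<close> and \<open>u = v\<close> it is that determinant at the row mixture
  \<open>u\<close>.\<close>

definition form ::
    "real list \<Rightarrow> real list \<Rightarrow> real list \<Rightarrow> real list \<Rightarrow> real \<Rightarrow> real list \<Rightarrow> real list \<Rightarrow> real" where
  "form a b a' b' k u v = dot a u * dot b v - k * (dot a' u * dot b' v)"

text \<open>The first six conditions make both linear forms positive strictly between
  \<open>u\<close> and \<open>v\<close>. The rest says that the quadratic form is positive somewhere
  on the segment: at \<open>u\<close>, or inside by the discriminant. Positivity at \<open>v\<close>
  is found when the pair is tested in the other order.\<close>

definition pair_test ::
    "real list \<Rightarrow> real list \<Rightarrow> real list \<Rightarrow> real list \<Rightarrow> real \<Rightarrow> real list \<Rightarrow> real list \<Rightarrow> bool" where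
  "pair_test a b a' b' k u v \<longleftrightarrow>
     \<not> dot a u < 0 \<and> \<not> dot a v < 0 \<and> \<not> dot b u < 0 \<and> \<not> dot b v < 0 \<and>
     0 < dot a u + dot a v \<and> 0 < dot b u + dot b v \<and>
     (0 < form a b a' b' k u u \<or>
      (0 < form a b a' b' k u v + form a b a' b' k v u \<and>
       4 * (form a b a' b' k u u * form a b a' b' k v v) <
         (form a b a' b' k u v + form a b a' b' k v u) *
         (form a b a' b' k u v + form a b a' b' k v u)))"

definition block_test ::
    "real list \<Rightarrow> real list \<Rightarrow> real list \<Rightarrow> real list \<Rightarrow> real \<Rightarrow> bool" where
  "block_test a b a' b' k \<longleftrightarrow>
     (let gs = foldr split_by [a, b] [[1, 0], [0, 1]]
      in \<exists>(u, v)\<in>set (List.product gs gs). pair_test a b a' b' k u v)"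

text \<open>Completing the square: if all three alternatives fail, then \<open>a < 0\<close>, and
  \<open>4 * a\<close> times the form is a sum of two nonnegative terms.\<close>

lemma quadratic_pos_imp:
  fixes a b c r t :: real
  assumes "0 \<le> r" "0 \<le> t" "0 < r * r * a + r * t * b + t * t * c"
  shows "0 < a \<or> 0 < c \<or> (0 < b \<and> 4 * (a * c) < b * b)"
proof (rule ccontr)
  assume no: "\<not> ?thesis"
  then have ac: "a \<le> 0" "c \<le> 0" by auto
  have "r * r * a \<le> 0" "t * t * c \<le> 0" using ac by (simp_all add: mult_nonneg_nonpos)
  then have "0 < r * t * b" using assms by linarith
  then have b: "0 < b" using assms by (metis mult_nonneg_nonneg mult_nonneg_nonpos not_le)
  then have disc: "b * b \<le> 4 * (a * c)" using no by auto
  then have a: "a < 0" using b ac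
    by (metis less_eq_real_def mult_eq_0_iff mult_pos_pos not_less mult_zero_left mult_zero_right)
  have "4 * a * (r * r * a + r * t * b + t * t * c) =
      (2 * r * a + t * b)\<^sup>2 + t\<^sup>2 * (4 * (a * c) - b * b)"
    by (simp add: power2_eq_square algebra_simps)
  moreover have "0 \<le> t\<^sup>2 * (4 * (a * c) - b * b)" using disc by simp
  ultimately have "0 \<le> 4 * a * (r * r * a + r * t * b + t * t * c)" by simp
  moreover have "4 * a * (r * r * a + r * t * b + t * t * c) < 0" using a assms by (simp add: mult_neg_pos)
  ultimately show False by linarith
qed

lemma quadratic_posI:
  fixes a b c :: real
  assumes "0 < a \<or> (0 < b \<and> 4 * (a * c) < b * b)"
  shows "\<exists>r t. 0 \<le> r \<and> 0 \<le> t \<and> 0 < r * r * a + r * t * b + t * t * c"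
proof (cases "0 < a")
  case True
  then show ?thesis by (intro exI[of _ 1] exI[of _ 0]) simp
next
  case False
  then have b: "0 < b" "4 * (a * c) < b * b" using assms by auto
  show ?thesis
  proof (cases "a = 0")
    case True
    have "(\<bar>c\<bar> + 1) / b * b = \<bar>c\<bar> + 1" using b by simp
    then have "0 < (\<bar>c\<bar> + 1) / b * b + c" by (simp only:)
    then show ?thesis using True b by (intro exI[of _ "(\<bar>c\<bar> + 1) / b"] exI[of _ 1]) auto
  next
    case False
    with \<open>\<not> 0 < a\<close> have a: "a < 0" by simp
    \<comment> \<open>The ratio \<open>b : - 2 * a\<close> is the vertex of the parabola obtained by
      fixing \<open>t\<close>.\<close>
    have "b * b * a + b * (- 2 * a) * b + (- 2 * a) * (- 2 * a) * c = (- a) * (b * b - 4 * (a * c))"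
      by (simp add: algebra_simps)
    also have "0 < \<dots>" using a b by (simp add: mult_neg_pos)
    finally show ?thesis using a b by (intro exI[of _ b] exI[of _ "- 2 * a"]) auto
  qed
qed

text \<open>Needed to leave the end points of a segment, where the linear forms may vanish, without
  losing positivity of the quadratic form.\<close>

lemma quadratic_open:
  fixes c0 c1 c2 :: real
  assumes "0 < c0"
  shows "\<exists>e>0. 0 < c0 + e * c1 + e * e * c2"
proof -
  define d where "d = \<bar>c1\<bar> + \<bar>c2\<bar> + 1"
  define e where "e = min 1 (c0 / (2 * d))"
  have d: "0 < d" by (simp add: d_def)
  have e: "0 < e" "e \<le> 1" "e * d \<le> c0 / 2" using assms d by (auto simp: e_def min_def field_simps)
  have "- (e * \<bar>c1\<bar>) \<le> e * c1" "- (e * \<bar>c2\<bar>) \<le> e * e * c2"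
  proof -
    show "- (e * \<bar>c1\<bar>) \<le> e * c1" using e
      by (metis abs_ge_minus_self minus_le_iff mult_le_cancel_left_pos mult_minus_right)
    have "e * (e * \<bar>c2\<bar>) \<le> 1 * (e * \<bar>c2\<bar>)" using e by (intro mult_right_mono) auto
    moreover have "- (e * e * \<bar>c2\<bar>) \<le> e * e * c2" using e
      by (metis abs_ge_minus_self minus_le_iff mult_le_cancel_left_pos mult_minus_right mult_pos_pos)
    ultimately show "- (e * \<bar>c2\<bar>) \<le> e * e * c2" by (simp add: mult.assoc)
  qed
  moreover have "e * \<bar>c1\<bar> + e * \<bar>c2\<bar> \<le> e * d" using e by (simp add: d_def algebra_simps)
  ultimately have "0 < c0 + e * c1 + e * e * c2" using e assms by linarith
  with e show ?thesis by blast
qed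

text \<open>The row mixtures at which both linear forms are nonnegative form a segment whose ends
  belong to the arrangement. A successful pair yields a solution after a small shift into its
  interior and normalisation of the weights; conversely every solution lies between two arrangement
  points.\<close>

lemma block_test_iff:
  fixes a0 a1 b0 b1 c0 c1 d0 d1 k :: real
  shows "block_test [a0, a1] [b0, b1] [c0, c1] [d0, d1] k \<longleftrightarrow>
    (\<exists>s t. 0 \<le> s \<and> 0 \<le> t \<and> s + t = 1 \<and> 0 < s * a0 + t * a1 \<and> 0 < s * b0 + t * b1 \<and>
       k * ((s * c0 + t * c1) * (s * d0 + t * d1)) < (s * a0 + t * a1) * (s * b0 + t * b1))"
    (is "?L \<longleftrightarrow> ?R")
proof
  define gs where "gs = foldr split_by [[a0, a1], [b0, b1]] [[1, 0], [0, 1::real]]"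
  have gens: "\<forall>g\<in>set [[1, 0], [0, 1::real]]. in_simplex 2 g"
    by (auto simp: in_simplex_def numeral_2_eq_2 less_Suc_eq)
  let ?f = "form [a0, a1] [b0, b1] [c0, c1] [d0, d1] k"
  let ?a = "dot [a0, a1]" and ?b = "dot [b0, b1]"
  {
    assume ?L
    then obtain u v where uv: "u \<in> set gs" "v \<in> set gs"
      and pt: "pair_test [a0, a1] [b0, b1] [c0, c1] [d0, d1] k u v"
      unfolding block_test_def gs_def[symmetric] Let_def by auto
    have "\<forall>g\<in>set gs. in_simplex 2 g"
      unfolding gs_def foldr.simps o_apply id_apply by (intro in_simplex_split_by gens)
    then have "in_simplex 2 u" "in_simplex 2 v" using uv by auto
    then obtain u0 u1 v0 v1 where u: "u = [u0, u1]" "0 \<le> u0" "0 \<le> u1" "u0 + u1 = 1"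
      and v: "v = [v0, v1]" "0 \<le> v0" "0 \<le> v1" "v0 + v1 = 1"
      by (force simp: in_simplex_def numeral_2_eq_2 length_Suc_conv less_Suc_eq all_conj_distrib)
    obtain r t where rt: "0 \<le> r" "0 \<le> t"
      and q0: "0 < r * r * ?f u u + r * t * (?f u v + ?f v u) + t * t * ?f v v"
      using quadratic_posI pt unfolding pair_test_def by blast
    \<comment> \<open>The coefficients come from expanding the quadratic form at
      \<open>(r + e, t + e)\<close> in powers of \<open>e\<close>.\<close>
    obtain e where e: "0 < e" and
      "0 < (r * r * ?f u u + r * t * (?f u v + ?f v u) + t * t * ?f v v)
        + e * (2 * r * ?f u u + (r + t) * (?f u v + ?f v u) + 2 * t * ?f v v)
        + e * e * (?f u u + (?f u v + ?f v u) + ?f v v)"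
      using quadratic_open[OF q0] by blast
    then have q: "0 < (r + e) * (r + e) * ?f u u + (r + e) * (t + e) * (?f u v + ?f v u) +
        (t + e) * (t + e) * ?f v v"
      by (simp add: algebra_simps)
    define p where "p = r + t + 2 * e"
    define s' t' where "s' = (r + e) * u0 + (t + e) * v0" and "t' = (r + e) * u1 + (t + e) * v1"
    have p: "0 < p" "s' + t' = p" and st: "0 \<le> s'" "0 \<le> t'"
    proof -
      have "s' + t' = (r + e) * (u0 + u1) + (t + e) * (v0 + v1)" by (simp add: s'_def t'_def algebra_simps)
      then show "s' + t' = p" using u v by (simp add: p_def)
    qed (use rt e u v in \<open>auto simp: p_def s'_def t'_def\<close>)
    have lin: "s' * x + t' * y = (r + e) * dot [x, y] u + (t + e) * dot [x, y] v" for x y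
      by (simp add: u v s'_def t'_def algebra_simps)
    have pos: "0 < (r + e) * x + (t + e) * y" if "0 \<le> x" "0 \<le> y" "0 < x + y" for x y
    proof -
      have "(r + e) * x + (t + e) * y = r * x + t * y + e * (x + y)" by (simp add: algebra_simps)
      moreover have "0 < e * (x + y)" "0 \<le> r * x" "0 \<le> t * y" using that rt e by simp_all
      ultimately show ?thesis by linarith
    qed
    have A: "0 < s' * a0 + t' * a1" and B: "0 < s' * b0 + t' * b1"
      unfolding lin by (rule pos; use pt in \<open>simp add: pair_test_def not_less\<close>)+
    have "(s' * a0 + t' * a1) * (s' * b0 + t' * b1) - k * ((s' * c0 + t' * c1) * (s' * d0 + t' * d1)) =
      (r + e) * (r + e) * ?f u u + (r + e) * (t + e) * (?f u v + ?f v u) + (t + e) * (t + e) * ?f v v"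
      unfolding lin form_def by (simp add: algebra_simps)
    then have C: "k * ((s' * c0 + t' * c1) * (s' * d0 + t' * d1)) < (s' * a0 + t' * a1) * (s' * b0 + t' * b1)"
      using q by linarith
    have sc: "s' / p * x + t' / p * y = (s' * x + t' * y) / p" for x y by (simp add: add_divide_distrib)
    show ?R
    proof (intro exI conjI)
      show "s' / p + t' / p = 1" using p by (simp flip: add_divide_distrib)
      have "k * ((s' * c0 + t' * c1) * (s' * d0 + t' * d1)) / (p * p) <
          (s' * a0 + t' * a1) * (s' * b0 + t' * b1) / (p * p)"
        using C p by (intro divide_strict_right_mono) auto
      then show "k * ((s' / p * c0 + t' / p * c1) * (s' / p * d0 + t' / p * d1)) <
          (s' / p * a0 + t' / p * a1) * (s' / p * b0 + t' / p * b1)"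
        unfolding sc by simp
    qed (simp_all only: sc, use st p A B in simp_all)
  next
    assume ?R
    then obtain s t where st: "0 \<le> s" "0 \<le> t" "s + t = 1"
      and A: "0 < s * a0 + t * a1" and B: "0 < s * b0 + t * b1"
      and C: "k * ((s * c0 + t * c1) * (s * d0 + t * d1)) < (s * a0 + t * a1) * (s * b0 + t * b1)" by blast
    define x where "x i = (if i = 0 then s else t)" for i :: nat
    let ?S = "{g\<in>set gs. (\<forall>i\<in>{}. g ! i = 0) \<and> (\<forall>c\<in>set [[a0, a1], [b0, b1]]. True \<longrightarrow> 0 \<le> dot c g)}"
    have arr: "(\<forall>g\<in>set gs. in_simplex 2 g) \<and> in_cone 2 ?S x"
      unfolding gs_def
    proof (rule finite_arrangement[OF _ gens])
      show "in_cone 2 {g \<in> set [[1, 0], [0, 1]]. \<forall>i\<in>{}. g ! i = 0} x"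
        unfolding in_cone_def
        by (rule exI[of _ "\<lambda>g. s * g ! 0 + t * g ! 1"])
          (use st in \<open>auto simp: x_def less_2_cases_iff insert_Collect[symmetric] Collect_disj_eq\<close>)
    qed (use A B in \<open>auto simp: x_def numeral_2_eq_2 algebra_simps\<close>)
    have fin: "finite ?S" "\<forall>g\<in>?S. in_simplex 2 g" using arr by auto
    have x1: "(\<Sum>i<2. x i) = 1" using st by (simp add: x_def numeral_2_eq_2)
    \<comment> \<open>\<open>u\<close> has at least as much weight on the first row as the solution,
      and \<open>v\<close> below at least as much on the second; hence the solution lies between
      \<open>v\<close> and \<open>u\<close>.\<close>
    obtain u where u: "u \<in> ?S" "s \<le> u ! 0"
      using in_cone_dominates[OF fin conjunct2[OF arr] x1, of "\<lambda>i. if i = 0 then 1 else 0"]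
      by (auto simp: x_def numeral_2_eq_2)
    obtain v where v: "v \<in> ?S" "t \<le> v ! 1"
      using in_cone_dominates[OF fin conjunct2[OF arr] x1, of "\<lambda>i. if i = 0 then 0 else 1"]
      by (auto simp: x_def numeral_2_eq_2)
    have "in_simplex 2 u" "in_simplex 2 v" using u v fin by auto
    then obtain u0 u1 v0 v1 where u': "u = [u0, u1]" "u0 + u1 = 1" and v': "v = [v0, v1]" "v0 + v1 = 1"
      by (force simp: in_simplex_def numeral_2_eq_2 length_Suc_conv)
    have "\<exists>r. 0 \<le> r \<and> r \<le> 1 \<and> s = r * u0 + (1 - r) * v0"
    proof (cases "u0 = v0")
      case True
      then have "s = 1 * u0 + (1 - 1) * v0" using u v u' v' st by simp
      then show ?thesis by (intro exI[of _ 1]) simp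
    next
      case False
      then have lt: "v0 < u0" "v0 \<le> s" "s \<le> u0" using u v u' v' st by simp_all
      define r where "r = (s - v0) / (u0 - v0)"
      have "r * (u0 - v0) = s - v0" "0 \<le> r" "r \<le> 1" using lt by (simp_all add: r_def)
      then show ?thesis by (intro exI[of _ r]) (simp add: algebra_simps)
    qed
    then obtain r where r: "0 \<le> r" "r \<le> 1" and s: "s = r * u0 + (1 - r) * v0" by blast
    have "r * u1 + (1 - r) * v1 = 1 - (r * u0 + (1 - r) * v0)"
      using u' v' by (simp add: algebra_simps flip: eq_diff_eq)
    then have t: "t = r * u1 + (1 - r) * v1" using st s by simp
    have lin: "s * y + t * z = r * dot [y, z] u + (1 - r) * dot [y, z] v" for y z
      by (simp add: u' v' s t algebra_simps)
    have "0 < r * r * ?f u u + r * (1 - r) * (?f u v + ?f v u) + (1 - r) * (1 - r) * ?f v v"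
      using C unfolding lin form_def by (simp add: algebra_simps)
    then have "0 < ?f u u \<or> 0 < ?f v v \<or>
        (0 < ?f u v + ?f v u \<and> 4 * (?f u u * ?f v v) < (?f u v + ?f v u) * (?f u v + ?f v u))"
      using r by (intro quadratic_pos_imp[of r "1 - r"]) auto
    moreover have "0 \<le> ?a u" "0 \<le> ?a v" "0 \<le> ?b u" "0 \<le> ?b v" using u(1) v(1) by auto
    moreover have "0 < ?a u + ?a v"
    proof (rule ccontr)
      assume "\<not> ?thesis"
      then have "?a u = 0" "?a v = 0" using \<open>0 \<le> ?a u\<close> \<open>0 \<le> ?a v\<close> by auto
      with A lin[of a0 a1] show False by simp
    qed
    moreover have "0 < ?b u + ?b v"
    proof (rule ccontr)
      assume "\<not> ?thesis"
      then have "?b u = 0" "?b v = 0" using \<open>0 \<le> ?b u\<close> \<open>0 \<le> ?b v\<close> by auto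
      with B lin[of b0 b1] show False by simp
    qed
    ultimately have "pair_test [a0, a1] [b0, b1] [c0, c1] [d0, d1] k u v \<or>
        pair_test [a0, a1] [b0, b1] [c0, c1] [d0, d1] k v u"
      unfolding pair_test_def by (auto simp: not_less add.commute)
    then show ?L unfolding block_test_def gs_def[symmetric] Let_def using u(1) v(1) by auto
  }
qed

section \<open>Strong equilibria in coordinates\<close>

definition mixed :: "nat \<Rightarrow> (nat \<Rightarrow> real) \<Rightarrow> bool" where
  "mixed m x \<longleftrightarrow> (\<forall>i<m. 0 \<le> x i) \<and> (\<Sum>i<m. x i) = 1"

definition payoff ::
    "nat \<Rightarrow> nat \<Rightarrow> (nat \<Rightarrow> nat \<Rightarrow> real) \<Rightarrow> (nat \<Rightarrow> real) \<Rightarrow> (nat \<Rightarrow> real) \<Rightarrow> real" where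
  "payoff m n a x y = (\<Sum>i<m. \<Sum>j<n. x i * a i j * y j)"

definition strong_nash ::
    "nat \<Rightarrow> nat \<Rightarrow> (nat \<Rightarrow> nat \<Rightarrow> real) \<Rightarrow> (nat \<Rightarrow> nat \<Rightarrow> real) \<Rightarrow> (nat \<Rightarrow> real) \<Rightarrow> (nat \<Rightarrow> real) \<Rightarrow> bool" where
  "strong_nash m n a b x y \<longleftrightarrow> mixed m x \<and> mixed n y \<and>
     (\<forall>z. mixed m z \<longrightarrow> payoff m n a z y \<le> payoff m n a x y) \<and>
     (\<forall>w. mixed n w \<longrightarrow> payoff m n b x w \<le> payoff m n b x y) \<and>
     \<not> (\<exists>z w. mixed m z \<and> mixed n w \<and>
          payoff m n a x y < payoff m n a z w \<and> payoff m n b x y < payoff m n b z w)"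

lemma payoff_rows: "payoff m n a x y = (\<Sum>i<m. x i * (\<Sum>j<n. a i j * y j))"
  by (simp add: payoff_def sum_distrib_left mult_ac)

lemma payoff_columns: "payoff m n a x y = (\<Sum>j<n. y j * (\<Sum>i<m. x i * a i j))"
  unfolding payoff_def by (subst sum.swap) (simp add: sum_distrib_left mult_ac)

lemma payoff_cong:
  "(\<And>i. i < m \<Longrightarrow> x i = x' i) \<Longrightarrow> (\<And>j. j < n \<Longrightarrow> y j = y' j) \<Longrightarrow>
   (\<And>i j. i < m \<Longrightarrow> j < n \<Longrightarrow> a i j = a' i j) \<Longrightarrow> payoff m n a x y = payoff m n a' x' y'"
  by (simp add: payoff_def)

lemma mixed_cong: "(\<And>i. i < m \<Longrightarrow> x i = x' i) \<Longrightarrow> mixed m x = mixed m x'"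
  by (simp add: mixed_def)

lemma payoff_diff:
  assumes "mixed m x" "mixed n y"
  shows "payoff m n (\<lambda>i j. a i j - v) x y = payoff m n a x y - v"
proof -
  have "(\<Sum>i<m. \<Sum>j<n. x i * y j) = 1"
    using assms by (simp add: mixed_def flip: sum_product)
  then have "(\<Sum>i<m. \<Sum>j<n. x i * v * y j) = v"
    by (simp add: mult.assoc mult.commute[of v] flip: sum_distrib_right)
       (simp add: mult.assoc[symmetric] flip: sum_distrib_right)
  then show ?thesis
    by (simp add: payoff_def algebra_simps sum_subtractf)
qed

lemma mean_le:
  assumes "mixed m x" "\<And>i. i < m \<Longrightarrow> f i \<le> v"
  shows "(\<Sum>i<m. x i * f i) \<le> v"
proof -
  have "(\<Sum>i<m. x i * f i) \<le> (\<Sum>i<m. x i * v)"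
    using assms by (intro sum_mono mult_left_mono) (auto simp: mixed_def)
  then show ?thesis using assms by (simp add: mixed_def flip: sum_distrib_right)
qed

lemma mean_eq:
  assumes "mixed m x" "\<And>i. i < m \<Longrightarrow> x i \<noteq> 0 \<Longrightarrow> f i = v"
  shows "(\<Sum>i<m. x i * f i) = v"
proof -
  have "(\<Sum>i<m. x i * f i) = (\<Sum>i<m. x i * v)"
    using assms(2) by (intro sum.cong refl) auto
  then show ?thesis using assms by (simp add: mixed_def flip: sum_distrib_right)
qed

text \<open>Complementary slackness: the nonnegative terms \<open>x i * (v - f i)\<close> add up to
  zero.\<close>

lemma mean_attained:
  assumes "mixed m x" "\<And>i. i < m \<Longrightarrow> f i \<le> v" "(\<Sum>i<m. x i * f i) = v" "i < m" "x i \<noteq> 0"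
  shows "f i = v"
proof -
  have "(\<Sum>i<m. x i * (v - f i)) = 0"
    using assms(1,3) by (simp add: mixed_def right_diff_distrib sum_subtractf flip: sum_distrib_right)
  moreover have "\<And>i. i \<in> {..<m} \<Longrightarrow> 0 \<le> x i * (v - f i)" using assms(1,2) by (simp add: mixed_def)
  ultimately have "\<forall>i\<in>{..<m}. x i * (v - f i) = 0"
    by (subst (asm) sum_nonneg_eq_0_iff) auto
  then show ?thesis using assms by auto
qed

definition pure :: "nat \<Rightarrow> nat \<Rightarrow> real" where
  "pure k i = (if i = k then 1 else 0)"

lemma mixed_pure: "k < m \<Longrightarrow> mixed m (pure k)"
  by (simp add: mixed_def pure_def)

lemma sum_pure: "k < m \<Longrightarrow> (\<Sum>i<m. pure k i * f i) = f k"
  by (simp add: pure_def if_distrib[of "\<lambda>x. x * _"] cong: if_cong)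

text \<open>Linearity reduces unilateral deviations to pure ones. Since product weights have total
  mass one, subtracting the utilities from all payoffs turns joint domination into positivity of two
  bilinear means, to which the block lemmas apply.\<close>

lemma strong_nash_iff:
  "strong_nash m n a b x y \<longleftrightarrow> mixed m x \<and> mixed n y \<and>
     (\<forall>i<m. (\<Sum>j<n. a i j * y j) \<le> payoff m n a x y) \<and>
     (\<forall>j<n. (\<Sum>i<m. x i * b i j) \<le> payoff m n b x y) \<and>
     \<not> (\<exists>i<m. \<exists>i'<m. \<exists>j<n. \<exists>j'<n. block_dominated
          (\<lambda>i j. a i j - payoff m n a x y) (\<lambda>i j. b i j - payoff m n b x y) i i' j j')"
    (is "?L \<longleftrightarrow> ?R")
proof -
  let ?v = "payoff m n a x y" and ?u = "payoff m n b x y"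
  have 1: "(\<forall>z. mixed m z \<longrightarrow> payoff m n a z y \<le> ?v) \<longleftrightarrow> (\<forall>i<m. (\<Sum>j<n. a i j * y j) \<le> ?v)"
    (is "?P \<longleftrightarrow> ?Q")
  proof
    assume ?P
    show ?Q
    proof (intro allI impI)
      fix i assume i: "i < m"
      with \<open>?P\<close> mixed_pure have "payoff m n a (pure i) y \<le> ?v" by blast
      then show "(\<Sum>j<n. a i j * y j) \<le> ?v" using i by (simp add: payoff_rows[of m n a "pure i"] sum_pure)
    qed
  next
    assume q: ?Q
    show ?P
      unfolding payoff_rows[of m n a _ y]
      using q[unfolded payoff_rows] by (auto intro: mean_le)
  qed
  have 2: "(\<forall>w. mixed n w \<longrightarrow> payoff m n b x w \<le> ?u) \<longleftrightarrow> (\<forall>j<n. (\<Sum>i<m. x i * b i j) \<le> ?u)"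
    (is "?P \<longleftrightarrow> ?Q")
  proof
    assume ?P
    show ?Q
    proof (intro allI impI)
      fix j assume j: "j < n"
      with \<open>?P\<close> mixed_pure have "payoff m n b x (pure j) \<le> ?u" by blast
      then show "(\<Sum>i<m. x i * b i j) \<le> ?u" using j by (simp add: payoff_columns[of m n b x "pure j"] sum_pure)
    qed
  next
    assume q: ?Q
    show ?P
      unfolding payoff_columns[of m n b x]
      using q[unfolded payoff_columns] by (auto intro: mean_le)
  qed
  have 3: "(\<exists>z w. mixed m z \<and> mixed n w \<and> ?v < payoff m n a z w \<and> ?u < payoff m n b z w) \<longleftrightarrow>
      (\<exists>i<m. \<exists>i'<m. \<exists>j<n. \<exists>j'<n. block_dominated (\<lambda>i j. a i j - ?v) (\<lambda>i j. b i j - ?u) i i' j j')"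
    (is "?P \<longleftrightarrow> ?Q")
  proof
    assume ?P
    then obtain z w where zw: "mixed m z" "mixed n w"
      and "?v < payoff m n a z w" "?u < payoff m n b z w" by blast
    then have "0 < payoff m n (\<lambda>i j. a i j - ?v) z w" "0 < payoff m n (\<lambda>i j. b i j - ?u) z w"
      by (simp_all add: payoff_diff)
    then show ?Q
      using dominated_imp_block[of "{..<m}" z "{..<n}" w "\<lambda>i j. a i j - ?v" "\<lambda>i j. b i j - ?u"] zw
      by (auto simp: payoff_def mixed_def)
  next
    assume ?Q
    then obtain i i' j j' where i: "i < m" "i' < m" and j: "j < n" "j' < n"
      and bd: "block_dominated (\<lambda>i j. a i j - ?v) (\<lambda>i j. b i j - ?u) i i' j j'" by blast
    obtain z w where zw: "\<And>i. 0 \<le> z i" "(\<Sum>i<m. z i) = 1" "\<And>j. 0 \<le> w j" "(\<Sum>j<n. w j) = 1"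
      and p: "0 < (\<Sum>i<m. \<Sum>j<n. z i * (a i j - ?v) * w j)"
        "0 < (\<Sum>i<m. \<Sum>j<n. z i * (b i j - ?u) * w j)"
      using block_imp_dominated[OF _ _ _ _ _ _ bd, of "{..<m}" "{..<n}"] i j by auto
    have s: "mixed m z" "mixed n w" using zw by (simp_all add: mixed_def)
    from p have "0 < payoff m n (\<lambda>i j. a i j - ?v) z w" "0 < payoff m n (\<lambda>i j. b i j - ?u) z w"
      by (simp_all add: payoff_def)
    then show ?P using s by (auto simp: payoff_diff)
  qed
  show ?thesis unfolding strong_nash_def 1 2 3 ..
qed

lemma best_reply_left:
  assumes sn: "strong_nash m n a b x y" and i: "i < m" "x i \<noteq> 0"
  shows "(\<Sum>j<n. a i j * y j) = payoff m n a x y"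
  by (rule mean_attained[where f = "\<lambda>i. \<Sum>j<n. a i j * y j" and x = x and m = m])
    (use sn i in \<open>auto simp: strong_nash_iff payoff_rows\<close>)

lemma best_reply_right:
  assumes sn: "strong_nash m n a b x y" and j: "j < n" "y j \<noteq> 0"
  shows "(\<Sum>i<m. x i * b i j) = payoff m n b x y"
  by (rule mean_attained[where f = "\<lambda>j. \<Sum>i<m. x i * b i j" and x = y and m = n])
    (use sn j in \<open>auto simp: strong_nash_iff payoff_columns\<close>)

lemma strong_nash_cong:
  assumes "\<And>i. i < m \<Longrightarrow> x i = x' i" "\<And>j. j < n \<Longrightarrow> y j = y' j"
    "\<And>i j. i < m \<Longrightarrow> j < n \<Longrightarrow> a i j = a' i j" "\<And>i j. i < m \<Longrightarrow> j < n \<Longrightarrow> b i j = b' i j"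
  shows "strong_nash m n a b x y \<longleftrightarrow> strong_nash m n a' b' x' y'"
proof -
  have "payoff m n a z w = payoff m n a' z w" "payoff m n b z w = payoff m n b' z w" for z w
    by (rule payoff_cong; use assms in simp)+
  moreover have "payoff m n c x w = payoff m n c x' w" "payoff m n c z y = payoff m n c z y'" for c z w
    by (rule payoff_cong; use assms in simp)+
  moreover have "mixed m x = mixed m x'" "mixed n y = mixed n y'"
    by (rule mixed_cong; use assms in simp)+
  ultimately show ?thesis unfolding strong_nash_def by simp
qed

lemma utility_P1:
  assumes "U1 \<in> carrier_mat m n" "x P1 \<in> carrier_vec m" "x P2 \<in> carrier_vec n"
  shows "utility U1 U2 P1 x = payoff m n (\<lambda>i j. U1 $$ (i, j)) (($) (x P1)) (($) (x P2))"
  using assms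
  by (auto simp: utility_def scalar_prod_def payoff_rows atLeast0LessThan intro!: sum.cong)

lemma utility_P2:
  assumes "U2 \<in> carrier_mat n m" "x P1 \<in> carrier_vec m" "x P2 \<in> carrier_vec n"
  shows "utility U1 U2 P2 x = payoff m n (\<lambda>i j. U2 $$ (j, i)) (($) (x P1)) (($) (x P2))"
  using assms
  by (auto simp: utility_def scalar_prod_def payoff_columns atLeast0LessThan mult.commute
      intro!: sum.cong)

lemma mixed_strategies_iff: "x \<in> mixed_strategies m \<longleftrightarrow> x \<in> carrier_vec m \<and> mixed m (($) x)"
  by (auto simp: mixed_strategies_def mixed_def)

lemma all_player: "(\<forall>i. Q i) \<longleftrightarrow> Q P1 \<and> Q P2"
  by (metis player.exhaust)

text \<open>For one-player coalitions weak Pareto efficiency follows from the Nash condition, so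
  only the coalition of both players remains. \<open>U2\<close> is transposed so that both payoff
  functions take the action of player 1 first.\<close>

lemma strong_nash_equilibrium_iff:
  assumes U: "U1 \<in> carrier_mat m n" "U2 \<in> carrier_mat n m"
  shows "strong_nash_equilibrium U1 U2 x \<longleftrightarrow>
     x P1 \<in> carrier_vec m \<and> x P2 \<in> carrier_vec n \<and>
     strong_nash m n (\<lambda>i j. U1 $$ (i, j)) (\<lambda>i j. U2 $$ (j, i)) (($) (x P1)) (($) (x P2))"
proof -
  let ?a = "\<lambda>i j. U1 $$ (i, j)" and ?b = "\<lambda>i j. U2 $$ (j, i)"
  let ?x = "($) (x P1)" and ?y = "($) (x P2)"
  have act: "actions U1 P1 = m" "actions U1 P2 = n" using U by (auto simp: actions_def)
  have lift: "\<exists>X\<in>carrier_vec k. \<forall>i<k. X $ i = z i" for z :: "nat \<Rightarrow> real" and k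
    by (rule bexI[of _ "vec k z"]) auto
  show ?thesis
  proof (cases "x P1 \<in> mixed_strategies m \<and> x P2 \<in> mixed_strategies n")
    case False
    then show ?thesis
      by (auto simp: strong_nash_equilibrium_def nash_equilibrium_def all_player act strong_nash_def
          mixed_strategies_iff)
  next
    case True
    then have X: "x P1 \<in> carrier_vec m" "x P2 \<in> carrier_vec n"
      "mixed m ?x" "mixed n ?y" by (auto simp: mixed_strategies_iff)
    note ut = utility_P1[OF U(1)] utility_P2[OF U(2)]
    have n1: "(\<exists>z\<in>mixed_strategies m. utility U1 U2 P1 (x(P1 := z)) > utility U1 U2 P1 x) \<longleftrightarrow>
        (\<exists>z. mixed m z \<and> payoff m n ?a ?x ?y < payoff m n ?a z ?y)"
      (is "?P \<longleftrightarrow> ?Q")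
    proof
      assume ?P
      then show ?Q using X by (auto simp: ut mixed_strategies_iff)
    next
      assume ?Q
      then obtain z where z: "mixed m z"
        "payoff m n ?a ?x ?y < payoff m n ?a z ?y" by blast
      obtain Z where Z: "Z \<in> carrier_vec m" "\<forall>i<m. Z $ i = z i" using lift by blast
      have "mixed m (($) Z)" "payoff m n ?a (($) Z) ?y = payoff m n ?a z ?y"
        using z(1) Z mixed_cong[of m "($) Z" z] by (auto intro: payoff_cong)
      then show ?P using z Z X by (intro bexI[of _ Z]) (auto simp: ut mixed_strategies_iff)
    qed
    have n2: "(\<exists>z\<in>mixed_strategies n. utility U1 U2 P2 (x(P2 := z)) > utility U1 U2 P2 x) \<longleftrightarrow>
        (\<exists>w. mixed n w \<and> payoff m n ?b ?x ?y < payoff m n ?b ?x w)"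
      (is "?P \<longleftrightarrow> ?Q")
    proof
      assume ?P
      then show ?Q using X by (auto simp: ut mixed_strategies_iff)
    next
      assume ?Q
      then obtain z where z: "mixed n z"
        "payoff m n ?b ?x ?y < payoff m n ?b ?x z" by blast
      obtain Z where Z: "Z \<in> carrier_vec n" "\<forall>i<n. Z $ i = z i" using lift by blast
      have "mixed n (($) Z)" "payoff m n ?b ?x (($) Z) = payoff m n ?b ?x z"
        using z(1) Z mixed_cong[of n "($) Z" z] by (auto intro: payoff_cong)
      then show ?P using z Z X by (intro bexI[of _ Z]) (auto simp: ut mixed_strategies_iff)
    qed
    have nash: "nash_equilibrium U1 U2 x \<longleftrightarrow>
        (\<forall>z. mixed m z \<longrightarrow> payoff m n ?a z ?y \<le> payoff m n ?a ?x ?y) \<and>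
        (\<forall>w. mixed n w \<longrightarrow> payoff m n ?b ?x w \<le> payoff m n ?b ?x ?y)"
      unfolding nash_equilibrium_def all_player act n1 n2 using True by (auto simp: not_less)
    have par: "\<not> weakly_pareto_efficient U1 U2 {P1, P2} x \<longleftrightarrow>
        (\<exists>z w. mixed m z \<and> mixed n w \<and>
          payoff m n ?a ?x ?y < payoff m n ?a z w \<and>
          payoff m n ?b ?x ?y < payoff m n ?b z w)"
      (is "?P \<longleftrightarrow> ?Q")
    proof
      assume ?P
      then obtain y where y: "y P1 \<in> mixed_strategies m" "y P2 \<in> mixed_strategies n"
        "utility U1 U2 P1 x < utility U1 U2 P1 y" "utility U1 U2 P2 x < utility U1 U2 P2 y"
        by (auto simp: weakly_pareto_efficient_def act)
      then show ?Q using X unfolding mixed_strategies_iff by (auto simp: ut)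
    next
      assume ?Q
      then obtain z w where zw: "mixed m z" "mixed n w"
        "payoff m n ?a ?x ?y < payoff m n ?a z w"
        "payoff m n ?b ?x ?y < payoff m n ?b z w" by blast
      obtain Z where Z: "Z \<in> carrier_vec m" "\<forall>i<m. Z $ i = z i" using lift by blast
      obtain W where W: "W \<in> carrier_vec n" "\<forall>i<n. W $ i = w i" using lift by blast
      have "mixed m (($) Z)" "mixed n (($) W)" "payoff m n c (($) Z) (($) W) = payoff m n c z w" for c
        using zw Z W mixed_cong[of m "($) Z" z] mixed_cong[of n "($) W" w] by (auto intro: payoff_cong)
      then show ?P using zw Z W X unfolding weakly_pareto_efficient_def
        by (simp add: act) (intro exI[of _ "\<lambda>i. case i of P1 \<Rightarrow> Z | P2 \<Rightarrow> W"],
          auto simp: ut mixed_strategies_iff all_player split: player.split)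
    qed
    have single: "weakly_pareto_efficient U1 U2 C x"
      if ne: "nash_equilibrium U1 U2 x" and C: "C = {i}" for C i
    proof -
      have False if y: "\<forall>k. k \<notin> C \<longrightarrow> y k = x k" "y i \<in> mixed_strategies (actions U1 i)"
        "utility U1 U2 i x < utility U1 U2 i y" for y
      proof -
        have "y = x(i := y i)" using y C by auto
        then show False using ne y unfolding nash_equilibrium_def by metis
      qed
      then show ?thesis using C unfolding weakly_pareto_efficient_def by blast
    qed
    have sets: "C = {} \<or> C = {P1} \<or> C = {P2} \<or> C = {P1, P2}" for C
    proof -
      have "C \<subseteq> {P1, P2}" using player.exhaust by blast
      then show ?thesis by blast
    qed
    have "(\<forall>C. C \<noteq> {} \<longrightarrow> weakly_pareto_efficient U1 U2 C x) \<longleftrightarrow>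
        weakly_pareto_efficient U1 U2 {P1, P2} x" if "nash_equilibrium U1 U2 x"
      using sets single[OF that] by (metis insert_not_empty)
    then have "strong_nash_equilibrium U1 U2 x \<longleftrightarrow>
        nash_equilibrium U1 U2 x \<and> weakly_pareto_efficient U1 U2 {P1, P2} x"
      unfolding strong_nash_equilibrium_def by blast
    also have "\<dots> \<longleftrightarrow> strong_nash m n ?a ?b ?x ?y"
      unfolding strong_nash_def nash par[symmetric] using X(3,4) by simp
    finally show ?thesis using X(1,2) by simp
  qed
qed

section \<open>Finitely many candidates\<close>

text \<open>Ordered pairs: each comparison of two opponent actions must be available with either
  sign, because cells are described by inequalities \<open>0 \<le> dot c g\<close> only.\<close>

definition differences :: "real list list \<Rightarrow> real list list" where
  "differences B = map (\<lambda>(r, s). lin_comb 1 r (-1) s) (List.product B B)"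

definition unit :: "nat \<Rightarrow> nat \<Rightarrow> real list" where
  "unit n k = map (pure k) [0..<n]"

definition units :: "nat \<Rightarrow> real list list" where
  "units n = map (unit n) [0..<n]"

text \<open>A finite subset of the mixed strategies that contains the vertices of all regions on which
  the opponent, whose payoff rows are \<open>B\<close>, has a constant set of best responses.\<close>

definition vertices :: "real list list \<Rightarrow> nat \<Rightarrow> real list list" where
  "vertices B n = foldr split_by (differences B) (units n)"

lemma length_unit [simp]: "length (unit n k) = n"
  by (simp add: unit_def)

lemma nth_unit [simp]: "i < n \<Longrightarrow> unit n k ! i = pure k i"
  by (simp add: unit_def)

lemma set_units: "set (units n) = unit n ` {..<n}"
  by (auto simp: units_def)

lemma in_simplex_unit: "k < n \<Longrightarrow> in_simplex n (unit n k)"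
  by (simp add: in_simplex_def pure_def)

text \<open>The support of \<open>x\<close> and the optimality of the actions in \<open>S\<close>
  cut out a cell of the arrangement. The listed points of this cell generate \<open>x\<close>, so
  one of them gives at least the same value to the linear payoff of \<open>j0\<close>.\<close>

lemma vertices_dominate:
  assumes B: "\<forall>r\<in>set B. length r = m"
    and x: "mixed m x" and S: "S \<subseteq> {..<length B}" "j0 \<in> S"
    and br: "\<And>j j'. j \<in> S \<Longrightarrow> j' < length B \<Longrightarrow> (\<Sum>i<m. B ! j' ! i * x i) \<le> (\<Sum>i<m. B ! j ! i * x i)"
  shows "\<exists>g\<in>set (vertices B m). in_simplex m g \<and> (\<forall>i<m. x i = 0 \<longrightarrow> g ! i = 0) \<and>
    (\<forall>j\<in>S. \<forall>j'<length B. dot (B ! j') g \<le> dot (B ! j) g) \<and>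
    (\<Sum>i<m. B ! j0 ! i * x i) \<le> dot (B ! j0) g"
proof -
  define F where "F = {i. i < m \<and> x i = 0}"
  define Q where "Q c \<longleftrightarrow> (\<exists>j\<in>S. \<exists>j'<length B. c = lin_comb 1 (B ! j) (-1) (B ! j'))" for c
  have len: "length (B ! j) = m" if "j < length B" for j using B that by simp
  let ?G = "{g\<in>set (vertices B m). (\<forall>i\<in>F. g ! i = 0) \<and> (\<forall>c\<in>set (differences B). Q c \<longrightarrow> 0 \<le> dot c g)}"
  have arr: "(\<forall>g\<in>set (vertices B m). in_simplex m g) \<and> in_cone m ?G x"
    unfolding vertices_def
  proof (rule finite_arrangement)
    let ?U = "{g \<in> set (units m). \<forall>i\<in>F. g ! i = 0}"
    let ?K = "{k. k < m \<and> x k \<noteq> 0}"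
    \<comment> \<open>The starting point of the arrangement: \<open>x\<close> is a combination of
      the unit vectors of its own support.\<close>
    have "in_cone m ?U (\<lambda>i. \<Sum>k\<in>?K. x k * unit m k ! i)"
      using x by (intro in_cone_sum in_cone_member) (auto simp: mixed_def set_units F_def pure_def)
    moreover have "(\<Sum>k\<in>?K. x k * unit m k ! i) = x i" if "i < m" for i
      using that by (simp add: pure_def if_distrib[of "\<lambda>y. _ * y"] cong: if_cong)
    ultimately show "in_cone m ?U x" by (rule in_cone_cong[rotated])
    show "\<forall>c\<in>set (differences B). Q c \<longrightarrow> 0 \<le> (\<Sum>i<m. c ! i * x i)"
    proof (intro ballI impI)
      fix c assume "Q c"
      then obtain j j' where j: "j \<in> S" "j' < length B" and c: "c = lin_comb 1 (B ! j) (-1) (B ! j')"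
        unfolding Q_def by blast
      have "j < length B" using S j by auto
      then have "(\<Sum>i<m. c ! i * x i) = (\<Sum>i<m. B ! j ! i * x i) - (\<Sum>i<m. B ! j' ! i * x i)"
        using j by (simp add: c len left_diff_distrib sum_subtractf)
      then show "0 \<le> (\<Sum>i<m. c ! i * x i)" using br[OF j] by simp
    qed
  qed (use B in \<open>auto simp: differences_def F_def set_units in_simplex_unit\<close>)
  have "\<exists>g\<in>?G. (\<Sum>i<m. B ! j0 ! i * x i) \<le> (\<Sum>i<m. B ! j0 ! i * g ! i)"
    by (rule in_cone_dominates) (use arr x in \<open>auto simp: mixed_def\<close>)
  then obtain g where g: "g \<in> ?G" "(\<Sum>i<m. B ! j0 ! i * x i) \<le> (\<Sum>i<m. B ! j0 ! i * g ! i)" by blast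
  have sg: "in_simplex m g" using g arr by blast
  show ?thesis
  proof (intro bexI[of _ g] conjI ballI allI impI)
    fix j j' assume j: "j \<in> S" "j' < length B"
    then have "j < length B" using S by auto
    with j have "lin_comb 1 (B ! j) (-1) (B ! j') \<in> set (differences B)"
      unfolding differences_def set_map set_product
      by (intro image_eqI[of _ _ "(B ! j, B ! j')"]) auto
    moreover have "Q (lin_comb 1 (B ! j) (-1) (B ! j'))" using j by (auto simp: Q_def)
    ultimately have "0 \<le> dot (lin_comb 1 (B ! j) (-1) (B ! j')) g" using g by blast
    then show "dot (B ! j') g \<le> dot (B ! j) g"
      using sg j \<open>j < length B\<close> len by (simp add: dot_lin_comb_left[of _ m] in_simplex_def)
  next
    show "(\<Sum>i<m. B ! j0 ! i * x i) \<le> dot (B ! j0) g"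
      using g(2) S sg len by (subst dot_eq_sum) (auto simp: in_simplex_def)
  qed (use g sg in \<open>auto simp: F_def\<close>)
qed

lemma in_simplex_mixed: "in_simplex n g \<longleftrightarrow> length g = n \<and> mixed n ((!) g)"
  by (simp add: in_simplex_def mixed_def)

lemma mixed_support: "mixed n x \<Longrightarrow> \<exists>i<n. x i \<noteq> 0"
  by (metis mixed_def lessThan_iff sum.neutral zero_neq_one)

text \<open>As long as supports shrink and best replies persist, the utility of player 2 depends on
  \<open>g\<close> only and that of player 1 on \<open>h\<close> only. Hence the two vertices can be
  chosen independently, each raising the opponent's utility weakly, and a profile dominating
  \<open>(g, h)\<close> would dominate \<open>(x, y)\<close>.\<close>

lemma strong_nash_at_vertices:
  assumes A: "length A = m" "\<forall>r\<in>set A. length r = n" and B: "length B = n" "\<forall>r\<in>set B. length r = m"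
    and sn: "strong_nash m n (\<lambda>i j. A ! i ! j) (\<lambda>i j. B ! j ! i) x y"
  shows "\<exists>g\<in>set (vertices B m). \<exists>h\<in>set (vertices A n). in_simplex m g \<and> in_simplex n h \<and>
    strong_nash m n (\<lambda>i j. A ! i ! j) (\<lambda>i j. B ! j ! i) ((!) g) ((!) h)"
proof -
  let ?a = "\<lambda>i j. A ! i ! j" and ?b = "\<lambda>i j. B ! j ! i"
  have x: "mixed m x" and y: "mixed n y" using sn by (auto simp: strong_nash_def)
  define v u where "v = payoff m n ?a x y" and "u = payoff m n ?b x y"
  have na: "(\<Sum>j<n. ?a i j * y j) \<le> v" if "i < m" for i
    using sn that unfolding strong_nash_iff v_def by blast
  have nb: "(\<Sum>i<m. ?b i j * x i) \<le> u" if "j < n" for j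
    using sn that unfolding strong_nash_iff u_def by (simp add: mult.commute)
  have ea: "(\<Sum>j<n. ?a i j * y j) = v" if "i < m" "x i \<noteq> 0" for i
    by (rule mean_attained[where f = "\<lambda>i. \<Sum>j<n. ?a i j * y j", OF x _ _ that])
      (use na in \<open>auto simp: v_def payoff_rows\<close>)
  have eb: "(\<Sum>i<m. ?b i j * x i) = u" if "j < n" "y j \<noteq> 0" for j
    by (rule mean_attained[where f = "\<lambda>j. \<Sum>i<m. ?b i j * x i", OF y _ _ that])
      (use nb in \<open>auto simp: u_def payoff_columns mult.commute\<close>)
  obtain i0 where i0: "i0 < m" "x i0 \<noteq> 0" using mixed_support[OF x] by blast
  obtain j0 where j0: "j0 < n" "y j0 \<noteq> 0" using mixed_support[OF y] by blast
  obtain g where g: "g \<in> set (vertices B m)" "in_simplex m g" "\<And>i. i < m \<Longrightarrow> x i = 0 \<Longrightarrow> g ! i = 0"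
    and gb: "\<And>j j'. j < n \<Longrightarrow> y j \<noteq> 0 \<Longrightarrow> j' < n \<Longrightarrow> dot (B ! j') g \<le> dot (B ! j) g"
    and gu: "u \<le> dot (B ! j0) g"
  proof -
    have "{j. j < n \<and> y j \<noteq> 0} \<subseteq> {..<length B}" using B(1) by auto
    from vertices_dominate[OF B(2) x this, of j0] show ?thesis using that j0 eb nb B(1) by auto
  qed
  obtain h where h: "h \<in> set (vertices A n)" "in_simplex n h" "\<And>j. j < n \<Longrightarrow> y j = 0 \<Longrightarrow> h ! j = 0"
    and ha: "\<And>i i'. i < m \<Longrightarrow> x i \<noteq> 0 \<Longrightarrow> i' < m \<Longrightarrow> dot (A ! i') h \<le> dot (A ! i) h"
    and hv: "v \<le> dot (A ! i0) h"
  proof -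
    have "{i. i < m \<and> x i \<noteq> 0} \<subseteq> {..<length A}" using A(1) by auto
    from vertices_dominate[OF A(2) y this, of i0] show ?thesis using that i0 ea na A(1) by auto
  qed
  have dg: "dot (B ! j) g = (\<Sum>i<m. g ! i * ?b i j)" if "j < n" for j
    using that B g by (simp add: dot_eq_sum in_simplex_def mult.commute)
  have dh: "dot (A ! i) h = (\<Sum>j<n. ?a i j * h ! j)" if "i < m" for i
    using that A h by (simp add: dot_eq_sum in_simplex_def)
  have mg: "mixed m ((!) g)" and mh: "mixed n ((!) h)" using g h by (auto simp: in_simplex_mixed)
  have pa: "payoff m n ?a ((!) g) ((!) h) = dot (A ! i0) h"
    unfolding payoff_rows
  proof (rule mean_eq[OF mg])
    fix i assume i: "i < m" "g ! i \<noteq> 0"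
    then have "x i \<noteq> 0" using g by blast
    then show "(\<Sum>j<n. ?a i j * h ! j) = dot (A ! i0) h"
      using ha[OF i(1) _ i0(1)] ha[OF i0 i(1)] dh[OF i(1)] by simp
  qed
  have pb: "payoff m n ?b ((!) g) ((!) h) = dot (B ! j0) g"
    unfolding payoff_columns
  proof (rule mean_eq[OF mh])
    fix j assume j: "j < n" "h ! j \<noteq> 0"
    then have "y j \<noteq> 0" using h by blast
    then show "(\<Sum>i<m. g ! i * ?b i j) = dot (B ! j0) g"
      using gb[OF j(1) _ j0(1)] gb[OF j0 j(1)] dg[OF j(1)] by simp
  qed
  have "strong_nash m n ?a ?b ((!) g) ((!) h)"
    unfolding strong_nash_def
  proof (intro conjI allI impI mg mh notI)
    fix z assume z: "mixed m z"
    show "payoff m n ?a z ((!) h) \<le> payoff m n ?a ((!) g) ((!) h)"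
      unfolding payoff_rows[of m n ?a z] pa using ha[OF i0] dh by (auto intro!: mean_le[OF z])
  next
    fix w assume w: "mixed n w"
    show "payoff m n ?b ((!) g) w \<le> payoff m n ?b ((!) g) ((!) h)"
      unfolding payoff_columns[of m n ?b _ w] pb using gb[OF j0] dg by (auto intro!: mean_le[OF w])
  next
    assume "\<exists>z w. mixed m z \<and> mixed n w \<and> payoff m n ?a ((!) g) ((!) h) < payoff m n ?a z w \<and>
      payoff m n ?b ((!) g) ((!) h) < payoff m n ?b z w"
    then have "\<exists>z w. mixed m z \<and> mixed n w \<and> v < payoff m n ?a z w \<and> u < payoff m n ?b z w"
      using hv gu unfolding pa pb by (meson order_le_less_trans)
    then show False using sn unfolding strong_nash_def v_def u_def by blast
  qed
  then show ?thesis using g h by blast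
qed

section \<open>Generic games\<close>

text \<open>The last clause is the vanishing cross product of the payoff-pair differences from
  \<open>(i, j)\<close> to \<open>(i', j)\<close> and to \<open>(i, j')\<close>.\<close>

definition degenerate ::
    "nat \<Rightarrow> nat \<Rightarrow> (nat \<Rightarrow> nat \<Rightarrow> real) \<Rightarrow> (nat \<Rightarrow> nat \<Rightarrow> real) \<Rightarrow> bool" where
  "degenerate m n a b \<longleftrightarrow> (\<exists>i<m. \<exists>i'<m. \<exists>j<n. \<exists>j'<n.
     i \<noteq> i' \<and> a i j = a i' j \<or> j \<noteq> j' \<and> b i j = b i j' \<or>
     i \<noteq> i' \<and> j \<noteq> j' \<and> (a i' j - a i j) * (b i j' - b i j) = (a i j' - a i j) * (b i' j - b i j))"


section \<open>Effects of moves inside the supports of an equilibrium\<close>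

lemma payoff_add_left: "payoff m n a (\<lambda>i. s * x i + t * z i) y = s * payoff m n a x y + t * payoff m n a z y"
  unfolding payoff_def sum_distrib_left sum.distrib[symmetric]
  by (intro sum.cong refl) (simp add: algebra_simps)

lemma payoff_add_right: "payoff m n a x (\<lambda>j. s * y j + t * w j) = s * payoff m n a x y + t * payoff m n a x w"
  unfolding payoff_def sum_distrib_left sum.distrib[symmetric]
  by (intro sum.cong refl) (simp add: algebra_simps)

definition tangent :: "nat \<Rightarrow> (nat \<Rightarrow> real) \<Rightarrow> (nat \<Rightarrow> real) \<Rightarrow> bool" where
  "tangent m x d \<longleftrightarrow> (\<forall>i<m. x i = 0 \<longrightarrow> d i = 0) \<and> (\<Sum>i<m. d i) = 0"

lemma tangent_add: "tangent m x d \<Longrightarrow> tangent m x d' \<Longrightarrow> tangent m x (\<lambda>i. s * d i + t * d' i)"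
  by (simp add: tangent_def sum.distrib flip: sum_distrib_left)

lemma tangent_pure:
  "mixed m x \<Longrightarrow> k < m \<Longrightarrow> x k \<noteq> 0 \<Longrightarrow> tangent m x (\<lambda>i. 1 * pure k i + (-1) * x i)"
  by (auto simp: tangent_def mixed_def pure_def sum_subtractf)

lemma mixed_nearby:
  assumes x: "mixed m x" and d: "tangent m x d"
  shows "\<exists>r>0. \<forall>e. \<bar>e\<bar> \<le> r \<longrightarrow> mixed m (\<lambda>i. 1 * x i + e * d i)"
proof -
  \<comment> \<open>Coordinates that do not move impose no bound; the value 1 merely keeps their
    entry in the minimum positive.\<close>
  define f where "f i = (if d i = 0 then 1 else x i / \<bar>d i\<bar>)" for i
  define r where "r = Min (f ` {..<m})"
  have ne: "f ` {..<m} \<noteq> {}" using mixed_support[OF x] by auto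
  have "0 < f i" if "i < m" for i
    using x d that by (force simp: f_def tangent_def mixed_def)
  then have "0 < r" unfolding r_def using ne by (subst Min_gr_iff) auto
  moreover have "mixed m (\<lambda>i. 1 * x i + e * d i)" if e: "\<bar>e\<bar> \<le> r" for e
  proof -
    have "0 \<le> x i + e * d i" if i: "i < m" for i
    proof (cases "d i = 0")
      case True
      then show ?thesis using x i by (simp add: mixed_def)
    next
      case False
      have "r \<le> f i" unfolding r_def using i by simp
      with e False have "\<bar>e\<bar> \<le> x i / \<bar>d i\<bar>" by (simp add: f_def)
      with False have "\<bar>e * d i\<bar> \<le> x i" by (simp add: abs_mult field_simps)
      then show ?thesis by linarith
    qed
    moreover have "(\<Sum>i<m. x i + e * d i) = 1"
      using x d by (simp add: mixed_def tangent_def sum.distrib flip: sum_distrib_left)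
    ultimately show ?thesis by (simp add: mixed_def)
  qed
  ultimately show ?thesis by blast
qed

text \<open>\<open>e\<close> and \<open>h\<close> are the step lengths of players 1 and 2;
  \<open>P\<close> and \<open>Q\<close> are the linear effects on the respective opponent,
  \<open>M\<close> and \<open>N\<close> the bilinear ones on players 1 and 2. For small steps a
  nonzero linear term outweighs its bilinear term, so suitable signs of \<open>e\<close> and
  \<open>h\<close> would make both gains positive.\<close>

lemma no_common_improvement:
  fixes P Q M N r :: real
  assumes r: "0 < r"
    and no: "\<And>e h. \<bar>e\<bar> \<le> r \<Longrightarrow> \<bar>h\<bar> \<le> r \<Longrightarrow> \<not> (0 < h * P + e * h * M \<and> 0 < e * Q + e * h * N)"
  shows "P = 0 \<or> Q = 0" "P = 0 \<Longrightarrow> Q \<noteq> 0 \<Longrightarrow> M = 0" "Q = 0 \<Longrightarrow> P \<noteq> 0 \<Longrightarrow> N = 0"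
    "P = 0 \<Longrightarrow> Q = 0 \<Longrightarrow> M * N \<le> 0"
proof -
  have small: "\<exists>s. 0 < s \<and> s \<le> r \<and> s * \<bar>K\<bar> < \<bar>L\<bar>" if "L \<noteq> 0" for K L :: real
  proof (intro exI conjI)
    let ?s = "min r (\<bar>L\<bar> / (\<bar>K\<bar> + 1))"
    show "0 < ?s" "?s \<le> r" using r that by auto
    have "?s * \<bar>K\<bar> \<le> \<bar>L\<bar> / (\<bar>K\<bar> + 1) * \<bar>K\<bar>" by (intro mult_right_mono) auto
    also have "\<dots> < \<bar>L\<bar>" using that by (simp add: field_simps)
    finally show "?s * \<bar>K\<bar> < \<bar>L\<bar>" .
  qed
  have pos: "0 < s * sgn L * L + K'" if "0 < s" "\<bar>K'\<bar> \<le> s * (t * \<bar>K\<bar>)" "t * \<bar>K\<bar> < \<bar>L\<bar>" for s t L K K' :: real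
  proof -
    have "s * (t * \<bar>K\<bar>) < s * \<bar>L\<bar>" using that by simp
    moreover have "s * sgn L * L = s * \<bar>L\<bar>" by (simp add: sgn_if)
    ultimately show ?thesis using that by linarith
  qed
  show "P = 0 \<or> Q = 0"
  proof (rule ccontr)
    assume ne: "\<not> ?thesis"
    obtain s t where s: "0 < s" "s \<le> r" "s * \<bar>M\<bar> < \<bar>P\<bar>" and t: "0 < t" "t \<le> r" "t * \<bar>N\<bar> < \<bar>Q\<bar>"
      using small[of P M] small[of Q N] ne by blast
    define w where "w = min s t"
    have w: "0 < w" "w \<le> r" "w \<le> s" "w \<le> t" using s t by (auto simp: w_def)
    have wM: "w * \<bar>M\<bar> < \<bar>P\<bar>" using mult_right_mono[OF w(3), of "\<bar>M\<bar>"] s by simp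
    have wN: "w * \<bar>N\<bar> < \<bar>Q\<bar>" using mult_right_mono[OF w(4), of "\<bar>N\<bar>"] t by simp
    let ?e = "w * sgn Q" and ?h = "w * sgn P"
    have a: "\<bar>?e\<bar> = w" "\<bar>?h\<bar> = w" using w ne by (auto simp: abs_mult sgn_if)
    have "0 < ?h * P + ?e * ?h * M"
      by (rule pos[OF w(1) _ wM]) (use w a ne in \<open>simp add: abs_mult mult.assoc\<close>)
    moreover have "0 < ?e * Q + ?e * ?h * N"
      by (rule pos[OF w(1) _ wN]) (use w a ne in \<open>simp add: abs_mult mult.assoc\<close>)
    ultimately show False using no[of ?e ?h] w(2) unfolding a by blast
  qed
  show "M = 0" if PQ: "P = 0" "Q \<noteq> 0"
  proof (rule ccontr)
    assume M: "M \<noteq> 0"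
    obtain t where t: "0 < t" "t \<le> r" "t * \<bar>N\<bar> < \<bar>Q\<bar>" using small[OF PQ(2), of N] by blast
    \<comment> \<open>The sign of \<open>e\<close> makes \<open>e * Q\<close> positive; the sign of
      \<open>h\<close> then makes \<open>e * h * M\<close> positive.\<close>
    let ?e = "t * sgn Q" and ?h = "t * (sgn Q * sgn M)"
    have a: "\<bar>?e\<bar> = t" "\<bar>?h\<bar> = t" using t PQ M by (auto simp: abs_mult sgn_if)
    have e: "?e * ?h * M = t * t * \<bar>M\<bar>" using PQ by (simp add: sgn_if)
    have "0 < ?h * P + ?e * ?h * M" unfolding e using t PQ M by simp
    moreover have "0 < ?e * Q + ?e * ?h * N"
      by (rule pos[of _ _ t N]) (use t a in \<open>auto simp: abs_mult mult.assoc\<close>)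
    ultimately show False using no[of ?e ?h] t(2) unfolding a by blast
  qed
  show "N = 0" if PQ: "Q = 0" "P \<noteq> 0"
  proof (rule ccontr)
    assume N: "N \<noteq> 0"
    obtain t where t: "0 < t" "t \<le> r" "t * \<bar>M\<bar> < \<bar>P\<bar>" using small[OF PQ(2), of M] by blast
    let ?h = "t * sgn P" and ?e = "t * (sgn P * sgn N)"
    have a: "\<bar>?e\<bar> = t" "\<bar>?h\<bar> = t" using t PQ N by (auto simp: abs_mult sgn_if)
    have e: "?e * ?h * N = t * t * \<bar>N\<bar>" using PQ by (simp add: sgn_if)
    have "0 < ?e * Q + ?e * ?h * N" unfolding e using t PQ N by simp
    moreover have "0 < ?h * P + ?e * ?h * M"
      by (rule pos[of _ _ t M]) (use t a in \<open>auto simp: abs_mult mult.assoc\<close>)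
    ultimately show False using no[of ?e ?h] t(2) unfolding a by blast
  qed
  show "M * N \<le> 0" if PQ: "P = 0" "Q = 0"
  proof (rule ccontr)
    assume "\<not> ?thesis"
    then have "0 < M \<and> 0 < N \<or> M < 0 \<and> N < 0" by (simp add: not_le zero_less_mult_iff)
    then show False using no[of r r] no[of r "- r"] r PQ by (auto simp: mult_pos_neg)
  qed
qed

text \<open>At \<open>s = k - g\<close>, \<open>t = f - h\<close> both linear forms take the value
  \<open>f * k - g * h\<close>, so its square is nonpositive.\<close>

lemma forms_proportional:
  fixes f g h k :: real
  assumes "\<And>s t. (s * f + t * g) * (s * h + t * k) \<le> 0"
  shows "f * k = g * h"
proof -
  have "(f * k - g * h)\<^sup>2 \<le> 0"
    using assms[of "k - g" "f - h"] by (simp add: power2_eq_square algebra_simps)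
  then show ?thesis by simp
qed

text \<open>Fixing one argument of the bilinear forms leaves two linear forms that are never both
  positive, hence proportional. Comparing the row mixtures \<open>(1, 0)\<close>,
  \<open>(0, 1)\<close> and \<open>(1, 1)\<close> makes the three payoff pairs needed pairwise
  parallel as vectors, and so collinear as points.\<close>

lemma collinear_block:
  fixes a11 a12 a21 a22 b11 b12 b21 b22 :: real
  assumes no: "\<And>p q s t. (p * s * a11 + p * t * a12 + q * s * a21 + q * t * a22) *
      (p * s * b11 + p * t * b12 + q * s * b21 + q * t * b22) \<le> 0"
  shows "(a21 - a11) * (b12 - b11) = (a12 - a11) * (b21 - b11)"
proof -
  have row: "(p * a11 + q * a21) * (p * b12 + q * b22) = (p * a12 + q * a22) * (p * b11 + q * b21)" for p q
    by (rule forms_proportional) (use no[of p _ _ q] in \<open>simp add: algebra_simps\<close>)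
  have col: "a11 * b21 = a21 * b11"
    by (rule forms_proportional) (use no[of _ 1 0] in \<open>simp add: algebra_simps\<close>)
  have r1: "a11 * b12 = a12 * b11" using row[of 1 0] by simp
  have r2: "a21 * b22 = a22 * b21" using row[of 0 1] by simp
  have r3: "a11 * b22 + a21 * b12 = a12 * b21 + a22 * b11"
    using row[of 1 1] r1 r2 by (simp add: algebra_simps)
  have "a21 * b12 = a12 * b21"
  \<comment> \<open>The relations involving the first payoff pair say nothing when it is zero; then
    the mixed relation \<open>r3\<close> is already the claim.\<close>
  proof (cases "a11 = 0 \<and> b11 = 0")
    case True
    then show ?thesis using r3 by simp
  next
    case False
    have "a11 * (a21 * b12 - a12 * b21) = 0" "b11 * (a21 * b12 - a12 * b21) = 0"
    proof -
      have "a11 * (a21 * b12 - a12 * b21) = a21 * (a11 * b12) - a12 * (a11 * b21)" by (simp add: algebra_simps)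
      then show "a11 * (a21 * b12 - a12 * b21) = 0" unfolding r1 col by simp
      have "b11 * (a21 * b12 - a12 * b21) = (a21 * b11) * b12 - (a12 * b11) * b21" by (simp add: algebra_simps)
      then show "b11 * (a21 * b12 - a12 * b21) = 0" unfolding r1[symmetric] col[symmetric] by simp
    qed
    then show ?thesis using False by auto
  qed
  then show ?thesis using r1 col by (simp add: algebra_simps)
qed

text \<open>All supported actions are best replies, so a tangent move of one player alone leaves
  that player's utility unchanged; what is left of the two gains are the displayed linear and
  bilinear terms.\<close>

lemma strong_nash_deviation:
  assumes sn: "strong_nash m n a b x y" and d: "tangent m x d" and g: "tangent n y g"
  shows "\<exists>r>0. \<forall>e h. \<bar>e\<bar> \<le> r \<longrightarrow> \<bar>h\<bar> \<le> r \<longrightarrow>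
    \<not> (0 < h * payoff m n a x g + e * h * payoff m n a d g \<and>
       0 < e * payoff m n b d y + e * h * payoff m n b d g)"
proof -
  have x: "mixed m x" and y: "mixed n y" using sn by (auto simp: strong_nash_def)
  note ea = best_reply_left[OF sn]
  note eb = best_reply_right[OF sn]
  have "payoff m n a d y = (\<Sum>i<m. d i * payoff m n a x y)"
    unfolding payoff_rows[of m n a d] using d ea by (intro sum.cong refl) (force simp: tangent_def)
  then have da: "payoff m n a d y = 0" using d by (simp add: tangent_def flip: sum_distrib_right)
  have "payoff m n b x g = (\<Sum>j<n. g j * payoff m n b x y)"
    unfolding payoff_columns[of m n b x g] using g eb by (intro sum.cong refl) (force simp: tangent_def)
  then have gb: "payoff m n b x g = 0" using g by (simp add: tangent_def flip: sum_distrib_right)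
  obtain r where r: "0 < r" "\<And>e. \<bar>e\<bar> \<le> r \<Longrightarrow> mixed m (\<lambda>i. 1 * x i + e * d i)"
    using mixed_nearby[OF x d] by blast
  obtain s where s: "0 < s" "\<And>h. \<bar>h\<bar> \<le> s \<Longrightarrow> mixed n (\<lambda>j. 1 * y j + h * g j)"
    using mixed_nearby[OF y g] by blast
  show ?thesis
  proof (intro exI[of _ "min r s"] conjI allI impI notI)
    fix e h assume eh: "\<bar>e\<bar> \<le> min r s" "\<bar>h\<bar> \<le> min r s" and
      "0 < h * payoff m n a x g + e * h * payoff m n a d g \<and>
       0 < e * payoff m n b d y + e * h * payoff m n b d g"
    then have "payoff m n a x y < payoff m n a (\<lambda>i. 1 * x i + e * d i) (\<lambda>j. 1 * y j + h * g j)"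
      and "payoff m n b x y < payoff m n b (\<lambda>i. 1 * x i + e * d i) (\<lambda>j. 1 * y j + h * g j)"
      unfolding payoff_add_left payoff_add_right by (simp_all add: da gb algebra_simps)
    then show False using sn r(2)[of e] s(2)[of h] eh unfolding strong_nash_def by auto
  qed (use r s in auto)
qed

text \<open>If player 1 can change player 2's utility to first order, the bilinear form of
  \<open>a\<close> vanishes and \<open>a\<close> is constant on column \<open>j\<close> along the
  support of \<open>x\<close>; the symmetric case makes \<open>b\<close> constant on row
  \<open>i\<close>. Otherwise the bilinear forms have no common strict sign and
  \<open>collinear_block\<close> applies.\<close>

lemma strong_nash_mixed_degenerate:
  assumes sn: "strong_nash m n a b x y"
    and i: "i < m" "x i \<noteq> 0" "i' < m" "x i' \<noteq> 0" "i \<noteq> i'"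
    and j: "j < n" "y j \<noteq> 0" "j' < n" "y j' \<noteq> 0" "j \<noteq> j'"
  shows "degenerate m n a b"
proof -
  have x: "mixed m x" and y: "mixed n y" using sn by (auto simp: strong_nash_def)
  let ?P = "payoff m n a x" and ?Q = "\<lambda>d. payoff m n b d y"
  let ?M = "payoff m n a" and ?N = "payoff m n b"
  have alt: "(?P g = 0 \<or> ?Q d = 0) \<and> (?P g = 0 \<longrightarrow> ?Q d \<noteq> 0 \<longrightarrow> ?M d g = 0) \<and>
      (?Q d = 0 \<longrightarrow> ?P g \<noteq> 0 \<longrightarrow> ?N d g = 0) \<and> (?P g = 0 \<longrightarrow> ?Q d = 0 \<longrightarrow> ?M d g * ?N d g \<le> 0)"
    if dg: "tangent m x d" "tangent n y g" for d g
  proof -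
    obtain r where r: "0 < r" and no: "\<And>e h. \<bar>e\<bar> \<le> r \<Longrightarrow> \<bar>h\<bar> \<le> r \<Longrightarrow>
        \<not> (0 < h * ?P g + e * h * ?M d g \<and> 0 < e * ?Q d + e * h * ?N d g)"
      using strong_nash_deviation[OF sn dg] by blast
    show ?thesis using no_common_improvement[OF r no] by blast
  qed
  define dx where "dx k = (\<lambda>i. 1 * pure k i + (-1) * x i)" for k
  define dy where "dy k = (\<lambda>j. 1 * pure k j + (-1) * y j)" for k
  have tx: "tangent m x (dx k)" if "k < m" "x k \<noteq> 0" for k
    unfolding dx_def using tangent_pure[OF x that] .
  have ty: "tangent n y (dy k)" if "k < n" "y k \<noteq> 0" for k
    unfolding dy_def using tangent_pure[OF y that] .
  have pc: "payoff m n c (pure k) (pure l) = c k l" if "k < m" "l < n" for c k l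
    unfolding payoff_rows sum_pure[OF that(1)] using sum_pure[OF that(2), of "c k"] by (simp add: mult.commute)
  have ea: "payoff m n a (pure k) y = payoff m n a x y" if "k < m" "x k \<noteq> 0" for k
    using best_reply_left[OF sn that] by (simp add: payoff_rows[of m n a "pure k"] sum_pure[OF that(1)])
  have eb: "payoff m n b x (pure k) = payoff m n b x y" if "k < n" "y k \<noteq> 0" for k
    using best_reply_right[OF sn that] by (simp add: payoff_columns[of m n b _ "pure k"] sum_pure[OF that(1)])
  have bil: "payoff m n c (dx k) (dy l) =
      c k l - payoff m n c (pure k) y - payoff m n c x (pure l) + payoff m n c x y"
    if "k < m" "l < n" for c k l
    unfolding dx_def dy_def payoff_add_left payoff_add_right by (simp add: pc that)
  consider (A) d where "tangent m x d" "?Q d \<noteq> 0" | (B) g where "tangent n y g" "?P g \<noteq> 0"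
    | (C) "\<And>d. tangent m x d \<Longrightarrow> ?Q d = 0" "\<And>g. tangent n y g \<Longrightarrow> ?P g = 0" by blast
  then show ?thesis
  proof cases
    case (A d)
    have P: "?P g = 0" if "tangent n y g" for g using alt[OF A(1) that] A(2) by blast
    have M: "?M d' g = 0" if t: "tangent m x d'" "tangent n y g" for d' g
    proof (cases "?Q d' = 0")
      case True
      \<comment> \<open>A direction without linear effect is the difference of two directions with
        one, \<open>d' + d\<close> and \<open>d\<close>, on both of which the form vanishes.\<close>
      have "tangent m x (\<lambda>i. 1 * d' i + 1 * d i)" by (rule tangent_add[OF t(1) A(1)])
      moreover have "?Q (\<lambda>i. 1 * d' i + 1 * d i) \<noteq> 0" unfolding payoff_add_left using True A by simp
      ultimately have "?M (\<lambda>i. 1 * d' i + 1 * d i) g = 0" using alt[OF _ t(2)] P[OF t(2)] by blast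
      moreover have "?M d g = 0" using alt[OF A(1) t(2)] P[OF t(2)] A(2) by blast
      ultimately show ?thesis unfolding payoff_add_left by simp
    qed (use alt[OF t] P[OF t(2)] in blast)
    have "a k j = payoff m n a x (pure j)" if "k < m" "x k \<noteq> 0" for k
      using M[OF tx[OF that] ty[OF j(1,2)]] unfolding bil[OF that(1) j(1)] ea[OF that] by simp
    then have "a i j = a i' j" using i by simp
    then show ?thesis using i j unfolding degenerate_def by blast
  next
    case (B g)
    have Q: "?Q d = 0" if "tangent m x d" for d using alt[OF that B(1)] B(2) by blast
    have N: "?N d g' = 0" if t: "tangent m x d" "tangent n y g'" for d g'
    proof (cases "?P g' = 0")
      case True
      have "tangent n y (\<lambda>i. 1 * g' i + 1 * g i)" by (rule tangent_add[OF t(2) B(1)])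
      moreover have "?P (\<lambda>i. 1 * g' i + 1 * g i) \<noteq> 0" unfolding payoff_add_right using True B by simp
      ultimately have "?N d (\<lambda>i. 1 * g' i + 1 * g i) = 0" using alt[OF t(1)] Q[OF t(1)] by blast
      moreover have "?N d g = 0" using alt[OF t(1) B(1)] Q[OF t(1)] B(2) by blast
      ultimately show ?thesis unfolding payoff_add_right by simp
    qed (use alt[OF t] Q[OF t(1)] in blast)
    have "b i k = payoff m n b (pure i) y" if "k < n" "y k \<noteq> 0" for k
      using N[OF tx[OF i(1,2)] ty[OF that]] unfolding bil[OF i(1) that(1)] eb[OF that] by simp
    then have "b i j = b i j'" using j by simp
    then show ?thesis using i j unfolding degenerate_def by blast
  next
    case C
    define v u where "v = payoff m n a x y" and "u = payoff m n b x y"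
    \<comment> \<open>With no first-order effects, each supported column mixed against
      \<open>x\<close> has the equilibrium value too, so on the moves towards pure actions the
      bilinear form is the payoff in excess of \<open>v\<close>.\<close>
    have va: "?M (dx k) (dy l) = a k l - v" if "k < m" "x k \<noteq> 0" "l < n" "y l \<noteq> 0" for k l
    proof -
      have "?P (dy l) = 0" using C(2)[OF ty[OF that(3,4)]] .
      then have "payoff m n a x (pure l) = v" unfolding dy_def payoff_add_right by (simp add: v_def)
      then show ?thesis using bil[OF that(1,3), of a] ea[OF that(1,2)] by (simp add: v_def)
    qed
    have ub: "?N (dx k) (dy l) = b k l - u" if "k < m" "x k \<noteq> 0" "l < n" "y l \<noteq> 0" for k l
    proof -
      have "?Q (dx k) = 0" using C(1)[OF tx[OF that(1,2)]] .
      then have "payoff m n b (pure k) y = u" unfolding dx_def payoff_add_left by (simp add: u_def)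
      then show ?thesis using bil[OF that(1,3), of b] eb[OF that(3,4)] by (simp add: u_def)
    qed
    have "((a i' j - v) - (a i j - v)) * ((b i j' - u) - (b i j - u)) =
        ((a i j' - v) - (a i j - v)) * ((b i' j - u) - (b i j - u))"
    proof (rule collinear_block)
      fix p q s t
      let ?d = "\<lambda>k. p * dx i k + q * dx i' k" and ?g = "\<lambda>k. s * dy j k + t * dy j' k"
      have "tangent m x ?d" "tangent n y ?g" using tx ty i j by (auto intro!: tangent_add)
      then have "?M ?d ?g * ?N ?d ?g \<le> 0" using alt[of ?d ?g] C by blast
      then show "(p * s * (a i j - v) + p * t * (a i j' - v) + q * s * (a i' j - v) + q * t * (a i' j' - v)) *
        (p * s * (b i j - u) + p * t * (b i j' - u) + q * s * (b i' j - u) + q * t * (b i' j' - u)) \<le> 0"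
        unfolding payoff_add_left payoff_add_right using i j by (simp add: va ub algebra_simps)
    qed
    then show ?thesis using i j unfolding degenerate_def by auto
  qed
qed

text \<open>Two mixed supports are excluded by degeneracy. If one player is pure, two supported
  actions of the other are best replies to one action and hence tie.\<close>

lemma generic_strong_nash_pure:
  assumes sn: "strong_nash m n a b x y" and gen: "\<not> degenerate m n a b"
  obtains i j where "i < m" "j < n" "\<And>k. k < m \<Longrightarrow> x k = pure i k" "\<And>k. k < n \<Longrightarrow> y k = pure j k"
proof -
  have x: "mixed m x" and y: "mixed n y" using sn by (auto simp: strong_nash_def)
  obtain i where i: "i < m" "x i \<noteq> 0" using mixed_support[OF x] by blast
  obtain j where j: "j < n" "y j \<noteq> 0" using mixed_support[OF y] by blast
  have one: "z k = pure l k" if "mixed q z" "l < q" "\<And>k. k < q \<Longrightarrow> k \<noteq> l \<Longrightarrow> z k = 0" "k < q"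
    for z :: "nat \<Rightarrow> real" and q l k
  proof -
    have "(\<Sum>k<q. z k) = (\<Sum>k<q. if k = l then z l else 0)" using that by (intro sum.cong) auto
    then have "z l = 1" using that by (simp add: mixed_def)
    then show ?thesis using that by (simp add: pure_def)
  qed
  note ea = best_reply_left[OF sn]
  note eb = best_reply_right[OF sn]
  have "x k = 0 \<or> k = i" if k: "k < m" for k
  proof (rule ccontr)
    assume k': "\<not> ?thesis"
    show False
    proof (cases "\<exists>l<n. y l \<noteq> 0 \<and> l \<noteq> j")
      case True
      then show False using strong_nash_mixed_degenerate[OF sn i k] k' j gen by blast
    next
      case False
      then have yj: "y l = pure j l" if "l < n" for l using one[OF y j(1) _ that] by blast
      have "(\<Sum>l<n. a c l * y l) = a c j" for c
        using sum_pure[OF j(1), of "a c"] yj by (simp add: mult.commute)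
      then have "a i j = a k j" using ea[OF i] ea[OF k] k' by simp
      then show False using gen i j k k' unfolding degenerate_def by blast
    qed
  qed
  then have xi: "x k = pure i k" if "k < m" for k using one[OF x i(1) _ that] by blast
  have "y k = 0 \<or> k = j" if k: "k < n" for k
  proof (rule ccontr)
    assume k': "\<not> ?thesis"
    \<comment> \<open>\<open>x\<close> is already known to be pure, so no case distinction is
      required for \<open>y\<close>.\<close>
    have "(\<Sum>l<m. x l * b l c) = b i c" for c
      using sum_pure[OF i(1), of "\<lambda>l. b l c"] xi by simp
    then have "b i j = b i k" using eb[OF j] eb[OF k] k' by simp
    then show False using gen i j k k' unfolding degenerate_def by blast
  qed
  then have "y k = pure j k" if "k < n" for k using one[OF y j(1) _ that] by blast
  then show ?thesis using that i j xi by blast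
qed

section \<open>The algorithm on lists\<close>

definition bil :: "real list list \<Rightarrow> real list \<Rightarrow> real list \<Rightarrow> real" where
  "bil A x y = dot x (map (\<lambda>r. dot r y) A)"

type_synonym strategy_pairs = "(real list \<times> real list) \<times> (real list \<times> real list)"

text \<open>The argument \<open>1 - dot d d'\<close> vanishes iff the unit vectors \<open>d\<close> and \<open>d'\<close> coincide, in which
  case the determinant condition of \<^const>\<open>block_dominated\<close> is void.\<close>

fun dominated_by :: "real list list \<Rightarrow> real list list \<Rightarrow> real \<Rightarrow> real \<Rightarrow> strategy_pairs \<Rightarrow> bool" where
  "dominated_by A B v u ((e, e'), (d, d')) \<longleftrightarrow>
     block_test [bil A e d - v, bil A e' d - v] [bil B d' e - u, bil B d' e' - u]
       [bil A e d' - v, bil A e' d' - v] [bil B d e - u, bil B d e' - u] (1 - dot d d')"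

text \<open>One enumeration of quadruples drives the best-reply tests and the domination test alike;
  its first members already run through all actions.\<close>

definition defect ::
    "real list list \<Rightarrow> real list list \<Rightarrow> real list \<times> real list \<Rightarrow> real \<Rightarrow> real \<Rightarrow> strategy_pairs \<Rightarrow> bool" where
  "defect A B p v u q \<longleftrightarrow>
     v < bil A (fst (fst q)) (snd p) \<or> u < bil B (fst (snd q)) (fst p) \<or> dominated_by A B v u q"

definition refuted ::
    "real list list \<Rightarrow> real list list \<Rightarrow> strategy_pairs list \<Rightarrow> real list \<times> real list \<Rightarrow> bool" where
  "refuted A B qs p \<longleftrightarrow>
     (\<exists>q\<in>set qs. defect A B p (bil A (fst p) (snd p)) (bil B (snd p) (fst p)) q)"

definition search ::
    "real list list \<Rightarrow> real list list \<Rightarrow> strategy_pairs list \<Rightarrow> (real list \<times> real list) list \<Rightarrow>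
      (real list \<times> real list) option" where
  "search A B qs ps = foldr (\<lambda>p r. if refuted A B qs p then r else Some p) ps None"

text \<open>Equality of reals is tested by the vanishing of a square.\<close>

fun degenerate_at :: "real list list \<Rightarrow> real list list \<Rightarrow> strategy_pairs \<Rightarrow> bool" where
  "degenerate_at A B ((e, e'), (d, d')) \<longleftrightarrow>
     \<not> 0 < dot e e' + (bil A e d - bil A e' d) * (bil A e d - bil A e' d) \<or>
     \<not> 0 < dot d d' + (bil B d e - bil B d' e) * (bil B d e - bil B d' e) \<or>
     \<not> 0 < dot e e' + dot d d' +
        ((bil A e' d - bil A e d) * (bil B d' e - bil B d e) -
         (bil A e d' - bil A e d) * (bil B d e' - bil B d e)) *
        ((bil A e' d - bil A e d) * (bil B d' e - bil B d e) -
         (bil A e d' - bil A e d) * (bil B d e' - bil B d e))"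

definition strategy_pairs :: "nat \<Rightarrow> nat \<Rightarrow> strategy_pairs list" where
  "strategy_pairs m n = List.product (List.product (units m) (units m)) (List.product (units n) (units n))"

text \<open>The degeneracy test guards the vertex lists: a generic game without a pure solution is
  answered before any arrangement is built.\<close>

definition solve :: "real list list \<Rightarrow> real list list \<Rightarrow> (real list \<times> real list) option" where
  "solve A B =
     (let m = length A; n = length B; qs = strategy_pairs m n;
          r = search A B qs (List.product (units m) (units n))
      in if r \<noteq> None then r
         else if \<exists>q\<in>set qs. degenerate_at A B q
           then search A B qs (List.product (vertices B m) (vertices A n))
         else None)"

locale list_game =
  fixes A B :: "real list list" and m n :: nat
  assumes A: "length A = m" "\<And>r. r \<in> set A \<Longrightarrow> length r = n"
    and B: "length B = n" "\<And>r. r \<in> set B \<Longrightarrow> length r = m"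
begin

definition a :: "nat \<Rightarrow> nat \<Rightarrow> real" where "a i j = A ! i ! j"
definition b :: "nat \<Rightarrow> nat \<Rightarrow> real" where "b i j = B ! j ! i"

lemma bil_A:
  assumes "length x = m" "length y = n"
  shows "bil A x y = payoff m n a ((!) x) ((!) y)"
  using assms A by (simp add: bil_def dot_eq_sum payoff_rows a_def)

lemma bil_B:
  assumes "length x = m" "length y = n"
  shows "bil B y x = payoff m n b ((!) x) ((!) y)"
  using assms B by (simp add: bil_def dot_eq_sum payoff_columns b_def mult.commute)

lemma payoff_unit_left: "i < m \<Longrightarrow> payoff m n c ((!) (unit m i)) y = (\<Sum>j<n. c i j * y j)"
  using payoff_cong[of m "(!) (unit m i)" "pure i" n y y c c]
  by (simp add: payoff_rows[of m n c "pure i"] sum_pure)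

lemma payoff_unit_right: "j < n \<Longrightarrow> payoff m n c x ((!) (unit n j)) = (\<Sum>i<m. x i * c i j)"
  using payoff_cong[of m x x n "(!) (unit n j)" "pure j" c c]
  by (simp add: payoff_columns[of m n c _ "pure j"] sum_pure)

lemma bil_units:
  assumes "i < m" "j < n"
  shows "bil A (unit m i) (unit n j) = a i j" "bil B (unit n j) (unit m i) = b i j"
proof -
  have "(\<Sum>l<n. c i l * unit n j ! l) = c i j" for c :: "nat \<Rightarrow> nat \<Rightarrow> real"
    using sum_pure[OF assms(2), of "c i"] by (simp add: mult.commute)
  then show "bil A (unit m i) (unit n j) = a i j" "bil B (unit n j) (unit m i) = b i j"
    using assms by (simp_all add: bil_A bil_B payoff_unit_left)
qed

lemma dot_unit: "k < l \<Longrightarrow> dot (unit l k) (unit l k') = (if k = k' then 1 else 0)"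
  using sum_pure[of k l "pure k'"] by (simp add: dot_eq_sum) (simp add: pure_def)

lemma set_strategy_pairs:
  "q \<in> set (strategy_pairs m n) \<longleftrightarrow> (\<exists>i<m. \<exists>i'<m. \<exists>j<n. \<exists>j'<n.
     q = ((unit m i, unit m i'), (unit n j, unit n j')))"
  by (auto simp: strategy_pairs_def set_units image_iff)

text \<open>For \<open>j = j'\<close> the factor passed to \<open>block_test\<close> is 0, and what
  remains of the determinant inequality is the positivity of a product of two positive
  numbers.\<close>

lemma dominated_by_iff:
  assumes "i < m" "i' < m" "j < n" "j' < n"
  shows "dominated_by A B v u ((unit m i, unit m i'), (unit n j, unit n j')) \<longleftrightarrow>
    block_dominated (\<lambda>i j. a i j - v) (\<lambda>i j. b i j - u) i i' j j'"
proof (cases "j = j'")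
  case True
  then show ?thesis
    using assms unfolding dominated_by.simps block_test_iff block_dominated_def
    by (simp add: bil_units dot_unit) (metis mult_pos_pos)
next
  case False
  then show ?thesis
    using assms unfolding dominated_by.simps block_test_iff block_dominated_def
    by (simp add: bil_units dot_unit)
qed

text \<open>Scalar products of unit vectors are 0 or 1. Added to a square they make the sum positive
  for coinciding actions, which switches off the corresponding clause.\<close>

lemma degenerate_iff: "(\<exists>q\<in>set (strategy_pairs m n). degenerate_at A B q) \<longleftrightarrow> degenerate m n a b"
proof -
  have at: "degenerate_at A B ((unit m i, unit m i'), (unit n j, unit n j')) \<longleftrightarrow>
     i \<noteq> i' \<and> a i j = a i' j \<or> j \<noteq> j' \<and> b i j = b i j' \<or>
     i \<noteq> i' \<and> j \<noteq> j' \<and> (a i' j - a i j) * (b i j' - b i j) = (a i j' - a i j) * (b i' j - b i j)"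
    if "i < m" "i' < m" "j < n" "j' < n" for i i' j j'
  proof -
    have pos: "0 < s + x * x \<longleftrightarrow> s \<noteq> 0 \<or> x \<noteq> 0" if "s = 0 \<or> s = 1 \<or> s = 2" for s x :: real
      using that zero_le_square[of x] by (auto simp: add_pos_nonneg not_less zero_less_mult_iff)
    show ?thesis using that unfolding degenerate_at.simps by (simp add: bil_units dot_unit pos)
  qed
  have "(\<exists>q\<in>set (strategy_pairs m n). degenerate_at A B q) \<longleftrightarrow> (\<exists>i<m. \<exists>i'<m. \<exists>j<n. \<exists>j'<n.
      degenerate_at A B ((unit m i, unit m i'), (unit n j, unit n j')))"
    unfolding Bex_def set_strategy_pairs by blast
  also have "\<dots> \<longleftrightarrow> degenerate m n a b"
    unfolding degenerate_def by (intro ex_cong1 conj_cong refl at)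
  finally show ?thesis .
qed

lemma refuted_iff:
  assumes x: "in_simplex m x" and y: "in_simplex n y"
  shows "refuted A B (strategy_pairs m n) (x, y) \<longleftrightarrow> \<not> strong_nash m n a b ((!) x) ((!) y)"
proof -
  have x': "length x = m" "mixed m ((!) x)" and y': "length y = n" "mixed n ((!) y)"
    using x y by (simp_all add: in_simplex_mixed)
  \<comment> \<open>Both action sets are nonempty, so the common quadruple quantifier can be
    distributed over the three tests.\<close>
  obtain i0 where i0: "i0 < m" using mixed_support[OF x'(2)] by blast
  obtain j0 where j0: "j0 < n" using mixed_support[OF y'(2)] by blast
  let ?v = "payoff m n a ((!) x) ((!) y)" and ?u = "payoff m n b ((!) x) ((!) y)"
  have vu: "bil A x y = ?v" "bil B y x = ?u" using x' y' by (simp_all add: bil_A bil_B)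
  have rows: "bil A (unit m i) y = (\<Sum>j<n. a i j * y ! j)" if "i < m" for i
    using that y' by (simp add: bil_A payoff_unit_left)
  have cols: "bil B (unit n j) x = (\<Sum>i<m. x ! i * b i j)" if "j < n" for j
    using that x' by (simp add: bil_B payoff_unit_right)
  have "refuted A B (strategy_pairs m n) (x, y) \<longleftrightarrow> (\<exists>i<m. \<exists>i'<m. \<exists>j<n. \<exists>j'<n.
      defect A B (x, y) ?v ?u ((unit m i, unit m i'), (unit n j, unit n j')))"
    unfolding refuted_def Bex_def set_strategy_pairs fst_conv snd_conv vu by blast
  also have "\<dots> \<longleftrightarrow> (\<exists>i<m. \<exists>i'<m. \<exists>j<n. \<exists>j'<n. ?v < (\<Sum>j<n. a i j * y ! j) \<or>
      ?u < (\<Sum>i<m. x ! i * b i j) \<or>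
      block_dominated (\<lambda>i j. a i j - ?v) (\<lambda>i j. b i j - ?u) i i' j j')"
    unfolding defect_def fst_conv snd_conv
    by (intro ex_cong1 conj_cong refl arg_cong2[where f = "(\<or>)"])
      (simp_all only: rows cols dominated_by_iff)
  also have "\<dots> \<longleftrightarrow> (\<exists>i<m. ?v < (\<Sum>j<n. a i j * y ! j)) \<or> (\<exists>j<n. ?u < (\<Sum>i<m. x ! i * b i j)) \<or>
      (\<exists>i<m. \<exists>i'<m. \<exists>j<n. \<exists>j'<n. block_dominated (\<lambda>i j. a i j - ?v) (\<lambda>i j. b i j - ?u) i i' j j')"
    using i0 j0 by blast
  also have "\<dots> \<longleftrightarrow> \<not> strong_nash m n a b ((!) x) ((!) y)"
    unfolding strong_nash_iff[of m n a b "(!) x"] using x'(2) y'(2) by (auto simp: not_le)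
  finally show ?thesis .
qed

lemma search_Some: "search A B qs ps = Some p \<Longrightarrow> p \<in> set ps \<and> \<not> refuted A B qs p"
  by (induction ps) (auto simp: search_def split: if_splits)

lemma search_None: "search A B qs ps = None \<Longrightarrow> p \<in> set ps \<Longrightarrow> refuted A B qs p"
  by (induction ps) (auto simp: search_def split: if_splits)

lemma vertices_simplex:
  assumes "g \<in> set (vertices C k)" "\<And>r. r \<in> set C \<Longrightarrow> length r = k"
  shows "in_simplex k g"
proof -
  have "\<forall>g\<in>set (foldr split_by cs (units k)). in_simplex k g" for cs
    by (induction cs) (simp_all add: in_simplex_split_by set_units in_simplex_unit del: set_split_by)
  then show ?thesis using assms by (simp add: vertices_def)
qed

lemma solve_eq:
  "solve A B =
     (let r = search A B (strategy_pairs m n) (List.product (units m) (units n))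
      in if r \<noteq> None then r
         else if degenerate m n a b
           then search A B (strategy_pairs m n) (List.product (vertices B m) (vertices A n))
         else None)"
  by (simp only: solve_def Let_def A(1) B(1) degenerate_iff)

lemma solve_Some:
  assumes "solve A B = Some (x, y)"
  shows "in_simplex m x \<and> in_simplex n y \<and> strong_nash m n a b ((!) x) ((!) y)"
proof -
  obtain ps where ps: "search A B (strategy_pairs m n) ps = Some (x, y)"
    and "ps = List.product (units m) (units n) \<or> ps = List.product (vertices B m) (vertices A n)"
    using assms unfolding solve_eq Let_def by (metis option.distinct(1))
  then have "in_simplex m x \<and> in_simplex n y"
    using search_Some[OF ps] vertices_simplex[of _ B m] vertices_simplex[of _ A n] A B
    by (auto simp: set_units in_simplex_unit)
  then show ?thesis using search_Some[OF ps] refuted_iff by blast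
qed

lemma solve_None:
  assumes "solve A B = None"
  shows "\<not> strong_nash m n a b x y"
proof
  assume sn: "strong_nash m n a b x y"
  let ?qs = "strategy_pairs m n"
  have none: "search A B ?qs (List.product (units m) (units n)) = None"
    using assms unfolding solve_eq Let_def by metis
  show False
  proof (cases "degenerate m n a b")
    case True
    then have none': "search A B ?qs (List.product (vertices B m) (vertices A n)) = None"
      using assms none unfolding solve_eq by simp
    have "strong_nash m n (\<lambda>i j. A ! i ! j) (\<lambda>i j. B ! j ! i) x y"
      using sn by (simp add: a_def[abs_def] b_def[abs_def])
    then obtain g h where "g \<in> set (vertices B m)" "h \<in> set (vertices A n)" "in_simplex m g" "in_simplex n h"
      "strong_nash m n a b ((!) g) ((!) h)"
      using strong_nash_at_vertices[of A m n B x y] A B unfolding a_def[abs_def] b_def[abs_def] by blast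
    then show False using search_None[OF none', of "(g, h)"] refuted_iff by auto
  next
    case False
    obtain i j where ij: "i < m" "j < n" and "\<And>k. k < m \<Longrightarrow> x k = pure i k" "\<And>k. k < n \<Longrightarrow> y k = pure j k"
      using generic_strong_nash_pure[OF sn False] by blast
    then have "strong_nash m n a b ((!) (unit m i)) ((!) (unit n j))"
      using sn by (subst strong_nash_cong[where x' = x and y' = y and a' = a and b' = b]) auto
    then show False
      using search_None[OF none, of "(unit m i, unit n j)"] refuted_iff ij
      by (auto simp: set_units in_simplex_unit)
  qed
qed

end

section \<open>Programs\<close>

definition halts :: "program \<Rightarrow> nat \<Rightarrow> val \<Rightarrow> bool" where
  "halts P f a \<longleftrightarrow> f < length P \<and> (\<exists>v n. eval P [a] (P ! f) v n)"

definition result :: "program \<Rightarrow> nat \<Rightarrow> val \<Rightarrow> val" where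
  "result P f a = (THE v. \<exists>n. eval P [a] (P ! f) v n)"

definition steps :: "program \<Rightarrow> nat \<Rightarrow> val \<Rightarrow> nat" where
  "steps P f a = (THE n. \<exists>v. eval P [a] (P ! f) v n)"

lemma eval_result: "halts P f a \<Longrightarrow> eval P [a] (P ! f) (result P f a) (steps P f a)"
proof -
  assume "halts P f a"
  then obtain v n where e: "eval P [a] (P ! f) v n" by (auto simp: halts_def)
  have "result P f a = v" unfolding result_def
    by (rule the_equality) (use e in \<open>auto dest: eval_deterministic[OF e]\<close>)
  moreover have "steps P f a = n" unfolding steps_def
    by (rule the_equality) (use e in \<open>auto dest: eval_deterministic[OF e]\<close>)
  ultimately show ?thesis using e by simp
qed

text \<open>Calls are left as \<open>result\<close> and \<open>steps\<close>, so a function body is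
  evaluated by rewriting with the specifications of its callees, and recursion is never
  unfolded.\<close>

primrec den :: "program \<Rightarrow> val list \<Rightarrow> trm \<Rightarrow> val" where
  "den P env (Var i) = env ! i"
| "den P env Empty = Null"
| "den P env (Const k) = Num (of_int k)"
| "den P env (Op1 f t) = app1 f (den P env t)"
| "den P env (Op2 f t u) = app2 f (den P env t) (den P env u)"
| "den P env (Cond s t u) = (if den P env s \<noteq> Null then den P env t else den P env u)"
| "den P env (LetIn t u) = den P (den P env t # env) u"
| "den P env (Call f t) = result P f (den P env t)"

primrec cost :: "program \<Rightarrow> val list \<Rightarrow> trm \<Rightarrow> nat" where
  "cost P env (Var i) = 1"
| "cost P env Empty = 1"
| "cost P env (Const k) = 1"
| "cost P env (Op1 f t) = cost P env t + 1"
| "cost P env (Op2 f t u) = cost P env t + cost P env u + 1"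
| "cost P env (Cond s t u) =
     cost P env s + (if den P env s \<noteq> Null then cost P env t else cost P env u) + 1"
| "cost P env (LetIn t u) = cost P env t + cost P (den P env t # env) u + 1"
| "cost P env (Call f t) = cost P env t + steps P f (den P env t) + 1"

text \<open>Only the branch taken must be safe, since a recursive call in the other branch may fail
  to halt.\<close>

primrec safe :: "program \<Rightarrow> val list \<Rightarrow> trm \<Rightarrow> bool" where
  "safe P env (Var i) \<longleftrightarrow> i < length env"
| "safe P env Empty \<longleftrightarrow> True"
| "safe P env (Const k) \<longleftrightarrow> True"
| "safe P env (Op1 f t) \<longleftrightarrow> safe P env t"
| "safe P env (Op2 f t u) \<longleftrightarrow> safe P env t \<and> safe P env u"
| "safe P env (Cond s t u) \<longleftrightarrow>
     safe P env s \<and> (if den P env s \<noteq> Null then safe P env t else safe P env u)"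
| "safe P env (LetIn t u) \<longleftrightarrow> safe P env t \<and> safe P (den P env t # env) u"
| "safe P env (Call f t) \<longleftrightarrow> safe P env t \<and> halts P f (den P env t)"

lemma eval_den: "safe P env t \<Longrightarrow> eval P env t (den P env t) (cost P env t)"
proof (induction t arbitrary: env)
  case (Var i)
  then show ?case by (simp add: eval.Var[simplified])
next
  case Empty
  show ?case by (simp add: eval.Empty[simplified])
next
  case (Const k)
  show ?case by (simp add: eval.Const[simplified])
next
  case (Op1 f t)
  show ?case unfolding den.simps cost.simps
    by (rule eval.Op1, rule Op1.IH) (use Op1.prems in simp)
next
  case (Op2 f t u)
  show ?case unfolding den.simps cost.simps
    by (rule eval.Op2, rule Op2.IH(1), use Op2.prems in simp, rule Op2.IH(2)) (use Op2.prems in simp)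
next
  case (Cond s t u)
  have s: "eval P env s (den P env s) (cost P env s)" using Cond by simp
  show ?case
  proof (cases "den P env s = Null")
    case True
    have "eval P env (Cond s t u) (den P env u) (cost P env s + cost P env u + 1)"
      by (rule eval.Cond_False) (use True s Cond in simp_all)
    with True show ?thesis by simp
  next
    case False
    have "eval P env (Cond s t u) (den P env t) (cost P env s + cost P env t + 1)"
      by (rule eval.Cond_True[OF s]) (use False Cond in simp_all)
    with False show ?thesis by simp
  qed
next
  case (LetIn t u)
  show ?case unfolding den.simps cost.simps
    by (rule eval.LetIn, rule LetIn.IH(1), use LetIn.prems in simp, rule LetIn.IH(2))
      (use LetIn.prems in simp)
next
  case (Call f t)
  then have s: "safe P env t" and h: "halts P f (den P env t)" by auto
  have f: "f < length P" using h by (simp add: halts_def)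
  show ?case unfolding den.simps cost.simps
    by (rule eval.Call[OF Call.IH[OF s] f eval_result[OF h]])
qed

definition computes :: "program \<Rightarrow> nat \<Rightarrow> val \<Rightarrow> val \<Rightarrow> nat \<Rightarrow> bool" where
  "computes P f a r N \<longleftrightarrow> halts P f a \<and> result P f a = r \<and> steps P f a \<le> N"

lemma computesD:
  assumes "computes P f a r N"
  shows "halts P f a" "result P f a = r" "steps P f a \<le> N"
  using assms by (auto simp: computes_def)

lemma computes_mono: "computes P f a r N \<Longrightarrow> N \<le> N' \<Longrightarrow> computes P f a r N'"
  by (auto simp: computes_def)

lemma computesI:
  assumes "f < length P" "safe P [a] (P ! f)" "den P [a] (P ! f) = r" "cost P [a] (P ! f) \<le> N"
  shows "computes P f a r N"
proof -
  have e: "eval P [a] (P ! f) r (cost P [a] (P ! f))" using eval_den[OF assms(2)] assms by simp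
  then have h: "halts P f a" using assms by (auto simp: halts_def)
  have "result P f a = r \<and> steps P f a = cost P [a] (P ! f)"
    using eval_deterministic[OF e eval_result[OF h]] .
  with h assms show ?thesis by (simp add: computes_def)
qed

text \<open>The body of the function at position \<open>k\<close> that maps \<open>Cell c xs\<close> to the right fold of \<open>step\<close>
  over the list \<open>xs\<close>; \<open>step\<close> sees the accumulator, the current element and the argument.\<close>

definition fold_body :: "nat \<Rightarrow> trm \<Rightarrow> trm \<Rightarrow> trm" where
  "fold_body k step base =
     Cond (Op1 Snd (Var 0))
       (LetIn (Op1 Fst (Op1 Snd (Var 0)))
         (LetIn (Call k (Op2 Mk_Cell (Op1 Fst (Var 1)) (Op1 Snd (Op1 Snd (Var 1))))) step))
       base"

text \<open>\<open>step\<close> is examined only at actual splittings of \<open>xs\<close>, which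
  gives access to properties of its elements. The 18 covers the 15 steps that
  \<open>fold_body\<close> spends around \<open>step\<close> and the recursive call; the 3 are the
  final test.\<close>

lemma computes_fold:
  fixes e :: "'a \<Rightarrow> val" and d :: "'b \<Rightarrow> val"
  assumes "k < length P" "P ! k = fold_body k step base"
    and base: "safe P [Cell c Null] base" "den P [Cell c Null] base = d b"
      "cost P [Cell c Null] base \<le> N"
    and step: "\<And>ys x zs t. xs = ys @ x # zs \<Longrightarrow> t = list_val (map e (x # zs)) \<Longrightarrow>
        safe P [d (foldr F zs b), e x, Cell c t] step \<and>
        den P [d (foldr F zs b), e x, Cell c t] step = d (F x (foldr F zs b)) \<and>
        cost P [d (foldr F zs b), e x, Cell c t] step \<le> K"
  shows "computes P k (Cell c (list_val (map e xs))) (d (foldr F xs b)) (length xs * (K + 18) + N + 3)"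
  using step
proof (induction xs)
  case Nil
  show ?case by (rule computesI[OF assms(1)]) (use base in \<open>simp_all add: assms(2) fold_body_def\<close>)
next
  case (Cons x xs)
  let ?r = "d (foldr F xs b)"
  have IH: "computes P k (Cell c (list_val (map e xs))) ?r (length xs * (K + 18) + N + 3)"
    by (rule Cons.IH) (use Cons.prems[of "x # _"] in simp)
  let ?env = "[?r, e x, Cell c (Cell (e x) (list_val (map e xs)))]"
  have s: "safe P ?env step" "den P ?env step = d (F x (foldr F xs b))" "cost P ?env step \<le> K"
    using Cons.prems[of "[]" x xs] by simp_all
  note IH = computesD[OF IH]
  show ?case
    by (rule computesI[OF assms(1)]) (simp_all add: assms(2) fold_body_def IH s, use s IH in linarith)
qed

text \<open>For folds without an explicit bound: the sum of the actual step costs bounds every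
  single one.\<close>

lemma terminates_fold:
  fixes e :: "'a \<Rightarrow> val" and d :: "'b \<Rightarrow> val"
  assumes "k < length P" "P ! k = fold_body k step base"
    and base: "safe P [Cell c Null] base" "den P [Cell c Null] base = d b"
    and step: "\<And>ys x zs t. xs = ys @ x # zs \<Longrightarrow> t = list_val (map e (x # zs)) \<Longrightarrow>
        safe P [d (foldr F zs b), e x, Cell c t] step \<and>
        den P [d (foldr F zs b), e x, Cell c t] step = d (F x (foldr F zs b))"
  shows "\<exists>N. computes P k (Cell c (list_val (map e xs))) (d (foldr F xs b)) N"
proof -
  define g where "g i = cost P [d (foldr F (drop (Suc i) xs) b), e (xs ! i),
      Cell c (list_val (map e (xs ! i # drop (Suc i) xs)))] step" for i
  have "computes P k (Cell c (list_val (map e xs))) (d (foldr F xs b))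
      (length xs * ((\<Sum>i<length xs. g i) + 18) + cost P [Cell c Null] base + 3)"
  proof (rule computes_fold[where d = d, OF assms(1,2) base order_refl])
    fix ys x zs t
    assume a: "xs = ys @ x # zs" "t = list_val (map e (x # zs))"
    have "cost P [d (foldr F zs b), e x, Cell c t] step = g (length ys)" using a by (simp add: g_def)
    also have "\<dots> \<le> (\<Sum>i<length xs. g i)" using a by (intro member_le_sum) auto
    finally show "safe P [d (foldr F zs b), e x, Cell c t] step \<and>
        den P [d (foldr F zs b), e x, Cell c t] step = d (F x (foldr F zs b)) \<and>
        cost P [d (foldr F zs b), e x, Cell c t] step \<le> (\<Sum>i<length xs. g i)"
      using step[OF a] by simp
  qed
  then show ?thesis ..
qed

section \<open>The program\<close>

abbreviation cell :: "trm \<Rightarrow> trm \<Rightarrow> trm" where "cell \<equiv> Op2 Mk_Cell"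
abbreviation hd_t :: "trm \<Rightarrow> trm" where "hd_t \<equiv> Op1 Fst"
abbreviation tl_t :: "trm \<Rightarrow> trm" where "tl_t \<equiv> Op1 Snd"
abbreviation less_t :: "trm \<Rightarrow> trm \<Rightarrow> trm" where "less_t \<equiv> Op2 Less"
abbreviation add_t :: "trm \<Rightarrow> trm \<Rightarrow> trm" where "add_t \<equiv> Op2 Add"
abbreviation sub_t :: "trm \<Rightarrow> trm \<Rightarrow> trm" where "sub_t \<equiv> Op2 Sub"
abbreviation mul_t :: "trm \<Rightarrow> trm \<Rightarrow> trm" where "mul_t \<equiv> Op2 Mul"
abbreviation true_t :: trm where "true_t \<equiv> Op2 Mk_Cell Empty Empty"
abbreviation ctx_t :: trm where "ctx_t \<equiv> Op1 Fst (Var 2)"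

text \<open>Two lists are consumed in parallel, so this recursion does not fit
  \<open>fold_body\<close>.\<close>

definition zip_body :: trm where
  "zip_body = Cond (hd_t (Var 0))
     (cell (cell (hd_t (hd_t (Var 0))) (hd_t (tl_t (Var 0))))
       (Call 1 (cell (tl_t (hd_t (Var 0))) (tl_t (tl_t (Var 0))))))
     Empty"

definition dot_step :: trm where
  "dot_step = add_t (mul_t (hd_t (Var 1)) (tl_t (Var 1))) (Var 0)"

definition dot_body :: trm where
  "dot_body = Call 2 (cell Empty (Call 1 (Var 0)))"

definition lin_comb_step :: trm where
  "lin_comb_step = cell (add_t (mul_t (hd_t ctx_t) (hd_t (Var 1))) (mul_t (tl_t ctx_t) (tl_t (Var 1)))) (Var 0)"

definition lin_comb_body :: trm where
  "lin_comb_body = Call 4 (cell (hd_t (Var 0)) (Call 1 (tl_t (Var 0))))"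

definition mat_vec_step :: trm where
  "mat_vec_step = cell (Call 3 (cell (Var 1) ctx_t)) (Var 0)"

definition bil_body :: trm where
  "bil_body = Call 3 (cell (hd_t (tl_t (Var 0))) (Call 6 (cell (tl_t (tl_t (Var 0))) (hd_t (Var 0)))))"

definition pair_step :: trm where
  "pair_step = cell (cell ctx_t (Var 1)) (Var 0)"

definition append_step :: trm where
  "append_step = cell (Var 1) (Var 0)"

text \<open>The fold runs over the first factor with the second as context; calls of position 10
  therefore pass the second factor first.\<close>

definition product_step :: trm where
  "product_step = Call 9 (cell (Var 0) (Call 8 (cell (Var 1) ctx_t)))"

definition zeros_step :: trm where
  "zeros_step = cell (Const 0) (Var 0)"

text \<open>Raises the dimension by one: the new unit vector gets as many zeros as there were unit
  vectors, and every old one is prefixed by a zero.\<close>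

definition units_step :: trm where
  "units_step = cell (cell (Const 1) (Call 11 (cell Empty (Var 0)))) (Call 8 (cell (Const 0) (Var 0)))"

text \<open>The context is \<open>(c, gs)\<close>; \<open>gs\<close> travels along because it is
  also the base value of the fold.\<close>

definition split_step :: trm where
  "split_step =
     LetIn (Call 3 (cell (hd_t ctx_t) (hd_t (Var 1))))
       (LetIn (Call 3 (cell (hd_t (hd_t (Var 3))) (tl_t (Var 2))))
         (Cond (less_t (Var 0) (Const 0))
           (Cond (less_t (Const 0) (Var 1))
             (LetIn (sub_t (Var 1) (Var 0))
               (cell
                 (Call 5 (cell (cell (Op2 Div (sub_t (Const 0) (Var 1)) (Var 0)) (Op2 Div (Var 2) (Var 0)))
                   (Var 4)))
                 (Var 3)))
             (Var 2))
           (Var 2)))"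

definition split_body :: trm where
  "split_body = Call 13 (cell (Var 0) (Call 10 (cell (tl_t (Var 0)) (tl_t (Var 0)))))"

definition arrange_step :: trm where
  "arrange_step = Call 14 (cell (Call 5 (cell (cell (Const 1) (Const (-1))) (Var 1))) (Var 0))"

definition pair_exists_step :: trm where
  "pair_exists_step = Cond (Call 18 (cell ctx_t (Var 1))) true_t (Var 0)"

text \<open>The argument is \<open>(((a, b), ((a', b'), k)), (u, v))\<close>.\<close>

definition form_body :: trm where
  "form_body = (let w = hd_t (Var 0); u = hd_t (tl_t (Var 0)); v = tl_t (tl_t (Var 0)) in
     sub_t (mul_t (Call 3 (cell (hd_t (hd_t w)) u)) (Call 3 (cell (tl_t (hd_t w)) v)))
       (mul_t (tl_t (tl_t w))
         (mul_t (Call 3 (cell (hd_t (hd_t (tl_t w))) u)) (Call 3 (cell (tl_t (hd_t (tl_t w))) v)))))"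

text \<open>At the tests, \<open>Var 6\<close> to \<open>Var 3\<close> hold \<open>dot a u\<close>,
  \<open>dot a v\<close>, \<open>dot b u\<close>, \<open>dot b v\<close>; \<open>Var 2\<close> and
  \<open>Var 1\<close> hold the form at \<open>(u, u)\<close> and \<open>(v, v)\<close>, and
  \<open>Var 0\<close> the sum of its two mixed values.\<close>

definition pair_test_body :: trm where
  "pair_test_body =
     LetIn (Call 3 (cell (hd_t (hd_t (hd_t (Var 0)))) (hd_t (tl_t (Var 0)))))
     (LetIn (Call 3 (cell (hd_t (hd_t (hd_t (Var 1)))) (tl_t (tl_t (Var 1)))))
     (LetIn (Call 3 (cell (tl_t (hd_t (hd_t (Var 2)))) (hd_t (tl_t (Var 2)))))
     (LetIn (Call 3 (cell (tl_t (hd_t (hd_t (Var 3)))) (tl_t (tl_t (Var 3)))))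
     (LetIn (Call 17 (cell (hd_t (Var 4)) (cell (hd_t (tl_t (Var 4))) (hd_t (tl_t (Var 4))))))
     (LetIn (Call 17 (cell (hd_t (Var 5)) (cell (tl_t (tl_t (Var 5))) (tl_t (tl_t (Var 5))))))
     (LetIn (add_t (Call 17 (Var 6))
        (Call 17 (cell (hd_t (Var 6)) (cell (tl_t (tl_t (Var 6))) (hd_t (tl_t (Var 6)))))))
     (Cond (less_t (Var 6) (Const 0)) Empty
     (Cond (less_t (Var 5) (Const 0)) Empty
     (Cond (less_t (Var 4) (Const 0)) Empty
     (Cond (less_t (Var 3) (Const 0)) Empty
     (Cond (less_t (Const 0) (add_t (Var 6) (Var 5)))
     (Cond (less_t (Const 0) (add_t (Var 4) (Var 3)))
     (Cond (less_t (Const 0) (Var 2)) true_t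
     (Cond (less_t (Const 0) (Var 0))
       (less_t (mul_t (Const 4) (mul_t (Var 2) (Var 1))) (mul_t (Var 0) (Var 0)))
       Empty)) Empty) Empty)))))))))))"

definition block_test_body :: trm where
  "block_test_body =
     LetIn (Call 14 (cell (hd_t (hd_t (Var 0))) (Call 14 (cell (tl_t (hd_t (Var 0)))
        (cell (cell (Const 1) (cell (Const 0) Empty))
          (cell (cell (Const 0) (cell (Const 1) Empty)) Empty))))))
     (Call 16 (cell (Var 1) (Call 10 (cell (Var 0) (Var 0)))))"

text \<open>The argument is \<open>(v, (A, (x, y)))\<close>.\<close>

definition gap_body :: trm where
  "gap_body = sub_t (Call 7 (tl_t (Var 0))) (hd_t (Var 0))"

text \<open>The argument is \<open>((v, A), ((e, e'), d))\<close>.\<close>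

definition gaps_left_body :: trm where
  "gaps_left_body = (let v = hd_t (hd_t (Var 0)); A = tl_t (hd_t (Var 0));
       p = hd_t (tl_t (Var 0)); d = tl_t (tl_t (Var 0))
     in cell (Call 20 (cell v (cell A (cell (hd_t p) d))))
       (cell (Call 20 (cell v (cell A (cell (tl_t p) d)))) Empty))"

definition gaps_right_body :: trm where
  "gaps_right_body = (let v = hd_t (hd_t (Var 0)); A = tl_t (hd_t (Var 0));
       p = hd_t (tl_t (Var 0)); d = tl_t (tl_t (Var 0))
     in cell (Call 20 (cell v (cell A (cell d (hd_t p)))))
       (cell (Call 20 (cell v (cell A (cell d (tl_t p))))) Empty))"

text \<open>The argument is \<open>(((A, B), (v, u)), ((e, e'), (d, d')))\<close>.\<close>

definition dominated_body :: trm where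
  "dominated_body = (let A = hd_t (hd_t (hd_t (Var 0))); B = tl_t (hd_t (hd_t (Var 0)));
       v = hd_t (tl_t (hd_t (Var 0))); u = tl_t (tl_t (hd_t (Var 0)));
       e = hd_t (tl_t (Var 0)); d = hd_t (tl_t (tl_t (Var 0))); d' = tl_t (tl_t (tl_t (Var 0)))
     in Call 19
       (cell (cell (Call 21 (cell (cell v A) (cell e d))) (Call 22 (cell (cell u B) (cell e d'))))
         (cell (cell (Call 21 (cell (cell v A) (cell e d'))) (Call 22 (cell (cell u B) (cell e d))))
           (sub_t (Const 1) (Call 3 (tl_t (tl_t (Var 0))))))))"

text \<open>The context is \<open>(((A, B), (v, u)), (x, y))\<close>.\<close>

definition defect_step :: trm where
  "defect_step = (let A = hd_t (hd_t (hd_t ctx_t)); B = tl_t (hd_t (hd_t ctx_t));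
       v = hd_t (tl_t (hd_t ctx_t)); u = tl_t (tl_t (hd_t ctx_t)); x = hd_t (tl_t ctx_t); y = tl_t (tl_t ctx_t)
     in Cond (less_t v (Call 7 (cell A (cell (hd_t (hd_t (Var 1))) y)))) true_t
       (Cond (less_t u (Call 7 (cell B (cell (hd_t (tl_t (Var 1))) x)))) true_t
         (Cond (Call 23 (cell (hd_t ctx_t) (Var 1))) true_t (Var 0))))"

text \<open>The argument is \<open>(((A, B), qs), (x, y))\<close>.\<close>

definition refuted_body :: trm where
  "refuted_body = (let AB = hd_t (hd_t (Var 0)); x = hd_t (tl_t (Var 0)); y = tl_t (tl_t (Var 0))
     in Call 24 (cell
       (cell (cell AB (cell (Call 7 (cell (hd_t AB) (cell x y))) (Call 7 (cell (tl_t AB) (cell y x)))))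
         (tl_t (Var 0)))
       (tl_t (hd_t (Var 0)))))"

definition search_step :: trm where
  "search_step = Cond (Call 25 (cell ctx_t (Var 1))) (Var 0) (Var 1)"

definition degenerate_step :: trm where
  "degenerate_step = Cond (Call 28 (cell ctx_t (Var 1))) true_t (Var 0)"

text \<open>The argument is \<open>((A, B), ((e, e'), (d, d')))\<close>; the variables bound last to first are
  the three entries of \<open>B\<close> (at \<open>(e, d)\<close>, \<open>(e', d)\<close> and \<open>(e, d')\<close>), those of \<open>A\<close>, and the two
  scalar products.\<close>

definition degenerate_body :: trm where
  "degenerate_body =
     LetIn (Call 3 (tl_t (tl_t (Var 0))))
     (LetIn (Call 3 (hd_t (tl_t (Var 1))))
     (LetIn (Call 7 (cell (hd_t (hd_t (Var 2)))
        (cell (hd_t (hd_t (tl_t (Var 2)))) (tl_t (tl_t (tl_t (Var 2)))))))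
     (LetIn (Call 7 (cell (hd_t (hd_t (Var 3)))
        (cell (tl_t (hd_t (tl_t (Var 3)))) (hd_t (tl_t (tl_t (Var 3)))))))
     (LetIn (Call 7 (cell (hd_t (hd_t (Var 4)))
        (cell (hd_t (hd_t (tl_t (Var 4)))) (hd_t (tl_t (tl_t (Var 4)))))))
     (LetIn (Call 7 (cell (tl_t (hd_t (Var 5)))
        (cell (tl_t (tl_t (tl_t (Var 5)))) (hd_t (hd_t (tl_t (Var 5)))))))
     (LetIn (Call 7 (cell (tl_t (hd_t (Var 6)))
        (cell (hd_t (tl_t (tl_t (Var 6)))) (tl_t (hd_t (tl_t (Var 6)))))))
     (LetIn (Call 7 (cell (tl_t (hd_t (Var 7)))
        (cell (hd_t (tl_t (tl_t (Var 7)))) (hd_t (hd_t (tl_t (Var 7)))))))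
     (LetIn (sub_t (mul_t (sub_t (Var 4) (Var 3)) (sub_t (Var 2) (Var 0)))
        (mul_t (sub_t (Var 5) (Var 3)) (sub_t (Var 1) (Var 0))))
     (Cond (less_t (Const 0) (add_t (Var 7) (mul_t (sub_t (Var 4) (Var 5)) (sub_t (Var 4) (Var 5)))))
     (Cond (less_t (Const 0) (add_t (Var 8) (mul_t (sub_t (Var 1) (Var 3)) (sub_t (Var 1) (Var 3)))))
     (Cond (less_t (Const 0) (add_t (add_t (Var 7) (Var 8)) (mul_t (Var 0) (Var 0))))
       Empty true_t) true_t) true_t)))))))))"

text \<open>The numbers of actions are never computed: the unit vectors are built by folding over
  the rows of the two matrices. From last to first the variables hold the search result, the
  quadruples, the unit vectors of player 2, those of player 1, and the game.\<close>

definition main_body :: trm where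
  "main_body =
     LetIn (Call 12 (cell Empty (hd_t (Var 0))))
     (LetIn (Call 12 (cell Empty (tl_t (Var 1))))
     (LetIn (Call 10 (cell (Call 10 (cell (Var 0) (Var 0))) (Call 10 (cell (Var 1) (Var 1)))))
     (LetIn (Call 26 (cell (cell (Var 3) (Var 0)) (Call 10 (cell (Var 1) (Var 2)))))
     (Cond (Var 0) (Var 0)
     (Cond (Call 27 (cell (Var 4) (Var 1)))
       (Call 26 (cell (cell (Var 4) (Var 1))
         (Call 10 (cell
           (Call 15 (cell (Var 2) (Call 10 (cell (hd_t (Var 4)) (hd_t (Var 4))))))
           (Call 15 (cell (Var 3) (Call 10 (cell (tl_t (Var 4)) (tl_t (Var 4))))))))))
       Empty)))))"

definition prog :: program where
  "prog =
    [main_body,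
     zip_body,
     fold_body 2 dot_step (Const 0),
     dot_body,
     fold_body 4 lin_comb_step Empty,
     lin_comb_body,
     fold_body 6 mat_vec_step Empty,
     bil_body,
     fold_body 8 pair_step Empty,
     fold_body 9 append_step (hd_t (Var 0)),
     fold_body 10 product_step Empty,
     fold_body 11 zeros_step Empty,
     fold_body 12 units_step Empty,
     fold_body 13 split_step (tl_t (hd_t (Var 0))),
     split_body,
     fold_body 15 arrange_step (hd_t (Var 0)),
     fold_body 16 pair_exists_step Empty,
     form_body,
     pair_test_body,
     block_test_body,
     gap_body,
     gaps_left_body,
     gaps_right_body,
     dominated_body,
     fold_body 24 defect_step Empty,
     refuted_body,
     fold_body 26 search_step Empty,
     fold_body 27 degenerate_step Empty,
     degenerate_body]"

lemma length_prog [simp]: "length prog = 29"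
  by (simp add: prog_def)

lemma nth_prog:
  "prog ! 0 = main_body"
  "prog ! Suc 0 = zip_body"
  "prog ! 2 = fold_body 2 dot_step (Const 0)"
  "prog ! 3 = dot_body"
  "prog ! 4 = fold_body 4 lin_comb_step Empty"
  "prog ! 5 = lin_comb_body"
  "prog ! 6 = fold_body 6 mat_vec_step Empty"
  "prog ! 7 = bil_body"
  "prog ! 8 = fold_body 8 pair_step Empty"
  "prog ! 9 = fold_body 9 append_step (hd_t (Var 0))"
  "prog ! 10 = fold_body 10 product_step Empty"
  "prog ! 11 = fold_body 11 zeros_step Empty"
  "prog ! 12 = fold_body 12 units_step Empty"
  "prog ! 13 = fold_body 13 split_step (tl_t (hd_t (Var 0)))"
  "prog ! 14 = split_body"
  "prog ! 15 = fold_body 15 arrange_step (hd_t (Var 0))"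
  "prog ! 16 = fold_body 16 pair_exists_step Empty"
  "prog ! 17 = form_body"
  "prog ! 18 = pair_test_body"
  "prog ! 19 = block_test_body"
  "prog ! 20 = gap_body"
  "prog ! 21 = gaps_left_body"
  "prog ! 22 = gaps_right_body"
  "prog ! 23 = dominated_body"
  "prog ! 24 = fold_body 24 defect_step Empty"
  "prog ! 25 = refuted_body"
  "prog ! 26 = fold_body 26 search_step Empty"
  "prog ! 27 = fold_body 27 degenerate_step Empty"
  "prog ! 28 = degenerate_body"
  by (simp_all add: prog_def)

section \<open>Correctness and running time of the program\<close>

definition V :: "real list \<Rightarrow> val" where "V u = list_val (map Num u)"
definition Vs :: "real list list \<Rightarrow> val" where "Vs us = list_val (map V us)"
definition bool_val :: "bool \<Rightarrow> val" where "bool_val c = (if c then Cell Null Null else Null)"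

lemma bool_val_simps [simp]: "bool_val True = Cell Null Null" "bool_val False = Null"
  by (simp_all add: bool_val_def)

lemma V_simps: "V [] = Null" "V (x # u) = Cell (Num x) (V u)"
  by (simp_all add: V_def)

lemma Vs_simps: "Vs [] = Null" "Vs (u # us) = Cell (V u) (Vs us)"
  by (simp_all add: Vs_def)

section \<open>Vector arithmetic\<close>

lemma computes_zip:
  "length u = length v \<Longrightarrow> computes prog 1 (Cell (V u) (V v))
    (list_val (map (\<lambda>(x, y). Cell (Num x) (Num y)) (zip u v))) (length v * 40 + 40)"
proof (induction u v rule: list_induct2)
  case Nil
  show ?case by (rule computesI) (simp_all add: nth_prog zip_body_def V_simps)
next
  case (Cons x u y v)
  note IH = computesD[OF Cons.IH, unfolded One_nat_def]
  show ?case
    by (rule computesI) (use IH in \<open>simp_all add: nth_prog zip_body_def V_simps\<close>)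
qed

text \<open>Constants in this and later time bounds are generous round numbers; only polynomial
  growth matters.\<close>

definition dot_time :: "nat \<Rightarrow> nat" where "dot_time l = 200 * l + 200"

lemma computes_dot:
  assumes "length u = length v"
  shows "computes prog 3 (Cell (V u) (V v)) (Num (dot u v)) (dot_time (length v))"
proof -
  have "computes prog 2 (Cell Null (list_val (map (\<lambda>(x, y). Cell (Num x) (Num y)) (zip u v))))
      (Num (dot u v)) (length (zip u v) * (20 + 18) + 10 + 3)"
    unfolding dot_def
    by (rule computes_fold[where d = Num]) (auto simp: nth_prog dot_step_def)
  note c = computesD[OF this] computesD[OF computes_zip[OF assms], unfolded One_nat_def]
  show ?thesis
    by (rule computesI) (use c assms in \<open>simp_all add: nth_prog dot_body_def dot_time_def\<close>)
qed

lemma computes_lin_comb: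
  assumes "length u = length v"
  shows "computes prog 5 (Cell (Cell (Num p) (Num q)) (Cell (V u) (V v))) (V (lin_comb p u q v))
    (dot_time (length v))"
proof -
  have l: "lin_comb p u q v = foldr (\<lambda>(x, y) w. (p * x + q * y) # w) (zip u v) []"
    unfolding lin_comb_def by (induction u v rule: list_induct2') auto
  have "computes prog 4 (Cell (Cell (Num p) (Num q)) (list_val (map (\<lambda>(x, y). Cell (Num x) (Num y)) (zip u v))))
      (V (lin_comb p u q v)) (length (zip u v) * (40 + 18) + 10 + 3)"
    unfolding l
    by (rule computes_fold[where d = V]) (auto simp: nth_prog lin_comb_step_def V_simps)
  note c = computesD[OF this] computesD[OF computes_zip[OF assms], unfolded One_nat_def]
  show ?thesis
    by (rule computesI) (use c assms in \<open>simp_all add: nth_prog lin_comb_body_def dot_time_def\<close>)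
qed

definition bil_time :: "nat \<Rightarrow> nat" where
  "bil_time M = M * (dot_time M + 60) + dot_time M + 60"

lemma dot_time_mono: "l \<le> l' \<Longrightarrow> dot_time l \<le> dot_time l'"
  by (simp add: dot_time_def)

lemma computes_bil:
  assumes "length x = length A" "\<And>r. r \<in> set A \<Longrightarrow> length r = length y" "length x \<le> M" "length y \<le> M"
  shows "computes prog 7 (Cell (Vs A) (Cell (V x) (V y))) (Num (bil A x y)) (bil_time M)"
proof -
  have m: "map (\<lambda>r. dot r y) A = foldr (\<lambda>r z. dot r y # z) A []" by (induction A) auto
  have "computes prog 6 (Cell (V y) (list_val (map V A))) (V (map (\<lambda>r. dot r y) A))
      (length A * (dot_time (length y) + 20 + 18) + 10 + 3)"
    unfolding m
  proof (rule computes_fold[where d = V])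
    fix ys r zs t assume "A = ys @ r # zs"
    then have "length r = length y" using assms(2) by simp
    note c = computesD[OF computes_dot[OF this]]
    show "safe prog [V (foldr (\<lambda>r z. dot r y # z) zs []), V r, Cell (V y) t] mat_vec_step \<and>
        den prog [V (foldr (\<lambda>r z. dot r y # z) zs []), V r, Cell (V y) t] mat_vec_step =
          V (dot r y # foldr (\<lambda>r z. dot r y # z) zs []) \<and>
        cost prog [V (foldr (\<lambda>r z. dot r y # z) zs []), V r, Cell (V y) t] mat_vec_step
          \<le> dot_time (length y) + 20"
      using c by (simp add: mat_vec_step_def V_simps)
  qed (auto simp: nth_prog V_simps)
  note c1 = computesD[OF this[folded Vs_def]]
  have l: "length x = length (map (\<lambda>r. dot r y) A)" using assms by simp
  note c2 = computesD[OF computes_dot[OF l]]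
  have "length A * (dot_time (length y) + 20 + 18) \<le> M * (dot_time M + 60)"
    using assms dot_time_mono[of "length y" M] by (intro mult_mono) auto
  moreover have "dot_time (length A) \<le> dot_time M" using assms by (intro dot_time_mono) simp
  ultimately show ?thesis
    by (intro computesI) (use c1 c2 in \<open>simp_all add: nth_prog bil_body_def bil_def bil_time_def\<close>)
qed

section \<open>List constructions and splitting\<close>

definition list_time :: "nat \<Rightarrow> nat" where "list_time l = 60 * l + 60"

lemma computes_pairs:
  "computes prog 8 (Cell c (list_val xs)) (list_val (map (Cell c) xs)) (list_time (length xs))"
proof -
  have m: "map (Cell c) xs = foldr (\<lambda>x r. Cell c x # r) xs []" by (induction xs) auto
  have "computes prog 8 (Cell c (list_val (map (\<lambda>x. x) xs))) (list_val (foldr (\<lambda>x r. Cell c x # r) xs []))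
      (length xs * (20 + 18) + 10 + 3)"
    by (rule computes_fold[where d = list_val]) (auto simp: nth_prog pair_step_def)
  then show ?thesis unfolding m by (auto intro: computes_mono simp: list_time_def)
qed

lemma computes_append:
  "computes prog 9 (Cell (list_val ys) (list_val xs)) (list_val (xs @ ys)) (list_time (length xs))"
proof -
  have "computes prog 9 (Cell (list_val ys) (list_val (map (\<lambda>x. x) xs))) (list_val (foldr (#) xs ys))
      (length xs * (20 + 18) + 10 + 3)"
    by (rule computes_fold[where d = list_val]) (auto simp: nth_prog append_step_def)
  moreover have "foldr (#) xs ys = xs @ ys" by (induction xs) auto
  ultimately show ?thesis by (auto intro: computes_mono simp: list_time_def)
qed

definition product_time :: "nat \<Rightarrow> nat \<Rightarrow> nat" where
  "product_time k l = k * (2 * list_time l + 40) + 20"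

lemma computes_product:
  "computes prog 10 (Cell (list_val ys) (list_val xs))
    (list_val (map (\<lambda>(x, y). Cell x y) (List.product xs ys))) (product_time (length xs) (length ys))"
proof -
  have p: "map (\<lambda>(x, y). Cell x y) (List.product xs ys) = foldr (\<lambda>x r. map (Cell x) ys @ r) xs []"
    by (induction xs) simp_all
  have "computes prog 10 (Cell (list_val ys) (list_val (map (\<lambda>x. x) xs)))
      (list_val (foldr (\<lambda>x r. map (Cell x) ys @ r) xs []))
      (length xs * ((2 * list_time (length ys) + 20) + 18) + 10 + 3)"
  proof (rule computes_fold[where d = list_val])
    fix us x zs t
    let ?r = "foldr (\<lambda>x r. map (Cell x) ys @ r) zs []"
    note c = computesD[OF computes_pairs[of x ys]] computesD[OF computes_append[of ?r "map (Cell x) ys"]]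
    show "safe prog [list_val ?r, x, Cell (list_val ys) t] product_step \<and>
        den prog [list_val ?r, x, Cell (list_val ys) t] product_step = list_val (map (Cell x) ys @ ?r) \<and>
        cost prog [list_val ?r, x, Cell (list_val ys) t] product_step \<le> 2 * list_time (length ys) + 20"
      using c by (simp add: product_step_def)
  qed (auto simp: nth_prog)
  then show ?thesis unfolding p by (auto intro: computes_mono simp: product_time_def algebra_simps)
qed

lemma computes_product_map:
  "computes prog 10 (Cell (list_val (map g ys)) (list_val (map f xs)))
    (list_val (map (\<lambda>p. Cell (f (fst p)) (g (snd p))) (List.product xs ys)))
    (product_time (length xs) (length ys))"
proof -
  have "List.product (map f xs) (map g ys) = map (\<lambda>p. (f (fst p), g (snd p))) (List.product xs ys)"
    by (induction xs) (simp_all add: o_def)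
  then show ?thesis using computes_product[of "map g ys" "map f xs"] by (simp add: o_def)
qed

lemma units_Suc:
  "units (Suc n) = (1 # map (\<lambda>_. 0) (units n)) # map ((#) 0) (units n)"
proof -
  have "unit (Suc n) 0 = 1 # map (\<lambda>_. 0) (units n)"
    by (rule nth_equalityI) (auto simp: units_def unit_def pure_def nth_Cons split: nat.split simp del: upt_Suc)
  moreover have "unit (Suc n) (Suc k) = 0 # unit n k" for k
    by (rule nth_equalityI) (auto simp: unit_def pure_def nth_Cons split: nat.split simp del: upt_Suc)
  moreover have "[0..<Suc n] = 0 # map Suc [0..<n]" by (simp add: map_Suc_upt upt_conv_Cons del: upt_Suc)
  ultimately show ?thesis by (simp add: units_def o_def del: upt_Suc)
qed

lemma length_units [simp]: "length (units n) = n"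
  by (simp add: units_def)

definition units_time :: "nat \<Rightarrow> nat" where "units_time l = l * (2 * list_time l + 60) + 20"

lemma computes_units:
  "computes prog 12 (Cell Null (list_val xs)) (Vs (units (length xs))) (units_time (length xs))"
proof -
  let ?F = "\<lambda>_ us. (1 # map (\<lambda>_. 0) us) # map ((#) 0) us"
  have u: "foldr ?F xs [] = units (length xs)" for xs :: "val list"
    by (induction xs) (simp_all add: units_Suc, simp add: units_def)
  have zeros: "computes prog 11 (Cell Null (Vs us)) (V (map (\<lambda>_. 0) us)) (list_time (length us))" for us
  proof -
    have m: "map (\<lambda>_. 0) us = foldr (\<lambda>_ r. 0 # r) us []" by (induction us) auto
    have "computes prog 11 (Cell Null (list_val (map V us))) (V (foldr (\<lambda>_ r. 0 # r) us []))
        (length us * (20 + 18) + 10 + 3)"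
      by (rule computes_fold[where d = V]) (auto simp: nth_prog zeros_step_def V_simps)
    then show ?thesis unfolding m Vs_def by (auto intro: computes_mono simp: list_time_def)
  qed
  have "computes prog 12 (Cell Null (list_val (map (\<lambda>x. x) xs))) (Vs (foldr ?F xs []))
      (length xs * ((2 * list_time (length xs) + 30) + 18) + 10 + 3)"
  proof (rule computes_fold[where d = Vs])
    fix ys x zs t assume xs: "xs = ys @ x # zs"
    let ?r = "units (length zs)"
    note c = computesD[OF zeros[of ?r]] computesD[OF computes_pairs[of "Num 0" "map V ?r"], folded Vs_def]
    have l: "list_time (length zs) \<le> list_time (length xs)" using xs by (simp add: list_time_def)
    have "Vs (map ((#) 0) ?r) = list_val (map (Cell (Num 0)) (map V ?r))" by (simp add: Vs_def V_simps o_def)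
    then show "safe prog [Vs (foldr ?F zs []), x, Cell Null t] units_step \<and>
        den prog [Vs (foldr ?F zs []), x, Cell Null t] units_step = Vs (?F x (foldr ?F zs [])) \<and>
        cost prog [Vs (foldr ?F zs []), x, Cell Null t] units_step \<le> 2 * list_time (length xs) + 30"
      unfolding u using c l by (simp add: units_step_def V_simps Vs_simps)
  qed (auto simp: nth_prog Vs_simps)
  then show ?thesis unfolding u by (auto intro: computes_mono simp: units_time_def algebra_simps)
qed

definition split_time :: "nat \<Rightarrow> nat \<Rightarrow> nat" where
  "split_time l g = product_time g g + g * g * (3 * dot_time l + 120) + 60"

lemma computes_split:
  assumes c: "length c = l" and gs: "\<And>g. g \<in> set gs \<Longrightarrow> length g = l"
  shows "computes prog 14 (Cell (V c) (Vs gs)) (Vs (split_by c gs)) (split_time l (length gs))"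
proof -
  let ?e = "\<lambda>p. Cell (V (fst p)) (V (snd p))"
  have "computes prog 13 (Cell (Cell (V c) (Vs gs)) (list_val (map ?e (List.product gs gs))))
      (Vs (foldr (add_crossing c) (List.product gs gs) gs))
      (length (List.product gs gs) * ((3 * dot_time l + 100) + 18) + 10 + 3)"
  proof (rule computes_fold[where d = Vs])
    fix ys p zs t assume "List.product gs gs = ys @ p # zs"
    then have "p \<in> set (List.product gs gs)" by simp
    then obtain u v where p: "p = (u, v)" and uv: "length u = l" "length v = l" using gs by auto
    have d1: "length c = length u" and d2: "length c = length v" and d3: "length u = length v"
      using c uv by auto
    let ?a = "dot c u" and ?b = "dot c v" and ?r = "foldr (add_crossing c) zs gs"
    note c = computesD[OF computes_dot[OF d1]] computesD[OF computes_dot[OF d2]]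
      computesD[OF computes_lin_comb[OF d3, of "- ?b / (?a - ?b)" "?a / (?a - ?b)"]]
    show "safe prog [Vs ?r, ?e p, Cell (Cell (V c) (Vs gs)) t] split_step \<and>
        den prog [Vs ?r, ?e p, Cell (Cell (V c) (Vs gs)) t] split_step = Vs (add_crossing c p ?r) \<and>
        cost prog [Vs ?r, ?e p, Cell (Cell (V c) (Vs gs)) t] split_step \<le> 3 * dot_time l + 100"
      using c uv by (simp add: split_step_def p add_crossing_def crossing_def Vs_simps)
  qed (auto simp: nth_prog)
  note c1 = computesD[OF this]
  note c2 = computesD[OF computes_product_map[of V gs V gs, folded Vs_def]]
  show ?thesis
    by (rule computesI) (use c1 c2 in \<open>simp_all add: nth_prog split_body_def split_by_def split_time_def
      length_product algebra_simps\<close>)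
qed

text \<open>Applied to the two splittings of a block only; iterated over all
  \<open>differences\<close>, this bound would not be polynomial.\<close>

lemma length_split_by: "length (split_by c gs) \<le> length gs + length gs * length gs"
proof -
  have "length (foldr (add_crossing c) ps gs) \<le> length ps + length gs" for ps
    by (induction ps) (auto simp: add_crossing_def)
  from this[of "List.product gs gs"] show ?thesis by (simp add: split_by_def length_product)
qed

lemma split_time_mono: "g \<le> g' \<Longrightarrow> split_time l g \<le> split_time l g'"
  unfolding split_time_def product_time_def list_time_def by (intro add_mono mult_mono) auto

lemma product_time_mono: "k \<le> k' \<Longrightarrow> l \<le> l' \<Longrightarrow> product_time k l \<le> product_time k' l'"
  unfolding product_time_def list_time_def by (intro add_mono mult_mono) auto

section \<open>The block test in constant time\<close>

definition block_val :: "real list \<Rightarrow> real list \<Rightarrow> real list \<Rightarrow> real list \<Rightarrow> real \<Rightarrow> val" where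
  "block_val a b a' b' k = Cell (Cell (V a) (V b)) (Cell (Cell (V a') (V b')) (Num k))"

text \<open>Two splittings take the 2 unit vectors to at most \<open>2 + 2 * 2 = 6\<close> and then
  \<open>6 + 6 * 6 = 42\<close> points, which form \<open>42 * 42 = 1764\<close> pairs.\<close>

definition block_time :: nat where
  "block_time = split_time 2 2 + split_time 2 6 + product_time 42 42 + 1764 * (24 * dot_time 2 + 1000) + 200"

lemma computes_form:
  assumes "length a = 2" "length b = 2" "length a' = 2" "length b' = 2" "length u = 2" "length v = 2"
  shows "computes prog 17 (Cell (block_val a b a' b' k) (Cell (V u) (V v)))
    (Num (form a b a' b' k u v)) (4 * dot_time 2 + 60)"
proof -
  have l: "length a = length u" "length b = length v" "length a' = length u" "length b' = length v"
    using assms by auto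
  note c = l[THEN computes_dot, THEN computesD(1)] l[THEN computes_dot, THEN computesD(2)]
    l[THEN computes_dot, THEN computesD(3)]
  show ?thesis
    by (rule computesI) (use c assms in \<open>simp_all add: nth_prog form_body_def form_def block_val_def Let_def\<close>)
qed

lemma computes_pair_test:
  assumes "length a = 2" "length b = 2" "length a' = 2" "length b' = 2" "length u = 2" "length v = 2"
  shows "computes prog 18 (Cell (block_val a b a' b' k) (Cell (V u) (V v)))
    (bool_val (pair_test a b a' b' k u v)) (20 * dot_time 2 + 800)"
proof -
  let ?C = "Cell (Cell (V a) (V b)) (Cell (Cell (V a') (V b')) (Num k))"
  have l: "length a = length u" "length a = length v" "length b = length u" "length b = length v"
    using assms by auto
  note c = l[THEN computes_dot, THEN computesD(1)] l[THEN computes_dot, THEN computesD(2)]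
    l[THEN computes_dot, THEN computesD(3)]
  have f: "halts prog 17 (Cell ?C (Cell (V w) (V z)))"
    "result prog 17 (Cell ?C (Cell (V w) (V z))) = Num (form a b a' b' k w z)"
    "steps prog 17 (Cell ?C (Cell (V w) (V z))) \<le> 4 * dot_time 2 + 60"
    if "length w = 2" "length z = 2" for w z
    using computesD[OF computes_form[OF assms(1-4) that]] by (simp_all add: block_val_def)
  note f' = f[OF assms(5,5)] f[OF assms(5,6)] f[OF assms(6,5)] f[OF assms(6,6)]
  note c = c[unfolded assms]
  show ?thesis unfolding block_val_def
  proof (rule computesI)
    show "safe prog [Cell ?C (Cell (V u) (V v))] (prog ! 18)"
      by (simp add: nth_prog pair_test_body_def c f')
    show "den prog [Cell ?C (Cell (V u) (V v))] (prog ! 18) = bool_val (pair_test a b a' b' k u v)"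
      by (simp add: nth_prog pair_test_body_def c f' pair_test_def)
    have "cost prog [Cell ?C (Cell (V u) (V v))] (prog ! 18) \<le>
      steps prog 3 (Cell (V a) (V u)) + steps prog 3 (Cell (V a) (V v)) +
      steps prog 3 (Cell (V b) (V u)) + steps prog 3 (Cell (V b) (V v)) +
      steps prog 17 (Cell ?C (Cell (V u) (V u))) + steps prog 17 (Cell ?C (Cell (V v) (V v))) +
      steps prog 17 (Cell ?C (Cell (V u) (V v))) + steps prog 17 (Cell ?C (Cell (V v) (V u))) + 400"
      by (simp add: nth_prog pair_test_body_def c f')
    then show "cost prog [Cell ?C (Cell (V u) (V v))] (prog ! 18) \<le> 20 * dot_time 2 + 800"
      using c f' by linarith
  qed simp
qed

lemma foldr_exists: "foldr (\<lambda>x c. p x \<or> c) xs False \<longleftrightarrow> (\<exists>x\<in>set xs. p x)"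
  by (induction xs) auto

lemma computes_pair_exists:
  assumes "length a = 2" "length b = 2" "length a' = 2" "length b' = 2"
    "\<And>p. p \<in> set ps \<Longrightarrow> length (fst p) = 2 \<and> length (snd p) = 2"
  shows "computes prog 16 (Cell (block_val a b a' b' k) (list_val (map (\<lambda>p. Cell (V (fst p)) (V (snd p))) ps)))
    (bool_val (\<exists>p\<in>set ps. pair_test a b a' b' k (fst p) (snd p)))
    (length ps * (20 * dot_time 2 + 900) + 20)"
proof -
  let ?F = "\<lambda>p c. pair_test a b a' b' k (fst p) (snd p) \<or> c"
  let ?C = "block_val a b a' b' k"
  have "computes prog 16 (Cell ?C (list_val (map (\<lambda>p. Cell (V (fst p)) (V (snd p))) ps)))
    (bool_val (foldr ?F ps False)) (length ps * ((20 * dot_time 2 + 850) + 18) + 10 + 3)"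
  proof (rule computes_fold[where d = bool_val])
    fix ys p zs t assume "ps = ys @ p # zs"
    then have l: "length (fst p) = 2" "length (snd p) = 2" using assms(5)[of p] by simp_all
    note c = computesD[OF computes_pair_test[OF assms(1-4) l, of k]]
    show "safe prog [bool_val (foldr ?F zs False), Cell (V (fst p)) (V (snd p)), Cell ?C t] pair_exists_step \<and>
      den prog [bool_val (foldr ?F zs False), Cell (V (fst p)) (V (snd p)), Cell ?C t] pair_exists_step =
        bool_val (?F p (foldr ?F zs False)) \<and>
      cost prog [bool_val (foldr ?F zs False), Cell (V (fst p)) (V (snd p)), Cell ?C t] pair_exists_step
        \<le> 20 * dot_time 2 + 850"
      using c by (simp add: pair_exists_step_def bool_val_def)
  qed (auto simp: nth_prog)
  then show ?thesis unfolding foldr_exists by (auto intro: computes_mono simp: algebra_simps)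
qed

lemma computes_block_test:
  assumes "length a = 2" "length b = 2" "length a' = 2" "length b' = 2"
  shows "computes prog 19 (block_val a b a' b' k) (bool_val (block_test a b a' b' k)) block_time"
proof -
  let ?g = "[[1, 0], [0, 1]] :: real list list"
  define g1 where "g1 = split_by b ?g"
  define g2 where "g2 = split_by a g1"
  have s0: "\<forall>g\<in>set ?g. in_simplex 2 g" by (auto simp: in_simplex_def numeral_2_eq_2 less_Suc_eq)
  have s1: "\<forall>g\<in>set g1. in_simplex 2 g" unfolding g1_def by (rule in_simplex_split_by[OF s0])
  have s2: "\<forall>g\<in>set g2. in_simplex 2 g" unfolding g2_def by (rule in_simplex_split_by[OF s1])
  have l1: "length g1 \<le> 6" using length_split_by[of b ?g] by (simp add: g1_def)
  have "length g2 \<le> length g1 + length g1 * length g1" unfolding g2_def by (rule length_split_by)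
  also have "\<dots> \<le> 6 + 6 * 6" using l1 by (intro add_mono mult_mono) auto
  finally have l2: "length g2 \<le> 42" by simp
  let ?ps = "List.product g2 g2"
  have "length ?ps \<le> 42 * 42" unfolding length_product using l2 by (intro mult_mono) auto
  then have lp: "length ?ps * (20 * dot_time 2 + 900) \<le> 1764 * (20 * dot_time 2 + 900)"
    by (intro mult_right_mono) auto
  have Vg: "Cell (Cell (Num 1) (Cell (Num 0) Null)) (Cell (Cell (Num 0) (Cell (Num 1) Null)) Null) = Vs ?g"
    by (simp add: Vs_simps V_simps)
  have g: "\<And>g. g \<in> set ?g \<Longrightarrow> length g = 2" "\<And>g. g \<in> set g1 \<Longrightarrow> length g = 2"
    using s0 s1 by (auto simp: in_simplex_def)
  have "computes prog 14 (Cell (V b) (Vs ?g)) (Vs g1) (split_time 2 2)"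
    using computes_split[of b 2 ?g] assms(2) g(1) by (simp add: g1_def numeral_2_eq_2)
  note c1 = computesD[OF this]
  note c2 = computesD[OF computes_split[OF assms(1), of g1, OF g(2), folded g2_def]]
  have t: "split_time 2 (length g1) \<le> split_time 2 6" by (rule split_time_mono[OF l1])
  note c3 = computesD[OF computes_product_map[of V g2 V g2, folded Vs_def]]
  have t3: "product_time (length g2) (length g2) \<le> product_time 42 42" by (rule product_time_mono[OF l2 l2])
  have "\<And>p. p \<in> set ?ps \<Longrightarrow> length (fst p) = 2 \<and> length (snd p) = 2"
    using s2 by (auto simp: in_simplex_def)
  note c4 = computesD[OF computes_pair_exists[where ps = ?ps and k = k, OF assms this]]
  have bt: "block_test a b a' b' k \<longleftrightarrow> (\<exists>p\<in>set ?ps. pair_test a b a' b' k (fst p) (snd p))"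
    unfolding block_test_def g1_def g2_def by (simp add: Let_def split_def)
  have "length ?ps * (20 * dot_time 2 + 900) + 20 \<le> 1764 * (20 * dot_time 2 + 900) + 20"
    using lp by simp
  note c4 = c4(1,2) order_trans[OF c4(3) this]
  show ?thesis
    unfolding bt
    by (rule computesI)
      (simp_all add: nth_prog block_test_body_def block_val_def Vg c1 c2 c3 c4[unfolded block_val_def]
         del: set_product,
       use c1(3) c2(3) c3(3) c4(3)[unfolded block_val_def] t t3 in
         \<open>simp add: block_time_def del: set_product\<close>)
qed

definition pair_val :: "real list \<times> real list \<Rightarrow> val" where
  "pair_val p = Cell (V (fst p)) (V (snd p))"

definition pairs_val :: "strategy_pairs \<Rightarrow> val" where
  "pairs_val q = Cell (pair_val (fst q)) (pair_val (snd q))"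

definition option_val :: "(real list \<times> real list) option \<Rightarrow> val" where
  "option_val r = (case r of None \<Rightarrow> Null | Some p \<Rightarrow> pair_val p)"

lemma option_val_simps [simp]: "option_val None = Null" "option_val (Some p) = pair_val p"
  by (simp_all add: option_val_def)

lemma pair_val_neq_Null [simp]: "pair_val p \<noteq> Null"
  by (simp add: pair_val_def)

text \<open>Termination suffices, since this part of the program is entered in degenerate games
  only.\<close>

lemma computes_differences_split:
  assumes C: "\<And>r. r \<in> set C \<Longrightarrow> length r = k"
  shows "\<exists>N. computes prog 15 (Cell (Vs (units k)) (list_val (map pair_val (List.product C C))))
    (Vs (vertices C k)) N"
proof -
  let ?F = "\<lambda>p. split_by (lin_comb 1 (fst p) (-1) (snd p))"
  have len: "\<forall>g\<in>set (foldr ?F ps (units k)). in_simplex k g" for ps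
    by (induction ps) (simp_all add: in_simplex_split_by set_units in_simplex_unit)
  have "vertices C k = foldr ?F (List.product C C) (units k)"
    by (simp add: vertices_def differences_def foldr_map split_def o_def)
  moreover have "\<exists>N. computes prog 15 (Cell (Vs (units k)) (list_val (map pair_val (List.product C C))))
    (Vs (foldr ?F (List.product C C) (units k))) N"
  proof (rule terminates_fold[where d = Vs])
    fix ys p zs t assume "List.product C C = ys @ p # zs"
    then have "p \<in> set (List.product C C)" by simp
    then obtain u v where p: "p = (u, v)" "length u = k" "length v = k" using C by auto
    let ?r = "foldr ?F zs (units k)"
    have r: "\<And>g. g \<in> set ?r \<Longrightarrow> length g = k" using len by (auto simp: in_simplex_def)
    have l: "length u = length v" "length (lin_comb 1 u (-1) v) = k" using p by auto
    note c = computesD[OF computes_lin_comb[OF l(1), of 1 "-1"]] computesD[OF computes_split[OF l(2) r]]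
    show "safe prog [Vs ?r, pair_val p, Cell (Vs (units k)) t] arrange_step \<and>
        den prog [Vs ?r, pair_val p, Cell (Vs (units k)) t] arrange_step = Vs (?F p ?r)"
      using c by (simp add: arrange_step_def pair_val_def p)
  qed (auto simp: nth_prog)
  ultimately show ?thesis by simp
qed

section \<open>The tests and searches for a given game\<close>

definition dominated_time :: "nat \<Rightarrow> nat" where
  "dominated_time M = 8 * bil_time M + dot_time M + block_time + 1000"

definition refuted_time :: "nat \<Rightarrow> nat \<Rightarrow> nat" where
  "refuted_time M l = l * (2 * bil_time M + dominated_time M + 300) + 2 * bil_time M + 200"

definition search_time :: "nat \<Rightarrow> nat \<Rightarrow> nat \<Rightarrow> nat" where
  "search_time M l k = k * (refuted_time M l + 60) + 20"

definition degenerate_time :: "nat \<Rightarrow> nat" where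
  "degenerate_time M = 2 * dot_time M + 6 * bil_time M + 400"

context list_game
begin

lemma computes_bil_A:
  assumes "length x = m" "length y = n"
  shows "computes prog 7 (Cell (Vs A) (Cell (V x) (V y))) (Num (bil A x y)) (bil_time (m + n))"
  using assms A by (intro computes_bil) auto

lemma computes_bil_B:
  assumes "length x = m" "length y = n"
  shows "computes prog 7 (Cell (Vs B) (Cell (V y) (V x))) (Num (bil B y x)) (bil_time (m + n))"
  using assms B by (intro computes_bil) auto

lemma computes_gap_A:
  assumes "length x = m" "length y = n"
  shows "computes prog 20 (Cell (Num v) (Cell (Vs A) (Cell (V x) (V y)))) (Num (bil A x y - v))
    (bil_time (m + n) + 30)"
  by (rule computesI) (use computesD[OF computes_bil_A[OF assms]] in \<open>simp_all add: nth_prog gap_body_def\<close>)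

lemma computes_gap_B:
  assumes "length x = m" "length y = n"
  shows "computes prog 20 (Cell (Num v) (Cell (Vs B) (Cell (V y) (V x)))) (Num (bil B y x - v))
    (bil_time (m + n) + 30)"
  by (rule computesI) (use computesD[OF computes_bil_B[OF assms]] in \<open>simp_all add: nth_prog gap_body_def\<close>)

lemma computes_gaps_left:
  assumes "length e = m" "length e' = m" "length d = n"
  shows "computes prog 21 (Cell (Cell (Num v) (Vs A)) (Cell (Cell (V e) (V e')) (V d)))
    (V [bil A e d - v, bil A e' d - v]) (2 * bil_time (m + n) + 200)"
  by (rule computesI)
    (use computesD[OF computes_gap_A[OF assms(1,3), of v]] computesD[OF computes_gap_A[OF assms(2,3), of v]]
      in \<open>simp_all add: nth_prog gaps_left_body_def Let_def V_simps\<close>)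

lemma computes_gaps_right:
  assumes "length e = m" "length e' = m" "length d = n"
  shows "computes prog 22 (Cell (Cell (Num v) (Vs B)) (Cell (Cell (V e) (V e')) (V d)))
    (V [bil B d e - v, bil B d e' - v]) (2 * bil_time (m + n) + 200)"
  by (rule computesI)
    (use computesD[OF computes_gap_B[OF assms(1,3), of v]] computesD[OF computes_gap_B[OF assms(2,3), of v]]
      in \<open>simp_all add: nth_prog gaps_right_body_def Let_def V_simps\<close>)

definition wf_pairs :: "strategy_pairs \<Rightarrow> bool" where
  "wf_pairs q \<longleftrightarrow> length (fst (fst q)) = m \<and> length (snd (fst q)) = m \<and>
     length (fst (snd q)) = n \<and> length (snd (snd q)) = n"

lemma computes_dominated:
  assumes "wf_pairs q"
  shows "computes prog 23 (Cell (Cell (Cell (Vs A) (Vs B)) (Cell (Num v) (Num u))) (pairs_val q))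
    (bool_val (dominated_by A B v u q)) (dominated_time (m + n))"
proof -
  obtain e e' d d' where q: "q = ((e, e'), (d, d'))" by (metis prod.collapse)
  have l: "length e = m" "length e' = m" "length d = n" "length d' = n"
    using assms by (auto simp: q wf_pairs_def)
  then have "length d = length d'" by simp
  note c0 = computesD[OF computes_dot[OF this]]
  note c1 = computesD[OF computes_gaps_left[OF l(1,2,3), of v]]
  note c2 = computesD[OF computes_gaps_left[OF l(1,2,4), of v]]
  note c3 = computesD[OF computes_gaps_right[OF l(1,2,3), of u]]
  note c4 = computesD[OF computes_gaps_right[OF l(1,2,4), of u]]
  let ?a = "[bil A e d - v, bil A e' d - v]" and ?b = "[bil B d' e - u, bil B d' e' - u]"
  let ?a' = "[bil A e d' - v, bil A e' d' - v]" and ?b' = "[bil B d e - u, bil B d e' - u]"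
  have "computes prog 19 (block_val ?a ?b ?a' ?b' (1 - dot d d'))
      (bool_val (block_test ?a ?b ?a' ?b' (1 - dot d d'))) block_time"
    by (rule computes_block_test) simp_all
  note c5 = computesD[OF this, unfolded block_val_def]
  have t: "dot_time (length d') \<le> dot_time (m + n)" using l by (intro dot_time_mono) simp
  show ?thesis
    by (rule computesI)
      (simp_all add: nth_prog dominated_body_def Let_def pairs_val_def pair_val_def q c0 c1 c2 c3 c4 c5,
       use c0(3) c1(3) c2(3) c3(3) c4(3) c5(3) t in \<open>simp add: dominated_time_def\<close>)
qed

lemma computes_defect:
  assumes q: "\<And>q. q \<in> set qs \<Longrightarrow> wf_pairs q" and p: "length (fst p) = m" "length (snd p) = n"
  shows "computes prog 24
    (Cell (Cell (Cell (Cell (Vs A) (Vs B)) (Cell (Num v) (Num u))) (pair_val p)) (list_val (map pairs_val qs)))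
    (bool_val (\<exists>q\<in>set qs. defect A B p v u q))
    (length qs * (2 * bil_time (m + n) + dominated_time (m + n) + 300) + 20)"
proof -
  let ?F = "\<lambda>q c. defect A B p v u q \<or> c"
  let ?AB = "Cell (Vs A) (Vs B)"
  let ?C = "Cell (Cell ?AB (Cell (Num v) (Num u))) (pair_val p)"
  let ?K = "2 * bil_time (m + n) + dominated_time (m + n) + 200"
  have "computes prog 24 (Cell ?C (list_val (map pairs_val qs))) (bool_val (foldr ?F qs False))
    (length qs * (?K + 18) + 10 + 3)"
  proof (rule computes_fold[where d = bool_val])
    fix ys q zs t assume "qs = ys @ q # zs"
    then have w: "wf_pairs q" using q by simp
    obtain e e' d d' where qe: "q = ((e, e'), (d, d'))" by (metis prod.collapse)
    obtain x y where pe: "p = (x, y)" by fastforce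
    have l: "length e = m" "length d = n" "length x = m" "length y = n"
      using w p by (auto simp: qe pe wf_pairs_def)
    note c = computesD[OF computes_bil_A[OF l(1,4)]] computesD[OF computes_bil_B[OF l(3,2)]]
      computesD[OF computes_dominated[OF w, of v u], unfolded qe pairs_val_def pair_val_def fst_conv snd_conv]
    let ?env = "[bool_val (foldr ?F zs False), pairs_val q, Cell ?C t]"
    show "safe prog ?env defect_step \<and>
        den prog ?env defect_step = bool_val (?F q (foldr ?F zs False)) \<and>
        cost prog ?env defect_step \<le> ?K"
      using c by (simp add: defect_step_def Let_def pe qe pairs_val_def pair_val_def defect_def bool_val_def)
  qed (auto simp: nth_prog)
  then show ?thesis unfolding foldr_exists by (auto intro: computes_mono simp: algebra_simps)
qed

lemma computes_refuted:
  assumes q: "\<And>q. q \<in> set qs \<Longrightarrow> wf_pairs q" and p: "length (fst p) = m" "length (snd p) = n"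
  shows "computes prog 25 (Cell (Cell (Cell (Vs A) (Vs B)) (list_val (map pairs_val qs))) (pair_val p))
    (bool_val (refuted A B qs p)) (refuted_time (m + n) (length qs))"
proof -
  note c = computesD[OF computes_bil_A[OF p]] computesD[OF computes_bil_B[OF p]]
    computesD[OF computes_defect[where qs = qs and v = "bil A (fst p) (snd p)" and
      u = "bil B (snd p) (fst p)", OF q p], unfolded pair_val_def]
  show ?thesis
    by (rule computesI)
      (use c in \<open>simp_all add: nth_prog refuted_body_def Let_def pair_val_def refuted_def refuted_time_def\<close>)
qed

lemma computes_search:
  assumes q: "\<And>q. q \<in> set qs \<Longrightarrow> wf_pairs q"
    and ps: "\<And>p. p \<in> set ps \<Longrightarrow> length (fst p) = m \<and> length (snd p) = n"
  shows "computes prog 26 (Cell (Cell (Cell (Vs A) (Vs B)) (list_val (map pairs_val qs)))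
      (list_val (map pair_val ps)))
    (option_val (search A B qs ps)) (search_time (m + n) (length qs) (length ps))"
proof -
  let ?F = "\<lambda>p r. if refuted A B qs p then r else Some p"
  let ?C = "Cell (Cell (Vs A) (Vs B)) (list_val (map pairs_val qs))"
  have "computes prog 26 (Cell ?C (list_val (map pair_val ps))) (option_val (foldr ?F ps None))
      (length ps * ((refuted_time (m + n) (length qs) + 30) + 18) + 10 + 3)"
  proof (rule computes_fold[where d = option_val])
    fix ys p zs t assume "ps = ys @ p # zs"
    then have l: "length (fst p) = m" "length (snd p) = n" using ps[of p] by simp_all
    note c = computesD[OF computes_refuted[where qs = qs, OF q l]]
    let ?env = "[option_val (foldr ?F zs None), pair_val p, Cell ?C t]"
    show "safe prog ?env search_step \<and> den prog ?env search_step = option_val (?F p (foldr ?F zs None)) \<and>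
        cost prog ?env search_step \<le> refuted_time (m + n) (length qs) + 30"
      using c by (simp add: search_step_def bool_val_def)
  qed (auto simp: nth_prog)
  then show ?thesis
    unfolding search_def by (auto intro: computes_mono simp: search_time_def algebra_simps)
qed

lemma computes_degenerate_at:
  assumes "wf_pairs q"
  shows "computes prog 28 (Cell (Cell (Vs A) (Vs B)) (pairs_val q))
    (bool_val (degenerate_at A B q)) (degenerate_time (m + n))"
proof -
  obtain e e' d d' where q: "q = ((e, e'), (d, d'))" by (metis prod.collapse)
  have l: "length e = m" "length e' = m" "length d = n" "length d' = n"
    using assms by (auto simp: q wf_pairs_def)
  then have l': "length d = length d'" "length e = length e'" by simp_all
  note c = l'[THEN computes_dot, THEN computesD(1)] l'[THEN computes_dot, THEN computesD(2)]
    computesD[OF computes_bil_A[OF l(1,3)]] computesD[OF computes_bil_A[OF l(1,4)]]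
    computesD[OF computes_bil_A[OF l(2,3)]] computesD[OF computes_bil_B[OF l(1,3)]]
    computesD[OF computes_bil_B[OF l(1,4)]] computesD[OF computes_bil_B[OF l(2,3)]]
  have "dot_time (length e') \<le> dot_time (m + n)" "dot_time (length d') \<le> dot_time (m + n)"
    using l by (intro dot_time_mono; simp)+
  then have t: "steps prog 3 (Cell (V e) (V e')) \<le> dot_time (m + n)"
      "steps prog 3 (Cell (V d) (V d')) \<le> dot_time (m + n)"
    using l'[THEN computes_dot, THEN computesD(3)] by linarith+
  show ?thesis
    unfolding q pairs_val_def pair_val_def fst_conv snd_conv
    by (rule computesI)
      (simp_all add: nth_prog degenerate_body_def c,
       use c t in \<open>simp add: degenerate_time_def\<close>)
qed

lemma computes_degenerate:
  assumes "\<And>q. q \<in> set qs \<Longrightarrow> wf_pairs q"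
  shows "computes prog 27 (Cell (Cell (Vs A) (Vs B)) (list_val (map pairs_val qs)))
    (bool_val (\<exists>q\<in>set qs. degenerate_at A B q)) (length qs * (degenerate_time (m + n) + 60) + 20)"
proof -
  let ?F = "\<lambda>q c. degenerate_at A B q \<or> c"
  let ?C = "Cell (Vs A) (Vs B)"
  have "computes prog 27 (Cell ?C (list_val (map pairs_val qs))) (bool_val (foldr ?F qs False))
      (length qs * ((degenerate_time (m + n) + 30) + 18) + 10 + 3)"
  proof (rule computes_fold[where d = bool_val])
    fix ys q zs t assume "qs = ys @ q # zs"
    then have w: "wf_pairs q" using assms by simp
    note c = computesD[OF computes_degenerate_at[OF w]]
    let ?env = "[bool_val (foldr ?F zs False), pairs_val q, Cell ?C t]"
    show "safe prog ?env degenerate_step \<and> den prog ?env degenerate_step = bool_val (?F q (foldr ?F zs False)) \<and>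
        cost prog ?env degenerate_step \<le> degenerate_time (m + n) + 30"
      using c by (simp add: degenerate_step_def bool_val_def)
  qed (auto simp: nth_prog)
  then show ?thesis unfolding foldr_exists by (auto intro: computes_mono simp: algebra_simps)
qed

end

lemma computes_product_pairs:
  "computes prog 10 (Cell (Vs ys) (Vs xs)) (list_val (map pair_val (List.product xs ys)))
    (product_time (length xs) (length ys))"
  using computes_product_map[of V ys V xs] by (simp add: Vs_def pair_val_def[abs_def])

lemma computes_product_strategy_pairs:
  "computes prog 10 (Cell (list_val (map pair_val qs)) (list_val (map pair_val ps)))
    (list_val (map pairs_val (List.product ps qs))) (product_time (length ps) (length qs))"
  using computes_product_map[of pair_val qs pair_val ps] by (simp add: pairs_val_def[abs_def])

text \<open>Accounts for the run up to and including the degeneracy test, not for the vertex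
  search.\<close>

definition main_time :: "nat \<Rightarrow> nat \<Rightarrow> nat" where
  "main_time m n = units_time m + units_time n + product_time m m + product_time n n
     + product_time (m * m) (n * n) + product_time m n + search_time (m + n) (m * m * (n * n)) (m * n)
     + m * m * (n * n) * (degenerate_time (m + n) + 60) + 400"

context list_game
begin

lemma computes_main:
  "\<exists>N. computes prog 0 (Cell (Vs A) (Vs B)) (option_val (solve A B)) N \<and>
     (degenerate m n a b \<or> N \<le> main_time m n)"
proof -
  let ?qs = "strategy_pairs m n"
  let ?r = "search A B ?qs (List.product (units m) (units n))"
  have wf: "wf_pairs q" if "q \<in> set ?qs" for q
    using that by (auto simp: set_strategy_pairs wf_pairs_def)
  have u: "\<forall>p\<in>set (List.product (units m) (units n)). length (fst p) = m \<and> length (snd p) = n"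
    by (auto simp: set_units)
  have v: "\<forall>p\<in>set (List.product (vertices B m) (vertices A n)). length (fst p) = m \<and> length (snd p) = n"
    using vertices_simplex[of _ B m] vertices_simplex[of _ A n] A(2) B(2) by (auto simp: in_simplex_def)
  have lq: "length ?qs = m * m * (n * n)" by (simp add: strategy_pairs_def length_product)
  note cu1 = computesD[OF computes_units[of "map V A", folded Vs_def, unfolded length_map A(1)]]
  note cu2 = computesD[OF computes_units[of "map V B", folded Vs_def, unfolded length_map B(1)]]
  note p1 = computesD[OF computes_product_pairs[of "units m" "units m"]]
  note p2 = computesD[OF computes_product_pairs[of "units n" "units n"]]
  note p3 = computesD[OF computes_product_strategy_pairs[of "List.product (units n) (units n)"
      "List.product (units m) (units m)", folded strategy_pairs_def]]
  note p4 = computesD[OF computes_product_pairs[of "units n" "units m"]]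
  let ?AB = "Cell (Vs A) (Vs B)"
  have "computes prog 26 (Cell (Cell ?AB (list_val (map pairs_val ?qs))) (list_val (map pair_val ps)))
      (option_val (search A B ?qs ps)) (search_time (m + n) (length ?qs) (length ps))"
    if "\<forall>p\<in>set ps. length (fst p) = m \<and> length (snd p) = n" for ps
    using that wf by (intro computes_search) auto
  note s1 = computesD[OF this[OF u]] and s2 = computesD[OF this[OF v]]
  have "computes prog 27 (Cell ?AB (list_val (map pairs_val ?qs))) (bool_val (degenerate m n a b))
      (length ?qs * (degenerate_time (m + n) + 60) + 20)"
    using computes_degenerate[of ?qs] wf unfolding degenerate_iff by blast
  note dg = computesD[OF this]
  obtain N1 where N1: "computes prog 15 (Cell (Vs (units m)) (list_val (map pair_val (List.product B B))))
      (Vs (vertices B m)) N1"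
    using computes_differences_split[of B m] B(2) by blast
  obtain N2 where N2: "computes prog 15 (Cell (Vs (units n)) (list_val (map pair_val (List.product A A))))
      (Vs (vertices A n)) N2"
    using computes_differences_split[of A n] A(2) by blast
  note v1 = computesD[OF N1] computesD[OF computes_product_pairs[of B B]]
  note v2 = computesD[OF N2] computesD[OF computes_product_pairs[of A A]]
  note p5 = computesD[OF computes_product_pairs[of "vertices A n" "vertices B m"]]
  let ?arg = "Cell (Vs A) (Vs B)"
  note all = cu1 cu2 p1 p2 p3 p4 s1 dg v1 v2 p5 s2
  have safe: "safe prog [?arg] (prog ! 0)"
    by (cases ?r; cases "degenerate m n a b") (simp_all add: nth_prog main_body_def all)
  have den: "den prog [?arg] (prog ! 0) = option_val (solve A B)"
    by (cases ?r; cases "degenerate m n a b") (simp_all add: nth_prog main_body_def all solve_eq)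
  have cost: "cost prog [?arg] (prog ! 0) \<le> main_time m n" if nd: "\<not> degenerate m n a b"
  proof -
    note l = length_product length_units lq
    have "cost prog [?arg] (prog ! 0) \<le> steps prog 12 (Cell Null (Vs A)) + steps prog 12 (Cell Null (Vs B))
      + steps prog 10 (Cell (Vs (units m)) (Vs (units m))) + steps prog 10 (Cell (Vs (units n)) (Vs (units n)))
      + steps prog 10 (Cell (list_val (map pair_val (List.product (units n) (units n))))
          (list_val (map pair_val (List.product (units m) (units m)))))
      + steps prog 10 (Cell (Vs (units n)) (Vs (units m)))
      + steps prog 26 (Cell (Cell ?arg (list_val (map pairs_val ?qs)))
          (list_val (map pair_val (List.product (units m) (units n)))))
      + steps prog 27 (Cell ?arg (list_val (map pairs_val ?qs))) + 100"
      by (cases ?r) (simp_all add: nth_prog main_body_def all nd)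
    also have "\<dots> \<le> main_time m n"
      using cu1(3) cu2(3) p1(3) p2(3) p3(3)[unfolded l] p4(3) s1(3)[unfolded l] dg(3)[unfolded l]
      unfolding main_time_def l by linarith
    finally show ?thesis .
  qed
  show ?thesis
    using computesI[OF _ safe den order_refl] cost by auto
qed

end

section \<open>From lists back to matrices\<close>

definition rows_list :: "real mat \<Rightarrow> real list list" where
  "rows_list U = map list_of_vec (rows U)"

lemma mat_val_eq: "mat_val U = Vs (rows_list U)"
  by (simp add: mat_val_def Vs_def rows_list_def vec_val_def[abs_def] V_def[abs_def] o_def)

lemma rows_list_props:
  assumes "U \<in> carrier_mat m n"
  shows "length (rows_list U) = m" "\<And>r. r \<in> set (rows_list U) \<Longrightarrow> length r = n"
    "\<And>i j. i < m \<Longrightarrow> j < n \<Longrightarrow> rows_list U ! i ! j = U $$ (i, j)"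
  using assms by (auto simp: rows_list_def rows_def)

lemma pair_val_profile:
  "pair_val (x, y) = profile_val (\<lambda>i. case i of P1 \<Rightarrow> vec_of_list x | P2 \<Rightarrow> vec_of_list y)"
  by (simp add: pair_val_def profile_val_def vec_val_def V_def list_vec)

text \<open>The two extra steps are the variable and the call in the entry term.\<close>

lemma runs_computes:
  assumes "computes prog 0 c r N"
  shows "\<exists>k \<le> N + 2. runs prog c r k"
proof -
  note c = computesD[OF assms]
  have "eval prog [c] (Call 0 (Var 0)) r (1 + steps prog 0 c + 1)"
    using eval.Call[OF eval.Var[of 0 "[c]" prog], of 0 r "steps prog 0 c"] eval_result[OF c(1)] c(2) by simp
  then show ?thesis using c(3) unfolding runs_def by (intro exI[of _ "1 + steps prog 0 c + 1"]) simp
qed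

theorem finds_strong_nash_prog: "finds_strong_nash prog"
  unfolding finds_strong_nash_def
proof (intro allI impI)
  fix U1 U2 assume "bimatrix_game U1 U2"
  then obtain m n where U: "U1 \<in> carrier_mat m n" "U2 \<in> carrier_mat n m"
    unfolding bimatrix_game_def by blast
  let ?A = "rows_list U1" and ?B = "rows_list U2"
  interpret list_game ?A ?B m n
    by unfold_locales (use rows_list_props[OF U(1)] rows_list_props[OF U(2)] in auto)
  have sn: "strong_nash_equilibrium U1 U2 x \<longleftrightarrow> x P1 \<in> carrier_vec m \<and> x P2 \<in> carrier_vec n \<and>
      strong_nash m n a b (($) (x P1)) (($) (x P2))" for x
  proof -
    have "strong_nash m n (\<lambda>i j. U1 $$ (i, j)) (\<lambda>i j. U2 $$ (j, i)) (($) (x P1)) (($) (x P2)) \<longleftrightarrow>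
        strong_nash m n a b (($) (x P1)) (($) (x P2))"
      by (rule strong_nash_cong)
        (simp_all add: a_def b_def rows_list_props(3)[OF U(1)] rows_list_props(3)[OF U(2)])
    then show ?thesis by (simp add: strong_nash_equilibrium_iff[OF U])
  qed
  obtain N where "computes prog 0 (Cell (Vs ?A) (Vs ?B)) (option_val (solve ?A ?B)) N"
    using computes_main by blast
  then obtain k where k: "runs prog (game_val U1 U2) (option_val (solve ?A ?B)) k"
    using runs_computes unfolding game_val_def mat_val_eq by blast
  show "\<exists>r n. runs prog (game_val U1 U2) r n \<and>
         (if \<exists>x. strong_nash_equilibrium U1 U2 x
          then \<exists>x. strong_nash_equilibrium U1 U2 x \<and> r = profile_val x
          else r = Null)"
  proof (cases "solve ?A ?B")
    case None
    then have "\<not> strong_nash_equilibrium U1 U2 x" for x using solve_None unfolding sn by blast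
    then show ?thesis using k None by auto
  next
    case (Some p)
    obtain x y where p: "p = (x, y)" by fastforce
    define z where "z = (\<lambda>i. case i of P1 \<Rightarrow> vec_of_list x | P2 \<Rightarrow> vec_of_list y)"
    have s: "in_simplex m x" "in_simplex n y" "strong_nash m n a b ((!) x) ((!) y)"
      using solve_Some[OF Some[unfolded p]] by simp_all
    have "($) (z P1) = (!) x" "($) (z P2) = (!) y"
      by (rule ext, simp add: z_def vec_of_list_index)+
    moreover have "z P1 \<in> carrier_vec m" "z P2 \<in> carrier_vec n"
      using s(1,2) unfolding z_def in_simplex_def carrier_vec_def by auto
    ultimately have eq: "strong_nash_equilibrium U1 U2 z" unfolding sn using s(3) by (simp only: simp_thms)
    have "option_val (solve ?A ?B) = profile_val z"
      by (simp add: Some p pair_val_profile z_def)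
    with k eq show ?thesis by (intro exI[of _ "profile_val z"] exI[of _ k]) auto
  qed
qed

lemma running_time_generic:
  assumes U: "U1 \<in> carrier_mat m n" "U2 \<in> carrier_mat n m"
    and nd: "\<not> degenerate m n (\<lambda>i j. U1 $$ (i, j)) (\<lambda>i j. U2 $$ (j, i))"
  shows "running_time prog (game_val U1 U2) \<le> of_nat (main_time m n + 2)"
proof -
  let ?A = "rows_list U1" and ?B = "rows_list U2"
  interpret list_game ?A ?B m n
    by unfold_locales (use rows_list_props[OF U(1)] rows_list_props[OF U(2)] in auto)
  have "degenerate m n a b \<longleftrightarrow> degenerate m n (\<lambda>i j. U1 $$ (i, j)) (\<lambda>i j. U2 $$ (j, i))"
    unfolding degenerate_def
    by (intro ex_cong1 conj_cong refl)
      (simp add: a_def b_def rows_list_props(3)[OF U(1)] rows_list_props(3)[OF U(2)])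
  with nd obtain N where N: "computes prog 0 (Cell (Vs ?A) (Vs ?B)) (option_val (solve ?A ?B)) N"
    "N \<le> main_time m n"
    using computes_main by blast
  then obtain k where k: "k \<le> N + 2" "runs prog (game_val U1 U2) (option_val (solve ?A ?B)) k"
    using runs_computes unfolding game_val_def mat_val_eq by blast
  have "running_time prog (game_val U1 U2) \<le> of_nat k"
    unfolding running_time_def using k by (intro Inf_lower) blast
  also have "\<dots> \<le> of_nat (main_time m n + 2)" using k(1) N(2) by (intro of_nat_mono) simp
  finally show ?thesis .
qed

section \<open>Measurability of the running time\<close>

text \<open>Evaluation with a bound on the depth of the call stack; the time is infinite iff the bound
  is exceeded or the term is ill-formed.\<close>

fun run_val :: "program \<Rightarrow> nat \<Rightarrow> val list \<Rightarrow> trm \<Rightarrow> val" where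
  "run_val P k env (Var i) = (if i < length env then env ! i else Null)"
| "run_val P k env Empty = Null"
| "run_val P k env (Const c) = Num (of_int c)"
| "run_val P k env (Op1 f t) = app1 f (run_val P k env t)"
| "run_val P k env (Op2 f t u) = app2 f (run_val P k env t) (run_val P k env u)"
| "run_val P k env (Cond s t u) =
     (if run_val P k env s \<noteq> Null then run_val P k env t else run_val P k env u)"
| "run_val P k env (LetIn t u) = run_val P k (run_val P k env t # env) u"
| "run_val P 0 env (Call f t) = Null"
| "run_val P (Suc k) env (Call f t) =
     (if f < length P then run_val P k [run_val P (Suc k) env t] (P ! f) else Null)"

fun run_time :: "program \<Rightarrow> nat \<Rightarrow> val list \<Rightarrow> trm \<Rightarrow> enat" where
  "run_time P k env (Var i) = (if i < length env then 1 else \<infinity>)"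
| "run_time P k env Empty = 1"
| "run_time P k env (Const c) = 1"
| "run_time P k env (Op1 f t) = run_time P k env t + 1"
| "run_time P k env (Op2 f t u) = run_time P k env t + run_time P k env u + 1"
| "run_time P k env (Cond s t u) =
     run_time P k env s + (if run_val P k env s \<noteq> Null then run_time P k env t else run_time P k env u) + 1"
| "run_time P k env (LetIn t u) = run_time P k env t + run_time P k (run_val P k env t # env) u + 1"
| "run_time P 0 env (Call f t) = \<infinity>"
| "run_time P (Suc k) env (Call f t) =
     (if f < length P then run_time P (Suc k) env t + run_time P k [run_val P (Suc k) env t] (P ! f) + 1
      else \<infinity>)"

lemma eval_run_val: "run_time P k env t = enat n \<Longrightarrow> eval P env t (run_val P k env t) n"
proof (induction P k env t arbitrary: n rule: run_time.induct)
  case (1 P k env i)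
  then show ?case using eval.Var[of i env P] by (simp add: one_enat_def split: if_splits)
next
  case (2 P k env)
  then show ?case using eval.Empty[of P env] by (simp add: one_enat_def)
next
  case (3 P k env c)
  then show ?case using eval.Const[of P env c] by (simp add: one_enat_def)
next
  case (4 P k env f t)
  then obtain i where i: "run_time P k env t = enat i" "n = i + 1"
    by (cases "run_time P k env t") (auto simp: one_enat_def)
  show ?case using eval.Op1[OF 4(1)[OF i(1)]] i by simp
next
  case (5 P k env f t u)
  then obtain i j where i: "run_time P k env t = enat i" "run_time P k env u = enat j" "n = i + j + 1"
    by (cases "run_time P k env t"; cases "run_time P k env u") (auto simp: one_enat_def)
  show ?case using eval.Op2[OF 5(1)[OF i(1)] 5(2)[OF i(2)]] i by simp
next
  case (6 P k env s t u)
  show ?case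
  proof (cases "run_val P k env s = Null")
    case True
    then obtain i j where i: "run_time P k env s = enat i" "run_time P k env u = enat j" "n = i + j + 1"
      using 6(4) by (cases "run_time P k env s"; cases "run_time P k env u") (auto simp: one_enat_def)
    have "eval P env s Null i" using 6(1)[OF i(1)] True by simp
    from eval.Cond_False[OF this 6(3)[OF _ i(2)]] show ?thesis using True i by simp
  next
    case False
    then obtain i j where i: "run_time P k env s = enat i" "run_time P k env t = enat j" "n = i + j + 1"
      using 6(4) by (cases "run_time P k env s"; cases "run_time P k env t") (auto simp: one_enat_def)
    from eval.Cond_True[OF 6(1)[OF i(1)] False 6(2)[OF False i(2)]] show ?thesis using False i by simp
  qed
next
  case (7 P k env t u)
  then obtain i j where i: "run_time P k env t = enat i"
    "run_time P k (run_val P k env t # env) u = enat j" "n = i + j + 1"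
    by (cases "run_time P k env t"; cases "run_time P k (run_val P k env t # env) u")
      (auto simp: one_enat_def)
  show ?case using eval.LetIn[OF 7(1)[OF i(1)] 7(2)[OF i(2)]] i by simp
next
  case (8 P env f t)
  then show ?case by simp
next
  case (9 P k env f t)
  then have f: "f < length P" by (auto split: if_splits)
  then obtain i j where i: "run_time P (Suc k) env t = enat i"
    "run_time P k [run_val P (Suc k) env t] (P ! f) = enat j" "n = i + j + 1"
    using 9(3) by (cases "run_time P (Suc k) env t"; cases "run_time P k [run_val P (Suc k) env t] (P ! f)")
      (auto simp: one_enat_def)
  show ?case using eval.Call[OF 9(1)[OF f i(1)] f 9(2)[OF f i(2)]] f i by simp
qed

lemma run_val_eval:
  "eval P env t v n \<Longrightarrow> \<exists>k0. \<forall>k\<ge>k0. run_val P k env t = v \<and> run_time P k env t = enat n"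
proof (induction rule: eval.induct)
  case (Var i env)
  then show ?case by (simp add: one_enat_def)
next
  case (Empty env)
  show ?case by (simp add: one_enat_def)
next
  case (Const env c)
  show ?case by (simp add: one_enat_def)
next
  case (Op1 env t a n f)
  then obtain k where "\<forall>l\<ge>k. run_val P l env t = a \<and> run_time P l env t = enat n" by blast
  then show ?case by (intro exI[of _ k]) (simp add: one_enat_def)
next
  case (Op2 env t a n u b m f)
  then obtain k l where "\<forall>i\<ge>k. run_val P i env t = a \<and> run_time P i env t = enat n"
    "\<forall>i\<ge>l. run_val P i env u = b \<and> run_time P i env u = enat m" by blast
  then show ?case by (intro exI[of _ "max k l"]) (simp add: one_enat_def)
next
  case (Cond_True env s a n t v m u)
  then obtain k l where "\<forall>i\<ge>k. run_val P i env s = a \<and> run_time P i env s = enat n"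
    "\<forall>i\<ge>l. run_val P i env t = v \<and> run_time P i env t = enat m" by blast
  then show ?case using Cond_True by (intro exI[of _ "max k l"]) (simp add: one_enat_def)
next
  case (Cond_False env s n u v m t)
  then obtain k l where "\<forall>i\<ge>k. run_val P i env s = Null \<and> run_time P i env s = enat n"
    "\<forall>i\<ge>l. run_val P i env u = v \<and> run_time P i env u = enat m" by blast
  then show ?case by (intro exI[of _ "max k l"]) (simp add: one_enat_def)
next
  case (LetIn env t a n u v m)
  then obtain k l where "\<forall>i\<ge>k. run_val P i env t = a \<and> run_time P i env t = enat n"
    "\<forall>i\<ge>l. run_val P i (a # env) u = v \<and> run_time P i (a # env) u = enat m" by blast
  then show ?case by (intro exI[of _ "max k l"]) (simp add: one_enat_def)
next
  case (Call env t a n f v m)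
  then obtain k l where kl: "\<forall>i\<ge>k. run_val P i env t = a \<and> run_time P i env t = enat n"
    "\<forall>i\<ge>l. run_val P i [a] (P ! f) = v \<and> run_time P i [a] (P ! f) = enat m" by blast
  show ?case
  proof (intro exI allI impI)
    \<comment> \<open>One level of depth is spent on the call itself, hence
      \<open>Suc l\<close>.\<close>
    fix i assume i: "max k (Suc l) \<le> i"
    then obtain i' where i': "i = Suc i'" "l \<le> i'" by (cases i) auto
    then show "run_val P i env (Call f t) = v \<and> run_time P i env (Call f t) = enat (n + m + 1)"
      using kl i Call by (simp add: one_enat_def)
  qed
qed

text \<open>Turns the infimum over runs into a countable infimum of depth-bounded times, each
  defined by structural recursion, so that measurability can be proved depth by depth.\<close>

lemma running_time_eq: "running_time P c = (INF k. ennreal_of_enat (run_time P k [c] (Call 0 (Var 0))))"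
proof (rule antisym)
  show "running_time P c \<le> (INF k. ennreal_of_enat (run_time P k [c] (Call 0 (Var 0))))"
  proof (rule INF_greatest)
    fix k
    show "running_time P c \<le> ennreal_of_enat (run_time P k [c] (Call 0 (Var 0)))"
    proof (cases "run_time P k [c] (Call 0 (Var 0))")
      case (enat n)
      then have "runs P c (run_val P k [c] (Call 0 (Var 0))) n" unfolding runs_def by (rule eval_run_val)
      then show ?thesis unfolding enat running_time_def by (auto intro!: Inf_lower)
    qed simp
  qed
  show "(INF k. ennreal_of_enat (run_time P k [c] (Call 0 (Var 0)))) \<le> running_time P c"
    unfolding running_time_def
  proof (rule Inf_greatest)
    fix x :: ennreal assume "x \<in> {of_nat n |r n. runs P c r n}"
    then obtain r n where x: "x = of_nat n" and "runs P c r n" by blast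
    then obtain k where "run_time P k [c] (Call 0 (Var 0)) = enat n"
      using run_val_eval unfolding runs_def by blast
    then show "(INF k. ennreal_of_enat (run_time P k [c] (Call 0 (Var 0)))) \<le> x"
      unfolding x by (intro INF_lower2[of k]) auto
  qed
qed

text \<open>Instead of a sigma-algebra on \<open>val\<close> we use the shape and the number at each position of the
  tree, a position being a sequence of projections.\<close>

primrec subtree :: "unop list \<Rightarrow> val \<Rightarrow> val" where
  "subtree [] v = v"
| "subtree (f # p) v = subtree p (app1 f v)"

fun kind :: "val \<Rightarrow> nat" where
  "kind Null = 0" | "kind (Num x) = 1" | "kind (Cell v w) = 2"

fun number :: "val \<Rightarrow> real" where
  "number (Num x) = x" | "number _ = 0"

definition random_value :: "'a measure \<Rightarrow> ('a \<Rightarrow> val) \<Rightarrow> bool" where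
  "random_value M f \<longleftrightarrow> (\<forall>p. (\<lambda>d. kind (subtree p (f d))) \<in> measurable M (count_space UNIV) \<and>
     (\<lambda>d. number (subtree p (f d))) \<in> borel_measurable M)"

lemma random_value_kind: "random_value M f \<Longrightarrow> (\<lambda>d. kind (f d)) \<in> measurable M (count_space UNIV)"
  unfolding random_value_def by (drule spec[of _ "[]"]) simp

lemma random_value_number: "random_value M f \<Longrightarrow> (\<lambda>d. number (f d)) \<in> borel_measurable M"
  unfolding random_value_def by (drule spec[of _ "[]"]) simp

lemma random_value_const: "random_value M (\<lambda>_. c)"
  by (simp add: random_value_def)

lemma random_value_app1: "random_value M f \<Longrightarrow> random_value M (\<lambda>d. app1 g (f d))"
  unfolding random_value_def
  by (intro allI) (drule_tac x = "g # p" in spec, simp)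

lemma random_value_if:
  assumes "Measurable.pred M Q" "random_value M f" "random_value M g"
  shows "random_value M (\<lambda>d. if Q d then f d else g d)"
  using assms unfolding random_value_def
  by (auto simp: if_distrib[of "subtree _"] if_distrib[of kind] if_distrib[of number]
      intro!: measurable_If)

lemma subtree_Null [simp]: "subtree p Null = Null"
proof (induction p)
  case (Cons f p)
  then show ?case by (cases f) simp_all
qed simp

lemma random_value_Cell:
  assumes "random_value M f" "random_value M g"
  shows "random_value M (\<lambda>d. Cell (f d) (g d))"
  unfolding random_value_def
proof
  fix p
  show "(\<lambda>d. kind (subtree p (Cell (f d) (g d)))) \<in> measurable M (count_space UNIV) \<and>
     (\<lambda>d. number (subtree p (Cell (f d) (g d)))) \<in> borel_measurable M"
  proof (cases p)
    case (Cons h q)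
    then show ?thesis using assms unfolding random_value_def by (cases h) simp_all
  qed simp
qed

lemma random_value_Num:
  assumes "f \<in> borel_measurable M"
  shows "random_value M (\<lambda>d. Num (f d))"
  unfolding random_value_def
proof
  fix p
  show "(\<lambda>d. kind (subtree p (Num (f d)))) \<in> measurable M (count_space UNIV) \<and>
     (\<lambda>d. number (subtree p (Num (f d)))) \<in> borel_measurable M"
  proof (cases p)
    case (Cons h q)
    then show ?thesis by (cases h) simp_all
  qed (use assms in simp)
qed

text \<open>Replaces pattern matching by tests on \<open>kind\<close> and arithmetic on
  \<open>number\<close>, both of which are measurable.\<close>

lemma app2_eq:
  "app2 Mk_Cell v w = Cell v w"
  "app2 Add v w = (if kind v = 1 \<and> kind w = 1 then Num (number v + number w) else Null)"
  "app2 Sub v w = (if kind v = 1 \<and> kind w = 1 then Num (number v - number w) else Null)"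
  "app2 Mul v w = (if kind v = 1 \<and> kind w = 1 then Num (number v * number w) else Null)"
  "app2 Div v w = (if kind v = 1 \<and> kind w = 1 then Num (number v / number w) else Null)"
  "app2 Less v w = (if kind v = 1 \<and> kind w = 1 \<and> number v < number w then Cell Null Null else Null)"
  by (cases v; cases w; simp)+

lemma random_value_app2:
  assumes f: "random_value M f" and g: "random_value M g"
  shows "random_value M (\<lambda>d. app2 h (f d) (g d))"
proof -
  have [measurable]: "(\<lambda>d. kind (f d)) \<in> measurable M (count_space UNIV)"
    "(\<lambda>d. kind (g d)) \<in> measurable M (count_space UNIV)"
    "(\<lambda>d. number (f d)) \<in> borel_measurable M" "(\<lambda>d. number (g d)) \<in> borel_measurable M"
    using f g by (simp_all add: random_value_kind random_value_number)
  show ?thesis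
    by (cases h; simp only: app2_eq;
        intro random_value_Cell f g random_value_if random_value_Num random_value_const)
      measurable
qed

text \<open>The environment is a fixed list of random values. The outer induction is on the depth,
  because the body of a called function is not a subterm of the call.\<close>

lemma random_value_eval:
  assumes "\<forall>e\<in>set es. random_value M e"
  shows "random_value M (\<lambda>d. run_val P k (map (\<lambda>e. e d) es) t) \<and>
    (\<lambda>d. run_time P k (map (\<lambda>e. e d) es) t) \<in> measurable M (count_space UNIV)"
  using assms
proof (induction k arbitrary: t es rule: less_induct)
  case (less k)
  note outer = less.IH
  have plus: "(\<lambda>d. f d + g d + 1) \<in> measurable M (count_space UNIV)"
    if [measurable]: "f \<in> measurable M (count_space UNIV)" "g \<in> measurable M (count_space UNIV)"
    for f g :: "_ \<Rightarrow> enat"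
    by measurable
  have plus1: "(\<lambda>d. f d + 1) \<in> measurable M (count_space UNIV)"
    if [measurable]: "f \<in> measurable M (count_space UNIV)" for f :: "_ \<Rightarrow> enat"
    by measurable
  have null: "Measurable.pred M (\<lambda>d. f d \<noteq> Null)" if "random_value M f" for f
  proof -
    have [measurable]: "(\<lambda>d. kind (f d)) \<in> measurable M (count_space UNIV)"
      using that by (rule random_value_kind)
    have "f d \<noteq> Null \<longleftrightarrow> kind (f d) \<noteq> 0" for d by (cases "f d") auto
    then show ?thesis by simp
  qed
  show ?case
    using less.prems
  proof (induction t arbitrary: es)
    case (Var i)
    then show ?case by (cases "i < length es") (auto simp: random_value_const)
  next
    case Empty
    then show ?case by (simp add: random_value_const)
  next
    case (Const c)
    then show ?case by (simp add: random_value_const)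
  next
    case (Op1 f t)
    then show ?case by (simp add: random_value_app1 plus1)
  next
    case (Op2 f t u)
    then show ?case by (simp add: random_value_app2 plus)
  next
    case (Cond s t u)
    have "random_value M (\<lambda>d. run_val P k (map (\<lambda>e. e d) es) s)" using Cond by blast
    from null[OF this] show ?case using Cond
      by (auto intro!: random_value_if plus measurable_If)
  next
    case (LetIn t u)
    let ?v = "\<lambda>d. run_val P k (map (\<lambda>e. e d) es) t"
    have v: "random_value M ?v" using LetIn by blast
    have "\<forall>e\<in>set (?v # es). random_value M e" using v LetIn.prems by simp
    from LetIn.IH(2)[OF this] show ?case using LetIn.IH(1)[OF LetIn.prems] by (simp add: plus)
  next
    case (Call f t)
    show ?case
    proof (cases k)
      case 0
      then show ?thesis by (simp add: random_value_const)
    next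
      case (Suc l)
      let ?v = "\<lambda>d. run_val P k (map (\<lambda>e. e d) es) t"
      have v: "random_value M ?v" using Call by blast
      have "l < k" "\<forall>e\<in>set [?v]. random_value M e" using v Suc by simp_all
      from outer[OF this, of "P ! f"] show ?thesis
        using Call.IH[OF Call.prems] unfolding Suc
        by (cases "f < length P") (simp_all add: plus random_value_const)
    qed
  qed
qed

lemma measurable_running_time:
  assumes "random_value M f"
  shows "(\<lambda>d. running_time P (f d)) \<in> borel_measurable M"
proof -
  have "(\<lambda>d. ennreal_of_enat (run_time P k [f d] (Call 0 (Var 0)))) \<in> borel_measurable M" for k
  proof -
    have "(\<lambda>d. run_time P k [f d] (Call 0 (Var 0))) \<in> measurable M (count_space UNIV)"
      using random_value_eval[of "[f]" M P k "Call 0 (Var 0)"] assms by simp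
    then show ?thesis by (rule measurable_compose) simp
  qed
  then show ?thesis unfolding running_time_eq by measurable
qed

lemma random_value_list:
  "(\<And>x. x \<in> set xs \<Longrightarrow> random_value M (f x)) \<Longrightarrow> random_value M (\<lambda>d. list_val (map (\<lambda>x. f x d) xs))"
  by (induction xs) (simp_all add: random_value_const random_value_Cell)

lemma mat_val_eq_list:
  assumes "U \<in> carrier_mat m n"
  shows "mat_val (U + mat (dim_row U) (dim_col U) d) =
    list_val (map (\<lambda>i. list_val (map (\<lambda>j. Num (U $$ (i, j) + d (i, j))) [0..<n])) [0..<m])"
  using assms
  by (auto simp: mat_val_def vec_val_def rows_def list_of_vec_map row_def intro!: arg_cong[of _ _ list_val])

lemma measurable_perturbed_time:
  assumes U: "U1 \<in> carrier_mat m n" "U2 \<in> carrier_mat n m"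
  shows "perturbed_time P U1 U2 \<in> borel_measurable (perturbation s m n)"
proof -
  have f: "(\<lambda>d. fst d (i, j)) \<in> borel_measurable (perturbation s m n)" if "i < m" "j < n" for i j
  proof -
    have "(\<lambda>d. d (i, j)) \<in> borel_measurable (\<Pi>\<^sub>M ij \<in> {..<m} \<times> {..<n}. uniform_measure lborel {-s..s})"
      using measurable_component_singleton[of "(i, j)" "{..<m} \<times> {..<n}"
          "\<lambda>_. uniform_measure lborel {-s..s}"] that
      by (simp cong: measurable_cong_sets)
    then show ?thesis unfolding perturbation_def by (rule measurable_compose[OF measurable_fst])
  qed
  have g: "(\<lambda>d. snd d (j, i)) \<in> borel_measurable (perturbation s m n)" if "i < m" "j < n" for i j
  proof -
    have "(\<lambda>d. d (j, i)) \<in> borel_measurable (\<Pi>\<^sub>M ij \<in> {..<n} \<times> {..<m}. uniform_measure lborel {-s..s})"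
      using measurable_component_singleton[of "(j, i)" "{..<n} \<times> {..<m}"
          "\<lambda>_. uniform_measure lborel {-s..s}"] that
      by (simp cong: measurable_cong_sets)
    then show ?thesis unfolding perturbation_def by (rule measurable_compose[OF measurable_snd])
  qed
  show ?thesis
    unfolding perturbed_time_def split_def game_val_def mat_val_eq_list[OF U(1)] mat_val_eq_list[OF U(2)]
    by (intro measurable_running_time random_value_Cell random_value_list random_value_Num
        borel_measurable_add borel_measurable_const f g) auto
qed

section \<open>Perturbed games are generic\<close>

lemma prob_space_uniform: "0 < (s::real) \<Longrightarrow> prob_space (uniform_measure lborel {-s..s})"
  by (intro prob_space_uniform_measure) auto

lemma AE_uniform_neq: "0 < (s::real) \<Longrightarrow> AE x in uniform_measure lborel {-s..s}. x \<noteq> c"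
  by (intro AE_uniform_measureI) (use AE_lborel_singleton[of c] in \<open>auto elim!: eventually_mono\<close>)

text \<open>Fubini with coordinate \<open>k\<close> integrated first: \<open>h\<close> does not
  depend on it, so each section of the exceptional set has at most one point.\<close>

lemma AE_PiM_neq:
  fixes h :: "('i \<Rightarrow> real) \<Rightarrow> real"
  assumes I: "finite I" "k \<in> I" and N: "prob_space N" "sets N = sets borel" "\<And>c. AE x in N. x \<noteq> c"
    and h: "h \<in> borel_measurable (PiM I (\<lambda>_. N))" "\<And>f x. h (f(k := x)) = h f"
  shows "AE f in PiM I (\<lambda>_. N). f k \<noteq> h f"
proof -
  interpret N: prob_space N by (rule N)
  interpret product_sigma_finite "\<lambda>_. N" by unfold_locales
  define J where "J = I - {k}"
  have J: "I = insert k J" "k \<notin> J" "finite J" using I by (auto simp: J_def)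
  let ?M = "PiM I (\<lambda>_. N)"
  have [measurable]: "(\<lambda>f. f k) \<in> borel_measurable ?M" "h \<in> borel_measurable ?M"
    using measurable_component_singleton[OF I(2), of "\<lambda>_. N"] h N(2) by (simp_all cong: measurable_cong_sets)
  define B where "B = {f \<in> space ?M. f k = h f}"
  have B: "B \<in> sets ?M" unfolding B_def by measurable
  have "emeasure ?M B = (\<integral>\<^sup>+ f. indicator B f \<partial>?M)" using B by simp
  also have "\<dots> = (\<integral>\<^sup>+ f. (\<integral>\<^sup>+ y. indicator B (f(k := y)) \<partial>N) \<partial>PiM J (\<lambda>_. N))"
    unfolding J(1) using B J by (intro product_nn_integral_insert) auto
  also have "\<dots> = (\<integral>\<^sup>+ f. 0 \<partial>PiM J (\<lambda>_. N))"
  proof (rule nn_integral_cong)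
    fix f
    have "AE y in N. indicator B (f(k := y)) = (0::ennreal)"
      using N(3)[of "h f"] by eventually_elim (auto simp: B_def h(2) split: split_indicator)
    then show "(\<integral>\<^sup>+ y. indicator B (f(k := y)) \<partial>N) = 0"
      by (subst nn_integral_cong_AE[where v = "\<lambda>_. 0"]) auto
  qed
  finally have "B \<in> null_sets ?M" using B by (simp add: null_sets_def)
  then show ?thesis by (rule AE_I') (auto simp: B_def)
qed

lemma AE_perturbation_generic:
  assumes s: "0 < s" and U: "U1 \<in> carrier_mat m n" "U2 \<in> carrier_mat n m"
  shows "AE d in perturbation s m n.
    \<not> degenerate m n (\<lambda>i j. U1 $$ (i, j) + fst d (i, j)) (\<lambda>i j. U2 $$ (j, i) + snd d (j, i))"
proof -
  let ?N = "uniform_measure lborel {-s..s}"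
  let ?I = "{..<m} \<times> {..<n}" and ?J = "{..<n} \<times> {..<m}"
  let ?M1 = "PiM ?I (\<lambda>_. ?N)" and ?M2 = "PiM ?J (\<lambda>_. ?N)"
  interpret N: prob_space ?N by (rule prob_space_uniform[OF s])
  interpret P1: prob_space ?M1 by (intro prob_space_PiM N.prob_space_axioms)
  interpret P2: prob_space ?M2 by (intro prob_space_PiM N.prob_space_axioms)
  interpret pair_sigma_finite ?M1 ?M2 ..
  have N: "sets ?N = sets borel" by simp
  note neq = AE_PiM_neq[OF _ _ N.prob_space_axioms N AE_uniform_neq[OF s]]
  have c1: "(\<lambda>x. x (i, j)) \<in> borel_measurable ?M1" if "i < m" "j < n" for i j
    using measurable_component_singleton[of "(i, j)" ?I "\<lambda>_. ?N"] that by (simp cong: measurable_cong_sets)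
  have c2: "(\<lambda>y. y (j, i)) \<in> borel_measurable ?M2" if "i < m" "j < n" for i j
    using measurable_component_singleton[of "(j, i)" ?J "\<lambda>_. ?N"] that by (simp cong: measurable_cong_sets)
  define a where "a x i j = U1 $$ (i, j) + x (i, j)" for x :: "nat \<times> nat \<Rightarrow> real" and i j
  define b where "b y i j = U2 $$ (j, i) + y (j, i)" for y :: "nat \<times> nat \<Rightarrow> real" and i j
  define D where "D i i' j j' x y \<longleftrightarrow> i \<noteq> i' \<and> a x i j = a x i' j \<or> j \<noteq> j' \<and> b y i j = b y i j' \<or>
     i \<noteq> i' \<and> j \<noteq> j' \<and> (a x i' j - a x i j) * (b y i j' - b y i j) = (a x i j' - a x i j) * (b y i' j - b y i j)"
    for i i' j j' x y
  have single: "AE z in ?M1 \<Otimes>\<^sub>M ?M2. \<not> D i i' j j' (fst z) (snd z)"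
    if ij: "i < m" "i' < m" "j < n" "j' < n" for i i' j j'
  proof -
    have [measurable]: "(\<lambda>x. a x k l) \<in> borel_measurable ?M1" "(\<lambda>y. b y k l) \<in> borel_measurable ?M2"
      if "k < m" "l < n" for k l
      unfolding a_def b_def using c1[OF that] c2[OF that] by measurable
    note [measurable] = ij
    have meas: "{z \<in> space (?M1 \<Otimes>\<^sub>M ?M2). \<not> D i i' j j' (fst z) (snd z)} \<in> sets (?M1 \<Otimes>\<^sub>M ?M2)"
      unfolding D_def by measurable
    \<comment> \<open>\<open>y\<close> is fixed first: the collinearity equation can be solved for
      an entry of \<open>U1\<close> only after the difference of two entries of \<open>U2\<close> is
      known to be nonzero.\<close>
    have "AE y in ?M2. AE x in ?M1. \<not> D i i' j j' x y"
    proof -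
      have "AE y in ?M2. j \<noteq> j' \<longrightarrow> b y i j \<noteq> b y i j'"
      proof (cases "j = j'")
        case False
        have "AE y in ?M2. y (j, i) \<noteq> U2 $$ (j', i) + y (j', i) - U2 $$ (j, i)"
          by (rule neq) (use ij False c2 in auto)
        then show ?thesis by eventually_elim (auto simp: b_def)
      qed simp
      then show ?thesis
      proof eventually_elim
        case (elim y)
        have "AE x in ?M1. i \<noteq> i' \<longrightarrow> a x i j \<noteq> a x i' j"
        proof (cases "i = i'")
          case False
          have "AE x in ?M1. x (i, j) \<noteq> U1 $$ (i', j) + x (i', j) - U1 $$ (i, j)"
            by (rule neq) (use ij False c1 in auto)
          then show ?thesis by eventually_elim (auto simp: a_def)
        qed simp
        moreover have "AE x in ?M1. i \<noteq> i' \<and> j \<noteq> j' \<longrightarrow>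
          (a x i' j - a x i j) * (b y i j' - b y i j) \<noteq> (a x i j' - a x i j) * (b y i' j - b y i j)"
        proof (cases "i \<noteq> i' \<and> j \<noteq> j'")
          case True
          then have nz: "b y i j' - b y i j \<noteq> 0" using elim by auto
          let ?c = "(b y i' j - b y i j) / (b y i j' - b y i j)"
          \<comment> \<open>The equation solved for the coordinate \<open>(i', j)\<close>; the
            right-hand side is free of it because \<open>i \<noteq> i'\<close>.\<close>
          have "AE x in ?M1. x (i', j) \<noteq> a x i j + (a x i j' - a x i j) * ?c - U1 $$ (i', j)"
            by (rule neq) (use ij True in \<open>auto simp: a_def intro!: c1 borel_measurable_add
              borel_measurable_diff borel_measurable_times borel_measurable_divide\<close>)
          then show ?thesis
          proof eventually_elim
            case (elim x)
            then have "a x i' j - a x i j \<noteq> (a x i j' - a x i j) * ?c" by (simp add: a_def)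
            then show ?case using nz by (simp add: field_simps)
          qed
        qed auto
        ultimately show ?case
          by eventually_elim (use elim in \<open>auto simp: D_def\<close>)
      qed
    qed
    \<comment> \<open>The product measure has the \<open>U1\<close> coordinates first, so the order
      of the quantifiers is exchanged.\<close>
    then have "AE x in ?M1. AE y in ?M2. \<not> D i i' j j' x y"
      using meas by (subst AE_commute) auto
    then show ?thesis using AE_pair_measure[OF meas] by simp
  qed
  have "AE z in ?M1 \<Otimes>\<^sub>M ?M2. \<forall>i\<in>{..<m}. \<forall>i'\<in>{..<m}. \<forall>j\<in>{..<n}. \<forall>j'\<in>{..<n}. \<not> D i i' j j' (fst z) (snd z)"
    using single by (auto simp: AE_finite_all)
  then show ?thesis
    unfolding perturbation_def by eventually_elim (auto simp: degenerate_def D_def a_def b_def)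
qed

section \<open>Polynomial bounds\<close>

definition poly_bounded :: "(nat \<Rightarrow> nat \<Rightarrow> nat) \<Rightarrow> bool" where
  "poly_bounded f \<longleftrightarrow> (\<exists>c k. \<forall>m\<ge>1. \<forall>n\<ge>1. f m n \<le> c * (m + n) ^ k)"

lemma poly_bounded_const: "poly_bounded (\<lambda>m n. c)"
  unfolding poly_bounded_def by (intro exI[of _ c] exI[of _ 0]) simp

lemma poly_bounded_args: "poly_bounded (\<lambda>m n. m)" "poly_bounded (\<lambda>m n. n)"
  unfolding poly_bounded_def by (intro exI[of _ 1]; simp)+

lemma poly_bounded_add:
  assumes "poly_bounded f" "poly_bounded g"
  shows "poly_bounded (\<lambda>m n. f m n + g m n)"
proof -
  obtain c k d l where f: "\<And>m n. 1 \<le> m \<Longrightarrow> 1 \<le> n \<Longrightarrow> f m n \<le> c * (m + n) ^ k"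
    and g: "\<And>m n. 1 \<le> m \<Longrightarrow> 1 \<le> n \<Longrightarrow> g m n \<le> d * (m + n) ^ l"
    using assms unfolding poly_bounded_def by blast
  have "f m n + g m n \<le> (c + d) * (m + n) ^ (k + l)" if "1 \<le> m" "1 \<le> n" for m n
  proof -
    have "(m + n) ^ k \<le> (m + n) ^ (k + l)" "(m + n) ^ l \<le> (m + n) ^ (k + l)"
      using that by (intro power_increasing; simp)+
    then have "c * (m + n) ^ k \<le> c * (m + n) ^ (k + l)" "d * (m + n) ^ l \<le> d * (m + n) ^ (k + l)"
      by simp_all
    then show ?thesis using f[OF that] g[OF that] unfolding add_mult_distrib by linarith
  qed
  then show ?thesis unfolding poly_bounded_def by blast
qed

lemma poly_bounded_mult:
  assumes "poly_bounded f" "poly_bounded g"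
  shows "poly_bounded (\<lambda>m n. f m n * g m n)"
proof -
  obtain c k d l where f: "\<And>m n. 1 \<le> m \<Longrightarrow> 1 \<le> n \<Longrightarrow> f m n \<le> c * (m + n) ^ k"
    and g: "\<And>m n. 1 \<le> m \<Longrightarrow> 1 \<le> n \<Longrightarrow> g m n \<le> d * (m + n) ^ l"
    using assms unfolding poly_bounded_def by blast
  have "f m n * g m n \<le> (c * d) * (m + n) ^ (k + l)" if "1 \<le> m" "1 \<le> n" for m n
    using mult_mono[OF f[OF that] g[OF that]] by (simp add: power_add mult_ac)
  then show ?thesis unfolding poly_bounded_def by blast
qed

lemma poly_bounded_main_time: "poly_bounded (\<lambda>m n. main_time m n + 2)"
  unfolding main_time_def search_time_def refuted_time_def dominated_time_def degenerate_time_def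
    bil_time_def units_time_def product_time_def list_time_def dot_time_def
  by (intro poly_bounded_add poly_bounded_mult poly_bounded_args poly_bounded_const)

text \<open>The polynomial bound holds almost surely, not just on average, which is why it depends
  neither on the game nor on the size of the perturbation.\<close>

lemma smoothed_polynomial_time_prog: "smoothed_polynomial_time prog"
proof -
  obtain c k where ck: "\<And>m n. 1 \<le> m \<Longrightarrow> 1 \<le> n \<Longrightarrow> main_time m n + 2 \<le> c * (m + n) ^ k"
    using poly_bounded_main_time unfolding poly_bounded_def by blast
  show ?thesis
    unfolding smoothed_polynomial_time_def
  proof (rule exI[of _ c], rule exI[of _ k], intro allI impI ballI conjI)
    fix s :: real and m n :: nat and U1 U2 :: "real mat"
    assume s: "0 < s" and mn: "1 \<le> m" "1 \<le> n" and U: "U1 \<in> carrier_mat m n" "U2 \<in> carrier_mat n m"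
    show "perturbed_time prog U1 U2 \<in> borel_measurable (perturbation s m n)"
      by (rule measurable_perturbed_time[OF U])
    have ps: "prob_space (perturbation s m n)"
      unfolding perturbation_def using prob_space_uniform[OF s]
      by (intro prob_space_pair prob_space_PiM)
    have "AE d in perturbation s m n. perturbed_time prog U1 U2 d \<le> of_nat (c * (m + n) ^ k)"
      using AE_perturbation_generic[OF s U]
    proof eventually_elim
      case (elim d)
      let ?V1 = "U1 + mat (dim_row U1) (dim_col U1) (fst d)"
        and ?V2 = "U2 + mat (dim_row U2) (dim_col U2) (snd d)"
      have V: "?V1 \<in> carrier_mat m n" "?V2 \<in> carrier_mat n m" using U by auto
      have "degenerate m n (\<lambda>i j. ?V1 $$ (i, j)) (\<lambda>i j. ?V2 $$ (j, i)) \<longleftrightarrow>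
          degenerate m n (\<lambda>i j. U1 $$ (i, j) + fst d (i, j)) (\<lambda>i j. U2 $$ (j, i) + snd d (j, i))"
        unfolding degenerate_def by (intro ex_cong1 conj_cong refl) (use U in simp)
      with elim have "running_time prog (game_val ?V1 ?V2) \<le> of_nat (main_time m n + 2)"
        by (intro running_time_generic[OF V]) simp
      also have "\<dots> \<le> of_nat (c * (m + n) ^ k)" using ck[OF mn] by (rule of_nat_mono)
      finally show ?case by (simp add: perturbed_time_def split_def)
    qed
    then have "(\<integral>\<^sup>+ d. perturbed_time prog U1 U2 d \<partial>perturbation s m n) \<le>
        (\<integral>\<^sup>+ d. of_nat (c * (m + n) ^ k) \<partial>perturbation s m n)"
      by (rule nn_integral_mono_AE)
    also have "\<dots> = of_nat (c * (m + n) ^ k)"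
      by (simp only: nn_integral_const prob_space.emeasure_space_1[OF ps] mult_1_right)
    finally show "(\<integral>\<^sup>+ d. perturbed_time prog U1 U2 d \<partial>perturbation s m n) \<le> of_nat (c * (m + n) ^ k)" .
  qed
qed

theorem theorem3p3:
  "\<exists>P :: program. finds_strong_nash P \<and> smoothed_polynomial_time P"
  using finds_strong_nash_prog smoothed_polynomial_time_prog by blast

end
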